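(* Let $\varphi\in\mathcal I$ and let $G:(0,\infty)\times S^{n-1}\to(0,\infty)$ be a continuous function such that, for some $q\in(1-n,0)$, $$\inf\Big\{\frac{G(t,u)}{t^q}:\ t\ge1,\ u\in S^{n-1}\Big\}>0.$$ i) Let $\mu$ be a nonzero finite Borel measure on $S^{n-1}$ whose support is not concentrated on any closed hemisphere. Then there exist $M_1,M_2\in\mathcal B$ such that $$\int_{S^{n-1}}\varphi(h_{M_1}(u))\,d\mu(u)=\inf_{Q\in\mathcal B}\int_{S^{n-1}}\varphi(h_Q(u))\,d\mu(u)\quad\text{and}\quad \|h_{M_2}\|_{\mu,\varphi}=\inf_{Q\in\mathcal B}\|h_Q\|_{\mu,\varphi}.$$ ii) Let $\mu_i$ ($i\in\mathbb N$) and $\mu$ be nonzero finite Borel measures on $S^{n-1}$ whose supports are not concentrated on any closed hemisphere, such that $\mu_i\to\mu$ weakly as $i\to\infty$. Then $$\lim_{i\to\infty}\Big(\inf_{Q\in\mathcal B}\int_{S^{n-1}}\varphi(h_Q(u))\,d\mu_i(u)\Big)=\inf_{Q\in\mathcal B}\int_{S^{n-1}}\varphi(h_Q(u))\,d\mu(u),$$ $$\lim_{i\to\infty}\Big(\inf_{Q\in\mathcal B}\|h_Q\|_{\mu_i,\varphi}\Big)=\inf_{Q\in\mathcal B}\|h_Q\|_{\mu,\varphi}.$$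
   Context: Work in $\mathbb R^n$, $n\ge2$, with inner product $\langle\cdot,\cdot\rangle$, unit ball $B^n$ and unit sphere $S^{n-1}$. $\mathcal K_{(o)}^n$ is the set of compact convex subsets of $\mathbb R^n$ with the origin $o$ in their interiors. For $K\in\mathcal K_{(o)}^n$: $h_K(u)=\max_{x\in K}\langle x,u\rangle$ for $u\in S^{n-1}$, $K^\circ=\{x\in\mathbb R^n:\langle x,y\rangle\le1\ \forall y\in K\}$, and $S_K$ is the surface area measure of $K$ on $S^{n-1}$, $S_K(\eta)=\mathcal H^{n-1}(\nu_K^{-1}(\eta))$ for Borel $\eta\subset S^{n-1}$, where $\nu_K$ is the Gauss map of $K$ (so $\nu_K^{-1}(\eta)$ is the set of boundary points of $K$ having an outer unit normal in $\eta$). The general volume of $K\in\mathcal K_{(o)}^n$ is $V_G(K)=\int_{S^{n-1}}G(h_K(u),u)\,dS_K(u)$, and $$\mathcal B=\{Q\in\mathcal K_{(o)}^n:\ V_G(Q^\circ)=V_G(B^n)\}.$$ $\mathcal I$ is the set of continuous strictly increasing functions $\varphi:(0,\infty)\to(0,\infty)$ with $\lim_{t\to0^+}\varphi(t)=0$, $\varphi(1)=1$, $\lim_{t\to\infty}\varphi(t)=\infty$. For $\varphi\in\mathcal I$, a nonzero finite Borel measure $\mu$ on $S^{n-1}$ and $Q\in\mathcal K_{(o)}^n$, the "Orlicz norm" is $$\|h_Q\|_{\mu,\varphi}=\inf\Big\{\lambda>0:\ \frac1{\mu(S^{n-1})}\int_{S^{n-1}}\varphi\Big(\frac{h_Q(u)}{\lambda}\Big)\,d\mu(u)\le1\Big\}.$$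 The support of a finite Borel measure $\mu$ on $S^{n-1}$ is not concentrated on any closed hemisphere if $\mu(\{u\in S^{n-1}:\langle u,v\rangle>0\})>0$ for every $v\in S^{n-1}$. Weak convergence $\mu_i\to\mu$ means $\int f\,d\mu_i\to\int f\,d\mu$ for every continuous $f$ on $S^{n-1}$. *)

theory Defs
  imports "HOL-Analysis.Analysis"
begin

definition convex_bodies_o :: "'a::euclidean_space set set" where
  "convex_bodies_o = {K. compact K \<and> convex K \<and> 0 \<in> interior K}"

definition support_fun :: "'a::euclidean_space set \<Rightarrow> 'a \<Rightarrow> real" where
  "support_fun K u = (SUP x\<in>K. x \<bullet> u)"

definition polar_body :: "'a::euclidean_space set \<Rightarrow> 'a set" where
  "polar_body K = {x. \<forall>y\<in>K. x \<bullet> y \<le> 1}"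

text \<open>
  The $k$-dimensional Hausdorff (outer) measure for \<open>k \<ge> 1\<close>, normalised so that it agrees with
  Lebesgue measure on \<open>k\<close>-dimensional Euclidean space. Covering sets are required to be bounded
  because \<^const>\<open>diameter\<close> is not meaningful for unbounded sets.
\<close>

definition hausdorff_premeasure :: "nat \<Rightarrow> real \<Rightarrow> 'a::metric_space set \<Rightarrow> ennreal" where
  "hausdorff_premeasure k \<delta> A =
     (INF C \<in> {C :: nat \<Rightarrow> 'a set. A \<subseteq> (\<Union>i. C i) \<and> (\<forall>i. bounded (C i) \<and> diameter (C i) \<le> \<delta>)}.
        (\<Sum>i. ennreal (unit_ball_vol (real k) * (diameter (C i) / 2) ^ k)))"

definition hausdorff_measure :: "nat \<Rightarrow> 'a::metric_space set \<Rightarrow> ennreal" where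
  "hausdorff_measure k A = (SUP \<delta> \<in> {0<..}. hausdorff_premeasure k \<delta> A)"

abbreviation borel_sphere :: "'a::euclidean_space measure" where
  "borel_sphere \<equiv> restrict_space borel (sphere 0 1)"

definition outer_unit_normals :: "'a::euclidean_space set \<Rightarrow> 'a \<Rightarrow> 'a set" where
  "outer_unit_normals K x = {u \<in> sphere 0 1. \<forall>y\<in>K. (y - x) \<bullet> u \<le> 0}"

text \<open>
  The Gauss map is read as a multivalued map. Boundary points with more than one outer unit normal
  form a null set for the \<open>(n - 1)\<close>-dimensional Hausdorff measure, so for convex bodies the set
  function in \<open>surface_area_measure\<close> is countably additive, as \<^const>\<open>measure_of\<close> needs.
\<close>

definition gauss_preimage :: "'a::euclidean_space set \<Rightarrow> 'a set \<Rightarrow> 'a set" where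
  "gauss_preimage K \<eta> = {x \<in> frontier K. outer_unit_normals K x \<inter> \<eta> \<noteq> {}}"

definition surface_area_measure :: "'a::euclidean_space set \<Rightarrow> 'a measure" where
  "surface_area_measure K =
     measure_of (sphere 0 1) (sets borel_sphere)
       (\<lambda>\<eta>. hausdorff_measure (DIM('a) - 1) (gauss_preimage K \<eta>))"

definition nonzero_finite_sphere_measure :: "'a::euclidean_space measure \<Rightarrow> bool" where
  "nonzero_finite_sphere_measure \<mu> \<longleftrightarrow>
     sets \<mu> = sets borel_sphere \<and> finite_measure \<mu> \<and> emeasure \<mu> (sphere 0 1) \<noteq> 0"

definition not_concentrated_on_hemisphere :: "'a::euclidean_space measure \<Rightarrow> bool" where
  "not_concentrated_on_hemisphere \<mu> \<longleftrightarrow>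
     (\<forall>v\<in>sphere 0 1. emeasure \<mu> {u \<in> sphere 0 1. u \<bullet> v > 0} > 0)"

definition weakly_converges :: "(nat \<Rightarrow> 'a::euclidean_space measure) \<Rightarrow> 'a measure \<Rightarrow> bool" where
  "weakly_converges \<mu>s \<mu> \<longleftrightarrow>
     (\<forall>f :: 'a \<Rightarrow> real. continuous_on (sphere 0 1) f \<longrightarrow>
        (\<lambda>i. \<integral>u. f u \<partial>\<mu>s i) \<longlonglongrightarrow> (\<integral>u. f u \<partial>\<mu>))"

definition general_volume :: "(real \<Rightarrow> 'a::euclidean_space \<Rightarrow> real) \<Rightarrow> 'a set \<Rightarrow> real" where
  "general_volume G K = (\<integral>u. G (support_fun K u) u \<partial>surface_area_measure K)"

definition body_class :: "(real \<Rightarrow> 'a::euclidean_space \<Rightarrow> real) \<Rightarrow> 'a set set" where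
  "body_class G =
     {Q \<in> convex_bodies_o. general_volume G (polar_body Q) = general_volume G (cball 0 1)}"

text \<open>
  Functions on $(0,\infty)$ are represented by total functions on the reals that are only
  constrained, and only evaluated, on \<open>{0<..}\<close>.
\<close>

definition orlicz_fun :: "(real \<Rightarrow> real) \<Rightarrow> bool" where
  "orlicz_fun \<phi> \<longleftrightarrow>
     continuous_on {0<..} \<phi> \<and> strict_mono_on {0<..} \<phi> \<and> (\<forall>t>0. \<phi> t > 0) \<and>
     (\<phi> \<longlongrightarrow> 0) (at_right 0) \<and> \<phi> 1 = 1 \<and> filterlim \<phi> at_top at_top"

definition orlicz_norm :: "'a measure \<Rightarrow> (real \<Rightarrow> real) \<Rightarrow> ('a \<Rightarrow> real) \<Rightarrow> real" where
  "orlicz_norm \<mu> \<phi> f =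
     Inf {l. l > 0 \<and> 1 / measure \<mu> (space \<mu>) * (\<integral>u. \<phi> (f u / l) \<partial>\<mu>) \<le> 1}"

end

theory Submission
  imports Defs "HOL-Complex_Analysis.Great_Picard"
begin

text \<open>
  The support function \<open>g\<close> of \<open>Q\<close> is the gauge of the polar body \<open>K = {g \<le> 1}\<close>. At a boundary point where
  \<open>g\<close> is differentiable the outer unit normal is \<open>\<nabla>g / |\<nabla>g|\<close> and the support function of \<open>K\<close> in that
  direction is \<open>1 / |\<nabla>g|\<close>. An area formula identifies the surface area measure of \<open>K\<close> with the image of
  \<open>\<kappa> n |\<nabla>g| dz\<close> on \<open>K\<close> under \<open>\<nabla>g / |\<nabla>g|\<close>, where the constant \<open>\<kappa>\<close>, the normalisation of the Hausdorff
  measure on hyperplanes, does not depend on \<open>K\<close>. Hence the general volume of \<open>K\<close> is the integral over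
  \<open>K\<close> of a fixed function of \<open>\<nabla>g\<close>.

  Continuity follows by dominated convergence, because gradients of convex functions converge almost
  everywhere. For the growth, let \<open>V\<close> be the volume of \<open>K\<close>: averaging translates gives
  \<open>\<integral>\<^sub>K |\<nabla>g| \<ge> c V\<^bsup>1 - 1/n\<^esup>\<close>, so with \<open>s = 1 - q < n\<close> the general volume is at least a multiple of
  \<open>\<integral>\<^sub>K |\<nabla>g|\<^bsup>s\<^esup> \<ge> c' V\<^bsup>1 - s/n\<^esup>\<close>. A bound on the general volume therefore bounds \<open>V\<close>, and then the diameter of
  \<open>K\<close> once \<open>K\<close> contains a fixed ball; that is, \<open>Q\<close> contains a fixed ball. With selection of convergent
  support functions and a bound on minimising sequences, both parts follow.
\<close>

subsection \<open>Hausdorff measure as a Borel measure\<close>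

text \<open>The constant \<kappa> enters the general volumes of the polar body and of the ball as
  the same factor, so its value drops out of the constraint; what must be known is that it is
  positive, finite and the same for every direction. The obstacle is that the surface area measures
  of a convergent sequence of bodies live on moving boundaries: rewriting them over Lebesgue measure
  replaces their weak convergence by pointwise convergence of gradients. The hypothesis q > 1 - n
  appears as s < n. It makes the exponent 1 - s/n of the volume positive, and this is what turns a
  bound on the general volume into a bound on the volume. The radii play dual roles: an outer ball
  of Q bounds the gradient of the support function from above and hence the support values of the
  polar body from below, where G is compared with \<open>t powr q\<close>; the resulting outer
  radius of the polar body yields an inner radius of Q.\<close>

lemma hausdorff_premeasure_mono:
  "A \<subseteq> B \<Longrightarrow> hausdorff_premeasure k \<delta> A \<le> hausdorff_premeasure k \<delta> B"
  unfolding hausdorff_premeasure_def by (rule INF_superset_mono) auto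

lemma hausdorff_premeasure_antimono:
  "\<delta> \<le> \<delta>' \<Longrightarrow> hausdorff_premeasure k \<delta>' A \<le> hausdorff_premeasure k \<delta> A"
  unfolding hausdorff_premeasure_def by (rule INF_superset_mono) (auto intro: order_trans)

lemma hausdorff_premeasure_le:
  assumes "A \<subseteq> (\<Union>i. C i)" "\<And>i. bounded (C i)" "\<And>i. diameter (C i) \<le> \<delta>"
  shows "hausdorff_premeasure k \<delta> A \<le> (\<Sum>i. ennreal (unit_ball_vol (real k) * (diameter (C i) / 2) ^ k))"
  unfolding hausdorff_premeasure_def by (rule INF_lower) (use assms in auto)

lemma hausdorff_premeasure_cover:
  assumes "hausdorff_premeasure k \<delta> A < c"
  obtains C where "A \<subseteq> (\<Union>i. C i)" "\<And>i. bounded (C i)" "\<And>i. diameter (C i) \<le> \<delta>"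
    "(\<Sum>i. ennreal (unit_ball_vol (real k) * (diameter (C i) / 2) ^ k)) < c"
  using assms unfolding hausdorff_premeasure_def INF_less_iff by blast

lemma hausdorff_premeasure_empty:
  assumes "k \<ge> 1" "\<delta> \<ge> 0" shows "hausdorff_premeasure k \<delta> ({} :: 'a::metric_space set) = 0"
  using hausdorff_premeasure_le[of "{} :: 'a set" "\<lambda>_. {}" \<delta> k] assms by (simp add: power_0_left)

text \<open>Cover each \<open>A i\<close> with excess e/2^(i+1) and enumerate the double family by
  \<open>prod_decode\<close>; the excesses add up to e. The reduction to a finite sum on the right
  makes each premeasure finite, so that adding a positive number strictly increases it.\<close>

lemma hausdorff_premeasure_UN_le:
  fixes A :: "nat \<Rightarrow> 'a::metric_space set"
  shows "hausdorff_premeasure k \<delta> (\<Union>i. A i) \<le> (\<Sum>i. hausdorff_premeasure k \<delta> (A i))"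
proof (rule ennreal_le_epsilon)
  fix e :: real
  assume fin: "(\<Sum>i. hausdorff_premeasure k \<delta> (A i)) < top" and e: "0 < e"
  let ?v = "\<lambda>C::'a set. ennreal (unit_ball_vol (real k) * (diameter C / 2) ^ k)"
  have fin': "hausdorff_premeasure k \<delta> (A i) < top" for i
  proof -
    have "hausdorff_premeasure k \<delta> (A i) \<le> (\<Sum>i. hausdorff_premeasure k \<delta> (A i))"
      using sum_le_suminf[OF summableI, of "{i}" "\<lambda>i. hausdorff_premeasure k \<delta> (A i)"] by simp
    with fin show ?thesis by (rule le_less_trans[rotated])
  qed
  have "\<exists>C. A i \<subseteq> (\<Union>j. C j) \<and> (\<forall>j. bounded (C j) \<and> diameter (C j) \<le> \<delta>) \<and>
      (\<Sum>j. ?v (C j)) \<le> hausdorff_premeasure k \<delta> (A i) + ennreal (e * (1/2) ^ Suc i)" for i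
  proof -
    have "hausdorff_premeasure k \<delta> (A i) < hausdorff_premeasure k \<delta> (A i) + ennreal (e * (1/2) ^ Suc i)"
      using fin'[of i] e
      by (metis add_0_right ennreal_0 ennreal_add_left_cancel_less ennreal_less_zero_iff ennreal_less_iff
          half_gt_zero_iff less_irrefl mult_pos_pos zero_less_one zero_less_power infinity_ennreal_def order_refl)
    from hausdorff_premeasure_cover[OF this] show ?thesis by (metis less_imp_le)
  qed
  then obtain C where C: "\<And>i. A i \<subseteq> (\<Union>j. C i j)" "\<And>i j. bounded (C i j)" "\<And>i j. diameter (C i j) \<le> \<delta>"
    "\<And>i. (\<Sum>j. ?v (C i j)) \<le> hausdorff_premeasure k \<delta> (A i) + ennreal (e * (1/2) ^ Suc i)"
    by metis
  define D where "D n = case_prod C (prod_decode n)" for n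
  have "hausdorff_premeasure k \<delta> (\<Union>i. A i) \<le> (\<Sum>n. ?v (D n))"
  proof (rule hausdorff_premeasure_le)
    show "(\<Union>i. A i) \<subseteq> (\<Union>n. D n)"
    proof
      fix x assume "x \<in> (\<Union>i. A i)"
      then obtain i j where "x \<in> C i j" using C(1) by blast
      then have "x \<in> D (prod_encode (i, j))" by (simp add: D_def)
      then show "x \<in> (\<Union>n. D n)" by blast
    qed
  qed (use C in \<open>auto simp: D_def split: prod.split\<close>)
  also have "\<dots> = (\<Sum>n. (\<lambda>(i, j). ?v (C i j)) (prod_decode n))"
    by (simp add: D_def case_prod_beta)
  also have "\<dots> = (\<Sum>i. \<Sum>j. ?v (C i j))"
    by (intro suminf_ennreal_2dimen) simp
  also have "\<dots> \<le> (\<Sum>i. hausdorff_premeasure k \<delta> (A i) + ennreal (e * (1/2) ^ Suc i))"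
    by (intro suminf_le C summableI)
  also have "\<dots> = (\<Sum>i. hausdorff_premeasure k \<delta> (A i)) + (\<Sum>i. ennreal (e * (1/2) ^ Suc i))"
    by (intro suminf_add[symmetric] summableI)
  also have "(\<Sum>i. ennreal (e * (1/2) ^ Suc i)) = ennreal e"
  proof -
    have "(\<lambda>i. e * (1/2) ^ Suc i) sums (e * 1)"
      by (intro sums_mult power_half_series)
    then show ?thesis using e by (subst suminf_ennreal_eq) auto
  qed
  finally show "hausdorff_premeasure k \<delta> (\<Union>i. A i) \<le> (\<Sum>i. hausdorff_premeasure k \<delta> (A i)) + ennreal e" .
qed

lemma hausdorff_premeasure_le_measure:
  "\<delta> > 0 \<Longrightarrow> hausdorff_premeasure k \<delta> A \<le> hausdorff_measure k A"
  unfolding hausdorff_measure_def by (rule SUP_upper) auto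

text \<open>A sequence of scales suffices because premeasures increase as the scale shrinks; an
  increasing sequence is what commuting sums with suprema needs.\<close>

lemma hausdorff_measure_eq_SUP_nat:
  "hausdorff_measure k A = (SUP n. hausdorff_premeasure k (inverse (real (Suc n))) A)"
proof (rule antisym)
  show "hausdorff_measure k A \<le> (SUP n. hausdorff_premeasure k (inverse (real (Suc n))) A)"
    unfolding hausdorff_measure_def
  proof (rule SUP_mono)
    fix \<delta> :: real assume "\<delta> \<in> {0<..}"
    then obtain n where "inverse (real (Suc n)) < \<delta>" using reals_Archimedean by auto
    then show "\<exists>n\<in>UNIV. hausdorff_premeasure k \<delta> A \<le> hausdorff_premeasure k (inverse (real (Suc n))) A"
      by (intro bexI[of _ n] hausdorff_premeasure_antimono) auto
  qed
qed (auto intro!: SUP_least hausdorff_premeasure_le_measure)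

lemma hausdorff_measure_mono: "A \<subseteq> B \<Longrightarrow> hausdorff_measure k A \<le> hausdorff_measure k B"
  unfolding hausdorff_measure_def by (intro SUP_mono) (auto intro: hausdorff_premeasure_mono)

lemma hausdorff_measure_empty: "k \<ge> 1 \<Longrightarrow> hausdorff_measure k {} = 0"
  unfolding hausdorff_measure_eq_SUP_nat by (simp add: hausdorff_premeasure_empty)

lemma hausdorff_measure_UN_le:
  "hausdorff_measure k (\<Union>i::nat. A i) \<le> (\<Sum>i. hausdorff_measure k (A i))"
  unfolding hausdorff_measure_def[of k "\<Union>i. A i"]
proof (rule SUP_least)
  fix \<delta> :: real assume "\<delta> \<in> {0<..}"
  then show "hausdorff_premeasure k \<delta> (\<Union>i. A i) \<le> (\<Sum>i. hausdorff_measure k (A i))"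
    by (intro order_trans[OF hausdorff_premeasure_UN_le] suminf_le summableI hausdorff_premeasure_le_measure) auto
qed

lemma hausdorff_measure_Un_le:
  assumes "k \<ge> 1"
  shows "hausdorff_measure k (A \<union> B) \<le> hausdorff_measure k A + hausdorff_measure k B"
proof -
  let ?F = "\<lambda>i::nat. if i = 0 then A else if i = 1 then B else {}"
  have "hausdorff_measure k (A \<union> B) \<le> hausdorff_measure k (\<Union>i. ?F i)"
  proof (rule hausdorff_measure_mono)
    have "A = ?F 0" "B = ?F 1" by auto
    then show "A \<union> B \<subseteq> (\<Union>i. ?F i)" by blast
  qed
  also have "\<dots> \<le> (\<Sum>i. hausdorff_measure k (?F i))" by (rule hausdorff_measure_UN_le)
  also have "\<dots> = (\<Sum>i\<in>{0,1}. hausdorff_measure k (?F i))"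
    by (rule suminf_finite) (use hausdorff_measure_empty[OF assms] in auto)
  finally show ?thesis by simp
qed

lemma hausdorff_measure_finite_UN_le:
  assumes "k \<ge> 1" "finite I"
  shows "hausdorff_measure k (\<Union>i\<in>I. A i) \<le> (\<Sum>i\<in>I. hausdorff_measure k (A i))"
  using assms(2)
proof induction
  case (insert i I)
  then show ?case
    using hausdorff_measure_Un_le[OF assms(1), of "A i" "\<Union>i\<in>I. A i"] by (simp add: add_left_mono order_trans)
qed (simp add: hausdorff_measure_empty[OF assms(1)])

text \<open>A set of diameter at most \<delta> cannot meet two sets that are more than \<delta>
  apart, so every cover splits into one for A and one for B that share no member.\<close>

lemma hausdorff_premeasure_separated:
  assumes k: "k \<ge> 1" and d: "\<delta> < d" and sep: "\<And>x y. x \<in> A \<Longrightarrow> y \<in> B \<Longrightarrow> d \<le> dist x y"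
  shows "hausdorff_premeasure k \<delta> A + hausdorff_premeasure k \<delta> B \<le> hausdorff_premeasure k \<delta> (A \<union> B)"
proof -
  let ?v = "\<lambda>C::'a set. ennreal (unit_ball_vol (real k) * (diameter C / 2) ^ k)"
  show ?thesis
    unfolding hausdorff_premeasure_def[of k \<delta> "A \<union> B"]
  proof (rule INF_greatest)
    fix C :: "nat \<Rightarrow> 'a set"
    assume "C \<in> {C. A \<union> B \<subseteq> (\<Union>i. C i) \<and> (\<forall>i. bounded (C i) \<and> diameter (C i) \<le> \<delta>)}"
    then have C: "A \<union> B \<subseteq> (\<Union>i. C i)" "\<And>i. bounded (C i)" "\<And>i. diameter (C i) \<le> \<delta>" by auto
    define CA where "CA i = (if C i \<inter> A \<noteq> {} then C i else {})" for i
    define CB where "CB i = (if C i \<inter> B \<noteq> {} then C i else {})" for i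
    have \<delta>: "0 \<le> \<delta>" using C(2,3) diameter_ge_0 order_trans by blast
    have 1: "hausdorff_premeasure k \<delta> A \<le> (\<Sum>i. ?v (CA i))"
      by (rule hausdorff_premeasure_le) (use C \<delta> in \<open>fastforce simp: CA_def\<close>)+
    have 2: "hausdorff_premeasure k \<delta> B \<le> (\<Sum>i. ?v (CB i))"
      by (rule hausdorff_premeasure_le) (use C \<delta> in \<open>fastforce simp: CB_def\<close>)+
    have no: "\<not> (C i \<inter> A \<noteq> {} \<and> C i \<inter> B \<noteq> {})" for i
    proof
      assume "C i \<inter> A \<noteq> {} \<and> C i \<inter> B \<noteq> {}"
      then obtain x y where "x \<in> C i" "x \<in> A" "y \<in> C i" "y \<in> B" by auto
      with sep[of x y] diameter_bounded_bound[OF C(2)[of i], of x y] C(3)[of i] d show False by linarith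
    qed
    have v0: "?v {} = 0" using k by (simp add: power_0_left)
    have "(\<Sum>i. ?v (CA i)) + (\<Sum>i. ?v (CB i)) = (\<Sum>i. ?v (CA i) + ?v (CB i))"
      by (intro suminf_add summableI)
    also have "\<dots> \<le> (\<Sum>i. ?v (C i))"
    proof (intro suminf_le summableI)
      fix i show "?v (CA i) + ?v (CB i) \<le> ?v (C i)"
        using no[of i] v0 by (cases "C i \<inter> A = {}"; cases "C i \<inter> B = {}") (auto simp: CA_def CB_def power_0_left)
    qed
    finally show "hausdorff_premeasure k \<delta> A + hausdorff_premeasure k \<delta> B \<le> (\<Sum>i. ?v (C i))"
      using add_mono[OF 1 2] by (rule order_trans[rotated])
  qed
qed

lemma hausdorff_measure_separated:
  assumes k: "k \<ge> 1" and d: "0 < d" and sep: "\<And>x y. x \<in> A \<Longrightarrow> y \<in> B \<Longrightarrow> d \<le> dist x y"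
  shows "hausdorff_measure k A + hausdorff_measure k B \<le> hausdorff_measure k (A \<union> B)"
proof -
  let ?p = "\<lambda>n. hausdorff_premeasure k (inverse (real (Suc n)))"
  have inc: "incseq (\<lambda>n. ?p n X)" for X :: "'a set"
    by (auto intro!: incseq_SucI hausdorff_premeasure_antimono simp: field_simps)
  have "hausdorff_measure k A + hausdorff_measure k B = (SUP n. ?p n A + ?p n B)"
    unfolding hausdorff_measure_eq_SUP_nat by (rule ennreal_SUP_add[OF inc inc, symmetric])
  also have "\<dots> \<le> hausdorff_measure k (A \<union> B)"
  proof (rule SUP_least)
    fix n
    obtain m where m: "inverse (real (Suc m)) < d" using reals_Archimedean d by blast
    define N where "N = max m n"
    have N: "inverse (real (Suc N)) < d"
      using m by (rule le_less_trans[rotated]) (simp add: N_def field_simps)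
    have "?p n A + ?p n B \<le> ?p N A + ?p N B"
      using inc by (intro add_mono) (auto simp: N_def incseq_def)
    also have "\<dots> \<le> ?p N (A \<union> B)" by (rule hausdorff_premeasure_separated[OF k N sep])
    also have "\<dots> \<le> hausdorff_measure k (A \<union> B)" by (intro hausdorff_premeasure_le_measure) auto
    finally show "?p n A + ?p n B \<le> hausdorff_measure k (A \<union> B)" .
  qed
  finally show ?thesis .
qed

text \<open>Caratheodory's argument for a metric outer measure. The part \<open>T j\<close> of S at
  distance at least 1/(j+1) from F is separated from F; the rest of S - F is cut into the shells
  \<open>R i\<close>, and the tail of their total measure tends to 0.\<close>

lemma hausdorff_measure_caratheodory_closed:
  assumes k: "k \<ge> 1" and F: "closed F"
  shows "hausdorff_measure k (S \<inter> F) + hausdorff_measure k (S - F) \<le> hausdorff_measure k S"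
proof (cases "hausdorff_measure k S = top \<or> F = {}")
  case True
  then show ?thesis by (auto simp: hausdorff_measure_empty[OF k])
next
  case False
  then have fin: "hausdorff_measure k S \<noteq> top" and ne: "F \<noteq> {}" by auto
  let ?H = "hausdorff_measure k"
  define T where "T j = {x \<in> S - F. 1 / real (j + 1) \<le> infdist x F}" for j
  define R where "R j = {x \<in> S - F. 1 / real (j + 2) \<le> infdist x F \<and> infdist x F < 1 / real (j + 1)}" for j
  have near: "infdist x F \<le> dist x y + infdist y F" for x y
    using infdist_triangle[of x F y] by (simp add: add.commute)
  have part: "?H (S \<inter> F) + ?H (T j) \<le> ?H S" for j
  proof -
    have "?H (S \<inter> F) + ?H (T j) \<le> ?H ((S \<inter> F) \<union> T j)"
    proof (rule hausdorff_measure_separated[OF k])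
      fix x y assume "x \<in> S \<inter> F" "y \<in> T j"
      then show "1 / real (j + 1) \<le> dist x y"
        using near[of y x] by (auto simp: T_def dist_commute infdist_zero)
    qed simp
    also have "\<dots> \<le> ?H S" by (rule hausdorff_measure_mono) (auto simp: T_def)
    finally show ?thesis .
  qed
  \<comment> \<open>Shells whose indices differ by at least 2 have a gap between them, so the shells
    of one parity add up to at most \<open>H S\<close>; even and odd shells together have finite
    total measure.\<close>
  have fin_par: "(\<Sum>j<N. ?H (R (2 * j + p))) \<le> ?H S" for N p
  proof -
    have "(\<Sum>j<N. ?H (R (2 * j + p))) \<le> ?H (\<Union>j<N. R (2 * j + p))"
    proof (induction N)
      case (Suc N)
      let ?d = "1 / real (2 * N + p) - 1 / real (2 * N + p + 1)"
      have "?H (\<Union>j<N. R (2 * j + p)) + ?H (R (2 * N + p)) \<le> ?H ((\<Union>j<N. R (2 * j + p)) \<union> R (2 * N + p))"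
      proof (cases "N = 0")
        case True then show ?thesis by (simp add: hausdorff_measure_empty[OF k])
      next
        case N: False
        show ?thesis
        proof (rule hausdorff_measure_separated[OF k, of ?d])
          show "0 < ?d" using N by (simp add: divide_strict_left_mono)
          fix x y assume x: "x \<in> (\<Union>j<N. R (2 * j + p))" and y: "y \<in> R (2 * N + p)"
          then obtain j where j: "j < N" "x \<in> R (2 * j + p)" by auto
          have "1 / real (2 * N + p) \<le> 1 / real (2 * j + p + 2)"
            using j(1) by (intro divide_left_mono) auto
          also have "\<dots> \<le> infdist x F" using j(2) by (simp add: R_def)
          finally show "?d \<le> dist x y" using y near[of x y] by (auto simp: R_def)
        qed
      qed
      note step = this
      have "(\<Sum>j<Suc N. ?H (R (2 * j + p))) = (\<Sum>j<N. ?H (R (2 * j + p))) + ?H (R (2 * N + p))"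
        by (rule sum.lessThan_Suc)
      also have "\<dots> \<le> ?H (\<Union>j<N. R (2 * j + p)) + ?H (R (2 * N + p))"
        by (rule add_right_mono[OF Suc.IH])
      also note step
      also have "(\<Union>j<N. R (2 * j + p)) \<union> R (2 * N + p) = (\<Union>j<Suc N. R (2 * j + p))"
        by (auto simp: lessThan_Suc)
      finally show ?case .
    qed (simp add: hausdorff_measure_empty[OF k])
    also have "\<dots> \<le> ?H S" by (rule hausdorff_measure_mono) (auto simp: R_def)
    finally show ?thesis .
  qed
  have sumR: "(\<Sum>j. ?H (R j)) \<noteq> top"
  proof -
    have "(\<Sum>j<N. ?H (R j)) \<le> ?H S + ?H S" for N
    proof -
      have "(\<Sum>j<N. ?H (R j)) \<le> (\<Sum>j<2 * N. ?H (R j))"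
        by (rule sum_mono2) auto
      also have "\<dots> = (\<Sum>j<N. ?H (R (2 * j + 0))) + (\<Sum>j<N. ?H (R (2 * j + 1)))"
        by (induction N) (simp_all add: ac_simps)
      also have "\<dots> \<le> ?H S + ?H S" by (intro add_mono fin_par)
      finally show ?thesis .
    qed
    then have "(\<Sum>j. ?H (R j)) \<le> ?H S + ?H S"
      by (intro suminf_le_const summableI)
    with fin show ?thesis by (auto simp: top_unique)
  qed
  have finR: "?H (R j) < top" for j
  proof -
    have "?H (R j) \<le> (\<Sum>j. ?H (R j))"
      using sum_le_suminf[OF summableI, of "{j}" "\<lambda>j. ?H (R j)"] by simp
    also have "\<dots> < top" using sumR by (simp add: less_top)
    finally show ?thesis .
  qed
  \<comment> \<open>Tails of a convergent series vanish; the statement is taken from the real-valued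
    case, hence the passage through \<open>enn2real\<close>.\<close>
  have lim0: "(\<lambda>j. \<Sum>i. ?H (R (i + j))) \<longlonglongrightarrow> 0"
  proof -
    have "summable (\<lambda>j. enn2real (?H (R j)))"
    proof (rule summableI_nonneg_bounded)
      fix N
      have "ennreal (\<Sum>j<N. enn2real (?H (R j))) = (\<Sum>j<N. ?H (R j))"
      proof -
                show ?thesis using finR by (subst sum_ennreal[symmetric]) auto
      qed
      also have "\<dots> \<le> (\<Sum>j. ?H (R j))" by (intro sum_le_suminf summableI) auto
      finally have le: "ennreal (\<Sum>j<N. enn2real (?H (R j))) \<le> (\<Sum>j. ?H (R j))" .
      have "0 \<le> (\<Sum>j<N. enn2real (?H (R j)))" by (intro sum_nonneg) simp
      then show "(\<Sum>j<N. enn2real (?H (R j))) \<le> enn2real (\<Sum>j. ?H (R j))"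
        using enn2real_mono[OF le] sumR by (simp add: less_top)
    qed simp
    then have "(\<lambda>j. \<Sum>i. enn2real (?H (R (i + j)))) \<longlonglongrightarrow> 0"
      by (rule suminf_exist_split2)
    then have "(\<lambda>j. ennreal (\<Sum>i. enn2real (?H (R (i + j))))) \<longlonglongrightarrow> ennreal 0"
      by (rule tendsto_ennrealI)
    moreover have "ennreal (\<Sum>i. enn2real (?H (R (i + j)))) = (\<Sum>i. ?H (R (i + j)))" for j
    proof -
            have "summable (\<lambda>i. enn2real (?H (R (i + j))))"
        using \<open>summable (\<lambda>j. enn2real (?H (R j)))\<close> by (rule summable_ignore_initial_segment)
      then show ?thesis
        using finR by (subst suminf_ennreal2[symmetric]) auto
    qed
    ultimately show ?thesis by simp
  qed
  have "?H (S \<inter> F) + ?H (S - F) \<le> ?H S + (\<Sum>i. ?H (R (i + j)))" for j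
  proof -
    have "S - F \<subseteq> T j \<union> (\<Union>i. R (i + j))"
    proof
      fix x assume x: "x \<in> S - F"
      then have pos: "0 < infdist x F"
        using infdist_pos_not_in_closed[OF F ne] by auto
      show "x \<in> T j \<union> (\<Union>i. R (i + j))"
      proof (cases "x \<in> T j")
        case False
        then have l: "infdist x F < 1 / real (j + 1)" using x by (auto simp: T_def)
        \<comment> \<open>The least m with 1/(m+1) \<le> \<open>infdist x F\<close> exceeds j
          because x is not in \<open>T j\<close>, and its predecessor is the index of the shell
          containing x.\<close>
        define m where "m = (LEAST m. 1 / real (m + 1) \<le> infdist x F)"
        obtain m0 where "inverse (real (Suc m0)) < infdist x F" using reals_Archimedean pos by blast
        then have "1 / real (m0 + 1) \<le> infdist x F" by (simp add: inverse_eq_divide)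
        then have m: "1 / real (m + 1) \<le> infdist x F" unfolding m_def by (rule LeastI)
        have "j < m"
        proof (rule ccontr)
          assume "\<not> j < m"
          then have "1 / real (j + 1) \<le> 1 / real (m + 1)" by (intro divide_left_mono) auto
          with m l show False by linarith
        qed
        then obtain i where i: "m = i + j + 1" using less_imp_add_positive[of j m] by (metis Suc_eq_plus1 add.commute less_imp_Suc_add)
        have "\<not> 1 / real (i + j + 1) \<le> infdist x F"
          using not_less_Least[of "i + j" "\<lambda>m. 1 / real (m + 1) \<le> infdist x F"] i by (simp add: m_def)
        with m i x have "x \<in> R (i + j)" by (auto simp: R_def add.commute add.left_commute)
        then show ?thesis by blast
      qed simp
    qed
    then have "?H (S - F) \<le> ?H (T j) + ?H (\<Union>i. R (i + j))"
      by (rule order_trans[OF hausdorff_measure_mono hausdorff_measure_Un_le[OF k]])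
    also have "\<dots> \<le> ?H (T j) + (\<Sum>i. ?H (R (i + j)))"
      by (intro add_left_mono hausdorff_measure_UN_le)
    finally have "?H (S \<inter> F) + ?H (S - F) \<le> (?H (S \<inter> F) + ?H (T j)) + (\<Sum>i. ?H (R (i + j)))"
      by (simp add: add_left_mono add.assoc)
    also have "\<dots> \<le> ?H S + (\<Sum>i. ?H (R (i + j)))" by (intro add_right_mono part)
    finally show ?thesis .
  qed
  note le = this
  have "(\<lambda>j. ?H S + (\<Sum>i. ?H (R (i + j)))) \<longlonglongrightarrow> ?H S + 0"
    by (intro tendsto_intros lim0)
  then show ?thesis
    using LIMSEQ_le_const[of _ "?H S + 0"] le by simp
qed

section \<open>Measurability of Borel sets and Lipschitz images\<close>

definition hausdorff_borel :: "nat \<Rightarrow> 'a::metric_space measure" where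
  "hausdorff_borel k = measure_of UNIV (sets borel) (hausdorff_measure k)"

lemma sets_hausdorff_borel [simp, measurable_cong]: "sets (hausdorff_borel k) = sets borel"
  unfolding hausdorff_borel_def
  by (metis sets_measure_of space_borel sets.sigma_sets_eq sets.space_closed)

lemma space_hausdorff_borel [simp]: "space (hausdorff_borel k) = UNIV"
  by (metis sets_hausdorff_borel sets_eq_imp_space_eq space_borel)

text \<open>Closed sets satisfy the Caratheodory condition, the lambda system is a sigma-algebra,
  and closed sets generate the Borel sets. The remaining inequality of the condition is
  subadditivity.\<close>

lemma emeasure_hausdorff_borel:
  assumes k: "k \<ge> 1" and A: "A \<in> sets (borel :: 'a::metric_space measure)"
  shows "emeasure (hausdorff_borel k) A = hausdorff_measure k A"
proof -
  let ?H = "hausdorff_measure k :: 'a set \<Rightarrow> ennreal"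
  let ?L = "lambda_system UNIV (Pow UNIV) ?H"
  interpret P: sigma_algebra "UNIV :: 'a set" "Pow UNIV" by (rule sigma_algebra_Pow)
  have oms: "outer_measure_space (Pow UNIV) ?H"
    unfolding outer_measure_space_def
    by (auto simp: positive_def increasing_def countably_subadditive_def hausdorff_measure_empty[OF k]
        intro: hausdorff_measure_mono hausdorff_measure_UN_le)
  have ms: "measure_space UNIV ?L ?H" by (rule P.caratheodory_lemma[OF oms])
  have "closed F \<Longrightarrow> F \<in> ?L" for F :: "'a set"
    unfolding P.lambda_system_eq
  proof (clarsimp, intro allI antisym)
    fix x :: "'a set" assume F: "closed F"
    show "?H (x \<inter> F) + ?H (x - F) \<le> ?H x" by (rule hausdorff_measure_caratheodory_closed[OF k F])
    show "?H x \<le> ?H (x \<inter> F) + ?H (x - F)"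
      using hausdorff_measure_Un_le[OF k, of "x \<inter> F" "x - F"] by (simp add: Int_Diff_Un)
  qed
  then have "sigma_sets UNIV (Collect closed) \<subseteq> ?L"
    using ms by (intro sigma_algebra.sigma_sets_subset) (auto simp: measure_space_def)
  then have sub: "sets borel \<subseteq> ?L" by (simp add: borel_eq_closed)
  have "measure_space UNIV (sets (borel::'a measure)) ?H"
    by (rule measure_down[OF ms _ sub]) (metis sets.sigma_algebra_axioms space_borel)
  then show ?thesis
    unfolding hausdorff_borel_def by (intro emeasure_measure_of_sigma) (auto simp: measure_space_def A)
qed

text \<open>Images of the traces on A of a cover at scale \<delta>/L form a cover of the image at
  scale \<delta>, with diameters enlarged by at most the factor L. The traces are taken because f is
  controlled on A alone.\<close>

lemma hausdorff_measure_lipschitz_image: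
  fixes f :: "'a::metric_space \<Rightarrow> 'b::metric_space"
  assumes k: "k \<ge> 1" and L: "0 < L" and lip: "\<And>x y. x \<in> A \<Longrightarrow> y \<in> A \<Longrightarrow> dist (f x) (f y) \<le> L * dist x y"
  shows "hausdorff_measure k (f ` A) \<le> ennreal (L ^ k) * hausdorff_measure k A"
proof -
  have pre: "hausdorff_premeasure k \<delta> (f ` A) \<le> ennreal (L ^ k) * hausdorff_measure k A" if \<delta>: "0 < \<delta>" for \<delta>
  proof -
    let ?v = "\<lambda>C::'a set. ennreal (unit_ball_vol (real k) * (diameter C / 2) ^ k)"
    let ?w = "\<lambda>C::'b set. ennreal (unit_ball_vol (real k) * (diameter C / 2) ^ k)"
    have "hausdorff_premeasure k \<delta> (f ` A) / ennreal (L ^ k) \<le> hausdorff_premeasure k (\<delta> / L) A"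
      unfolding hausdorff_premeasure_def[of k "\<delta> / L" A]
    proof (rule INF_greatest)
        fix C :: "nat \<Rightarrow> 'a set" assume "C \<in> {C. A \<subseteq> (\<Union>i. C i) \<and> (\<forall>i. bounded (C i) \<and> diameter (C i) \<le> \<delta> / L)}"
        then have C: "A \<subseteq> (\<Union>i. C i)" "\<And>i. bounded (C i)" "\<And>i. diameter (C i) \<le> \<delta> / L" by auto
        have d: "bounded (f ` (C i \<inter> A)) \<and> diameter (f ` (C i \<inter> A)) \<le> L * diameter (C i)" for i
        proof
          have b: "dist (f x) (f y) \<le> L * diameter (C i)" if "x \<in> C i \<inter> A" "y \<in> C i \<inter> A" for x y
          proof -
            have "dist (f x) (f y) \<le> L * dist x y" using lip that by auto
            also have "\<dots> \<le> L * diameter (C i)"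
              using that C(2) L by (intro mult_left_mono diameter_bounded_bound) auto
            finally show ?thesis .
          qed
          show "bounded (f ` (C i \<inter> A))"
            using b unfolding bounded_two_points by blast
          have "0 \<le> L * diameter (C i)" using L C(2) by (simp add: diameter_ge_0)
          then show "diameter (f ` (C i \<inter> A)) \<le> L * diameter (C i)"
            using b by (subst diameter_def) (auto intro!: cSUP_least)
        qed
        have "hausdorff_premeasure k \<delta> (f ` A) \<le> (\<Sum>i. ?w (f ` (C i \<inter> A)))"
        proof (rule hausdorff_premeasure_le)
          show "diameter (f ` (C i \<inter> A)) \<le> \<delta>" for i
            using d[of i] C(3)[of i] L by (simp add: field_simps)
          show "f ` A \<subseteq> (\<Union>i. f ` (C i \<inter> A))" using C(1) by blast
        qed (use d in auto)
        also have "\<dots> \<le> (\<Sum>i. ennreal (L ^ k) * ?v (C i))"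
        proof (intro suminf_le summableI)
          fix i
          have "(diameter (f ` (C i \<inter> A)) / 2) ^ k \<le> (L * (diameter (C i) / 2)) ^ k"
            using d[of i] by (intro power_mono) (auto intro!: diameter_ge_0)
          then have "unit_ball_vol (real k) * (diameter (f ` (C i \<inter> A)) / 2) ^ k
              \<le> unit_ball_vol (real k) * (L * (diameter (C i) / 2)) ^ k"
            by (rule mult_left_mono) simp
          then have "unit_ball_vol (real k) * (diameter (f ` (C i \<inter> A)) / 2) ^ k
              \<le> L ^ k * (unit_ball_vol (real k) * (diameter (C i) / 2) ^ k)"
            by (simp only: power_mult_distrib mult.left_commute)
          then show "?w (f ` (C i \<inter> A)) \<le> ennreal (L ^ k) * ?v (C i)"
            using L by (subst ennreal_mult[symmetric]) (auto intro!: mult_nonneg_nonneg diameter_ge_0 C(2) ennreal_leI zero_le_power)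
        qed
        also have "\<dots> = ennreal (L ^ k) * (\<Sum>i. ?v (C i))" by simp
        finally show "hausdorff_premeasure k \<delta> (f ` A) / ennreal (L ^ k) \<le> (\<Sum>i. ?v (C i))"
          using L by (intro divide_le_posI_ennreal) auto
    qed
    also have "\<dots> \<le> hausdorff_measure k A"
      using L \<delta> by (intro hausdorff_premeasure_le_measure) auto
    finally have "hausdorff_premeasure k \<delta> (f ` A) / ennreal (L ^ k) * ennreal (L ^ k) \<le> hausdorff_measure k A * ennreal (L ^ k)"
      by (rule mult_right_mono) auto
    moreover have "hausdorff_premeasure k \<delta> (f ` A) / ennreal (L ^ k) * ennreal (L ^ k) = hausdorff_premeasure k \<delta> (f ` A)"
      using L by (subst ennreal_divide_times) (simp add: divide_ennreal)
    ultimately show ?thesis by (simp add: mult.commute)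
  qed
  show ?thesis unfolding hausdorff_measure_def[of k "f ` A"] by (rule SUP_least) (use pre in auto)
qed

subsection \<open>Translation invariance and normalisation\<close>

text \<open>Uniqueness of translation-invariant measures by two applications of Fubini to the
  indicator of the pairs (x, y) with y in F and x + y in E; the substitution of y - x for y in
  between is what reflects F. Taking for F the unit cube shows that M is a multiple of
  \<open>lborel\<close>.\<close>

lemma translation_invariant_eq_lborel:
  fixes M :: "'a::euclidean_space measure"
  assumes sets_M [measurable_cong, simp]: "sets M = sets borel"
    and sigma: "sigma_finite_measure M"
    and inv: "\<And>a A. A \<in> sets borel \<Longrightarrow> emeasure M {x. x + a \<in> A} = emeasure M A"
    and E[measurable]: "E \<in> sets borel" and F[measurable]: "F \<in> sets borel"
  shows "emeasure M E * emeasure lborel F = emeasure lborel E * emeasure M {x. - x \<in> F}"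
proof -
  interpret M: sigma_finite_measure M by (rule sigma)
  interpret P: pair_sigma_finite M lborel ..
  have sp: "space M = UNIV" using sets_eq_imp_space_eq[OF sets_M] by simp
  have distr: "distr M borel (\<lambda>x. x + a) = M" for a
  proof (rule measure_eqI)
    fix A assume "A \<in> sets (distr M borel (\<lambda>x. x + a))"
    then have A: "A \<in> sets borel" by simp
    then show "emeasure (distr M borel (\<lambda>x. x + a)) A = emeasure M A"
      using inv[OF A, of a] by (subst emeasure_distr) (auto simp: sp vimage_def)
  qed simp
  have "emeasure M E * emeasure lborel F = (\<integral>\<^sup>+y. indicator F y * emeasure M E \<partial>lborel)"
    by (subst nn_integral_multc) (auto simp: mult.commute)
  also have "\<dots> = (\<integral>\<^sup>+y. (\<integral>\<^sup>+x. indicator F y * indicator E (x + y) \<partial>M) \<partial>lborel)"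
  proof (rule nn_integral_cong)
    fix y
    have "emeasure M E = (\<integral>\<^sup>+x. indicator E x \<partial>distr M borel (\<lambda>x. x + y))" by (simp add: distr)
    also have "\<dots> = (\<integral>\<^sup>+x. indicator E (x + y) \<partial>M)" by (subst nn_integral_distr) auto
    finally show "indicator F y * emeasure M E = (\<integral>\<^sup>+x. indicator F y * indicator E (x + y) \<partial>M)"
      by (subst nn_integral_cmult) auto
  qed
  also have "\<dots> = (\<integral>\<^sup>+x. (\<integral>\<^sup>+y. indicator F y * indicator E (x + y) \<partial>lborel) \<partial>M)"
    by (rule P.Fubini') measurable
  also have "\<dots> = (\<integral>\<^sup>+x. (\<integral>\<^sup>+y. indicator F (y - x) * indicator E y \<partial>lborel) \<partial>M)"
  proof (rule nn_integral_cong)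
    fix x
    have "(\<integral>\<^sup>+y. indicator F (y - x) * indicator E y \<partial>lborel)
        = (\<integral>\<^sup>+y. indicator F (y - x) * indicator E y \<partial>distr lborel borel ((+) x))"
      by (simp add: lborel_distr_plus)
    also have "\<dots> = (\<integral>\<^sup>+y. indicator F y * indicator E (x + y) \<partial>lborel)"
      by (subst nn_integral_distr) auto
    finally show "(\<integral>\<^sup>+y. indicator F y * indicator E (x + y) \<partial>lborel) = (\<integral>\<^sup>+y. indicator F (y - x) * indicator E y \<partial>lborel)"
      by simp
  qed
  also have "\<dots> = (\<integral>\<^sup>+y. (\<integral>\<^sup>+x. indicator F (y - x) * indicator E y \<partial>M) \<partial>lborel)"
    by (rule P.Fubini'[symmetric]) measurable
  also have "\<dots> = (\<integral>\<^sup>+y. indicator E y * emeasure M {x. - x \<in> F} \<partial>lborel)"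
  proof (rule nn_integral_cong)
    fix y
    have [measurable]: "{x. - x \<in> F} \<in> sets borel"
      using measurable_sets_borel[of uminus borel F] by (simp add: vimage_def)
    have "(\<integral>\<^sup>+x. indicator F (y - x) * indicator E y \<partial>M) = indicator E y * (\<integral>\<^sup>+x. indicator {x. y - x \<in> F} x \<partial>M)"
    proof -
      have [measurable]: "{x. y - x \<in> F} \<in> sets borel"
        using measurable_sets_borel[of "\<lambda>x. y - x" borel F] by (simp add: vimage_def)
      have "indicator F (y - x) * indicator E y = indicator E y * (indicator {x. y - x \<in> F} x :: ennreal)" for x
        by (auto split: split_indicator)
      then show ?thesis by (simp only:) (rule nn_integral_cmult, simp)
    qed
    also have "(\<integral>\<^sup>+x. indicator {x. y - x \<in> F} x \<partial>M) = emeasure M {x. y - x \<in> F}"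
      by (rule nn_integral_indicator) (use measurable_sets_borel[of "\<lambda>x. y - x" borel F] in \<open>auto simp: vimage_def\<close>)
    also have "{x. y - x \<in> F} = {x. x + (- y) \<in> {x. - x \<in> F}}" by auto
    also have "emeasure M \<dots> = emeasure M {x. - x \<in> F}" by (rule inv) measurable
    finally show "(\<integral>\<^sup>+x. indicator F (y - x) * indicator E y \<partial>M) = indicator E y * emeasure M {x. - x \<in> F}" .
  qed
  also have "\<dots> = emeasure lborel E * emeasure M {x. - x \<in> F}"
    by (subst nn_integral_multc) auto
  finally show ?thesis .
qed

lemma hausdorff_measure_isometry:
  fixes f :: "'a::metric_space \<Rightarrow> 'b::metric_space"
  assumes k: "k \<ge> 1" and iso: "\<And>x y. x \<in> A \<Longrightarrow> y \<in> A \<Longrightarrow> dist (f x) (f y) = dist x y"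
  shows "hausdorff_measure k (f ` A) = hausdorff_measure k A"
proof (rule antisym)
  show "hausdorff_measure k (f ` A) \<le> hausdorff_measure k A"
    using hausdorff_measure_lipschitz_image[OF k, of 1 A f] iso by simp
  have inj: "inj_on f A" using iso by (metis dist_eq_0_iff inj_onI)
  have "hausdorff_measure k (inv_into A f ` (f ` A)) \<le> ennreal (1 ^ k) * hausdorff_measure k (f ` A)"
    by (rule hausdorff_measure_lipschitz_image[OF k]) (use inj iso in auto)
  then show "hausdorff_measure k A \<le> hausdorff_measure k (f ` A)"
    using inj by (simp add: image_comp)
qed

lemma hausdorff_measure_scale:
  fixes A :: "'a::real_normed_vector set"
  assumes k: "k \<ge> 1" and s: "0 < s"
  shows "hausdorff_measure k ((*\<^sub>R) s ` A) = ennreal (s ^ k) * hausdorff_measure k A"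
proof (rule antisym)
  have d: "dist (t *\<^sub>R x) (t *\<^sub>R y) = t * dist x y" if "0 < t" for t and x y :: 'a
    using that by (simp add: dist_norm flip: scaleR_diff_right)
  show "hausdorff_measure k ((*\<^sub>R) s ` A) \<le> ennreal (s ^ k) * hausdorff_measure k A"
    by (rule hausdorff_measure_lipschitz_image[OF k s]) (simp add: d s)
  have "hausdorff_measure k ((*\<^sub>R) (1 / s) ` (*\<^sub>R) s ` A) \<le> ennreal ((1 / s) ^ k) * hausdorff_measure k ((*\<^sub>R) s ` A)"
    by (rule hausdorff_measure_lipschitz_image[OF k]) (use s d[of "1/s"] in auto)
  moreover have "(*\<^sub>R) (1 / s) ` (*\<^sub>R) s ` A = A"
    using s by (force simp: image_comp)
  ultimately have "ennreal (s ^ k) * hausdorff_measure k A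
      \<le> ennreal (s ^ k) * (ennreal ((1 / s) ^ k) * hausdorff_measure k ((*\<^sub>R) s ` A))"
    by (intro mult_left_mono) auto
  also have "\<dots> = hausdorff_measure k ((*\<^sub>R) s ` A)"
    using s by (simp add: ennreal_mult[symmetric] mult.assoc[symmetric] power_one_over)
  finally show "ennreal (s ^ k) * hausdorff_measure k A \<le> hausdorff_measure k ((*\<^sub>R) s ` A)" .
qed

lemma hausdorff_premeasure_finite_cover:
  fixes C :: "'i \<Rightarrow> 'a::metric_space set"
  assumes k: "k \<ge> 1" and I: "finite I" "A \<subseteq> (\<Union>i\<in>I. C i)" and C: "\<And>i. i \<in> I \<Longrightarrow> bounded (C i)"
    "\<And>i. i \<in> I \<Longrightarrow> diameter (C i) \<le> \<delta>" and \<delta>: "0 \<le> \<delta>"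
  shows "hausdorff_premeasure k \<delta> A \<le> ennreal (real (card I) * (unit_ball_vol (real k) * (\<delta> / 2) ^ k))"
proof -
  let ?v = "\<lambda>C::'a set. ennreal (unit_ball_vol (real k) * (diameter C / 2) ^ k)"
  obtain h where h: "bij_betw h {..<card I} I" using ex_bij_betw_nat_finite[OF I(1)] by (auto simp: atLeast0LessThan)
  define D where "D i = (if i < card I then C (h i) else {})" for i
  have hI: "i < card I \<Longrightarrow> h i \<in> I" for i using h by (auto simp: bij_betw_def)
  have "hausdorff_premeasure k \<delta> A \<le> (\<Sum>i. ?v (D i))"
  proof (rule hausdorff_premeasure_le)
    show "A \<subseteq> (\<Union>i. D i)"
    proof
      fix x assume "x \<in> A"
      then obtain i where "i \<in> I" "x \<in> C i" using I by auto
      moreover from this obtain j where "j < card I" "h j = i" using h by (metis bij_betw_def imageE lessThan_iff)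
      ultimately show "x \<in> (\<Union>i. D i)" by (auto simp: D_def intro!: exI[of _ j])
    qed
  qed (use C \<delta> hI in \<open>auto simp: D_def\<close>)
  also have "\<dots> = (\<Sum>i<card I. ?v (D i))"
    by (rule suminf_finite) (use k in \<open>auto simp: D_def power_0_left\<close>)
  also have "\<dots> \<le> (\<Sum>i<card I. ennreal (unit_ball_vol (real k) * (\<delta> / 2) ^ k))"
    by (intro sum_mono ennreal_leI mult_left_mono power_mono)
      (use C \<delta> hI in \<open>auto simp: D_def intro!: diameter_ge_0\<close>)
  also have "\<dots> = ennreal (real (card I) * (unit_ball_vol (real k) * (\<delta> / 2) ^ k))"
    using \<delta> by (simp add: ennreal_mult ennreal_of_nat_eq_real_of_nat)
  finally show ?thesis .
qed

section \<open>Finite and positive Hausdorff measure of coordinate cubes\<close>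

definition coord_cube :: "'a::euclidean_space set \<Rightarrow> 'a set" where
  "coord_cube D = {x. \<forall>b\<in>Basis. if b \<in> D then 0 \<le> x \<bullet> b \<and> x \<bullet> b \<le> 1 else x \<bullet> b = 0}"

lemma hausdorff_measure_coord_cube_finite:
  fixes D :: "'a::euclidean_space set"
  assumes D: "D \<subseteq> Basis" "card D = k" and k: "k \<ge> 1"
  shows "hausdorff_measure k (coord_cube D) < top"
proof -
  have fD: "finite D" using D finite_Basis finite_subset by blast
  let ?c = "unit_ball_vol (real k) * real k ^ k"
  have "hausdorff_premeasure k (inverse (real (Suc n))) (coord_cube D) \<le> ennreal ?c" for n
  proof -
    \<comment> \<open>Cells of side 1/N have l1-diameter at most k/N, which for this N is exactly
      the admissible diameter 1/(n+1).\<close>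
    define N where "N = k * Suc n"
    have N: "N \<ge> 1" using k by (simp add: N_def)
    \<comment> \<open>Indices run up to N inclusive because a coordinate equal to 1 has floor N;
      hence (N + 1)^k cells.\<close>
    define I where "I = PiE D (\<lambda>_. {0..N})"
    define C where "C f = {x \<in> coord_cube D. \<forall>b\<in>D. real (f b) / N \<le> x \<bullet> b \<and> x \<bullet> b \<le> (real (f b) + 1) / N}" for f :: "'a \<Rightarrow> nat"
    have cI: "card I = (N + 1) ^ k" and fI: "finite I"
      using fD D by (auto simp: I_def card_PiE intro: finite_PiE)
    have close: "dist x y \<le> inverse (real (Suc n))" if "x \<in> C f" "y \<in> C f" for x y f
    proof -
      have "norm (x - y) \<le> (\<Sum>b\<in>Basis. \<bar>(x - y) \<bullet> b\<bar>)" by (rule norm_le_l1)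
      also have "\<dots> \<le> (\<Sum>b\<in>Basis. if b \<in> D then 1 / N else 0)"
      proof (rule sum_mono)
        fix b :: 'a assume b: "b \<in> Basis"
        show "\<bar>(x - y) \<bullet> b\<bar> \<le> (if b \<in> D then 1 / real N else 0)"
        proof (cases "b \<in> D")
          case True
          then have "real (f b) / N \<le> x \<bullet> b" "x \<bullet> b \<le> (real (f b) + 1) / N"
            "real (f b) / N \<le> y \<bullet> b" "y \<bullet> b \<le> (real (f b) + 1) / N" using that by (auto simp: C_def)
          then show ?thesis using True by (auto simp: inner_diff_left add_divide_distrib abs_le_iff)
        next
          case False
          then show ?thesis using that b by (auto simp: C_def coord_cube_def inner_diff_left)
        qed
      qed
      also have "\<dots> = k / N"
        using D by (simp add: sum.If_cases Int_absorb1 Int_absorb2)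
      also have "\<dots> = inverse (real (Suc n))" using k unfolding N_def of_nat_mult by (simp add: inverse_eq_divide del: of_nat_Suc)
      finally show ?thesis by (simp add: dist_norm)
    qed
    have "hausdorff_premeasure k (inverse (real (Suc n))) (coord_cube D)
        \<le> ennreal (real (card I) * (unit_ball_vol (real k) * (inverse (real (Suc n)) / 2) ^ k))"
    proof (rule hausdorff_premeasure_finite_cover[OF k fI])
      show "coord_cube D \<subseteq> (\<Union>f\<in>I. C f)"
      proof
        fix x assume x: "x \<in> coord_cube D"
        define f where "f = restrict (\<lambda>b. nat \<lfloor>real N * (x \<bullet> b)\<rfloor>) D"
        have xb: "0 \<le> x \<bullet> b \<and> x \<bullet> b \<le> 1" if "b \<in> D" for b
          using x that D by (auto simp: coord_cube_def subset_iff dest: bspec[of _ _ b])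
        have "f \<in> I"
        proof (unfold I_def, rule PiE_I)
          fix b assume b: "b \<in> D"
          have "real N * (x \<bullet> b) \<le> real N" using xb[OF b] by (simp add: mult_left_le)
          then have "\<lfloor>real N * (x \<bullet> b)\<rfloor> \<le> int N" by linarith
          then show "f b \<in> {0..N}" using b by (simp add: f_def)
        qed (simp add: f_def)
        moreover have "x \<in> C f"
        proof -
          have "real (f b) / N \<le> x \<bullet> b \<and> x \<bullet> b \<le> (real (f b) + 1) / N" if b: "b \<in> D" for b
          proof -
            have "0 \<le> real N * (x \<bullet> b)" using xb[OF b] by simp
            then have "real (f b) = of_int \<lfloor>real N * (x \<bullet> b)\<rfloor>" using b by (simp add: f_def)
            then have "real (f b) \<le> real N * (x \<bullet> b)" "real N * (x \<bullet> b) \<le> real (f b) + 1" by linarith+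
            then show ?thesis using N by (simp add: field_simps)
          qed
          then show ?thesis using x by (simp add: C_def)
        qed
        ultimately show "x \<in> (\<Union>f\<in>I. C f)" by blast
      qed
      show "bounded (C f)" for f unfolding bounded_two_points using close by blast
      show "diameter (C f) \<le> inverse (real (Suc n))" for f
        by (subst diameter_def) (auto intro!: cSUP_least close simp del: of_nat_Suc)
    qed simp
    also have "\<dots> \<le> ennreal ?c"
    proof (rule ennreal_leI)
      have "(real (N + 1) * (inverse (real (Suc n)) / 2)) ^ k \<le> real k ^ k"
      proof (rule power_mono)
        have "real (N + 1) \<le> 2 * real N" using N by simp
        also have "\<dots> = 2 * (real k * real (Suc n))" unfolding N_def of_nat_mult by (rule refl)
        finally have "real (N + 1) * (inverse (real (Suc n)) / 2)
            \<le> 2 * (real k * real (Suc n)) * (inverse (real (Suc n)) / 2)"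
          by (rule mult_right_mono) simp
        also have "\<dots> = real k" by (simp del: of_nat_Suc)
        finally show "real (N + 1) * (inverse (real (Suc n)) / 2) \<le> real k" .
      qed simp
      then have "unit_ball_vol (real k) * (real (N + 1) * (inverse (real (Suc n)) / 2)) ^ k \<le> ?c"
        by (intro mult_left_mono) auto
      moreover have "real (card I) * (unit_ball_vol (real k) * (inverse (real (Suc n)) / 2) ^ k)
        = unit_ball_vol (real k) * (real (N + 1) * (inverse (real (Suc n)) / 2)) ^ k"
        unfolding cI power_mult_distrib by (simp only: of_nat_power mult.left_commute mult.commute mult.assoc)
      ultimately show "real (card I) * (unit_ball_vol (real k) * (inverse (real (Suc n)) / 2) ^ k) \<le> ?c"
        by (simp only:)
    qed
    finally show ?thesis .
  qed
  then have "hausdorff_measure k (coord_cube D) \<le> ennreal ?c"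
    unfolding hausdorff_measure_eq_SUP_nat by (intro SUP_least)
  then show ?thesis using ennreal_less_top order_le_less_trans by blast
qed

text \<open>A covering set of diameter d is thickened to a box with sides 2d in the directions of D
  and sides 1 in the others. These boxes cover the full unit cube, so their volumes (2d)^k sum to at
  least 1.\<close>

lemma hausdorff_measure_coord_cube_pos:
  fixes D :: "'a::euclidean_space set"
  assumes D: "D \<subseteq> Basis" "card D = k" and k: "k \<ge> 1"
  shows "0 < hausdorff_measure k (coord_cube D)"
proof -
  let ?v = "\<lambda>C::'a set. ennreal (unit_ball_vol (real k) * (diameter C / 2) ^ k)"
  have fD: "finite D" using D finite_Basis finite_subset by blast
  have ub: "0 < unit_ball_vol (real k)" by (intro unit_ball_vol_pos) auto
  then have ub0: "unit_ball_vol (real k) \<noteq> 0" by (rule less_imp_neq[symmetric])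
  \<comment> \<open>(2d)^k equals 4^k (d/2)^k, and the premeasure weights (d/2)^k by
    \<open>unit_ball_vol k\<close>.\<close>
  let ?c = "4 ^ k / unit_ball_vol (real k)"
  have "1 \<le> ennreal ?c * hausdorff_premeasure k 1 (coord_cube D)"
  proof (rule ccontr)
    assume "\<not> 1 \<le> ennreal ?c * hausdorff_premeasure k 1 (coord_cube D)"
    then have "ennreal ?c * hausdorff_premeasure k 1 (coord_cube D) < 1" by simp
    then have "hausdorff_premeasure k 1 (coord_cube D) < ennreal (1 / ?c)"
    proof -
      assume *: "ennreal ?c * hausdorff_premeasure k 1 (coord_cube D) < 1"
      show ?thesis
      proof (rule ccontr)
        assume "\<not> ?thesis"
        then have "ennreal ?c * ennreal (1 / ?c) \<le> ennreal ?c * hausdorff_premeasure k 1 (coord_cube D)"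
          by (intro mult_left_mono) auto
        moreover have "ennreal ?c * ennreal (1 / ?c) = 1"
          using ub ub0 by (subst ennreal_mult[symmetric]) auto
        ultimately show False using * by simp
      qed
    qed
    from hausdorff_premeasure_cover[OF this] obtain C where
      C: "coord_cube D \<subseteq> (\<Union>i. C i)" "\<And>i. bounded (C i)" "(\<Sum>i. ?v (C i)) < ennreal (1 / ?c)"
      by metis
    define p where "p i = (SOME x. x \<in> C i)" for i
    define d where "d i = diameter (C i)" for i
    have d0: "0 \<le> d i" for i unfolding d_def by (intro diameter_ge_0 C)
    define lo where "lo i = (\<Sum>b\<in>Basis. (if b \<in> D then p i \<bullet> b - d i else 0) *\<^sub>R b)" for i
    define hi where "hi i = (\<Sum>b\<in>Basis. (if b \<in> D then p i \<bullet> b + d i else 1) *\<^sub>R b)" for i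
    have sub: "cbox 0 One \<subseteq> (\<Union>i. cbox (lo i) (hi i))"
    proof
      fix x :: 'a assume x: "x \<in> cbox 0 One"
      then have xb: "b \<in> Basis \<Longrightarrow> 0 \<le> x \<bullet> b \<and> x \<bullet> b \<le> 1" for b by (auto simp: mem_box)
      define y where "y = (\<Sum>b\<in>Basis. (if b \<in> D then x \<bullet> b else 0) *\<^sub>R b)"
      have yb: "b \<in> Basis \<Longrightarrow> y \<bullet> b = (if b \<in> D then x \<bullet> b else 0)" for b by (simp add: y_def)
      have "y \<in> coord_cube D" using xb yb by (auto simp: coord_cube_def)
      then obtain i where i: "y \<in> C i" using C by auto
      then have pi: "p i \<in> C i" unfolding p_def by (rule someI)
      have "\<bar>y \<bullet> b - p i \<bullet> b\<bar> \<le> d i" if "b \<in> Basis" for b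
        using Basis_le_norm[OF that, of "y - p i"] diameter_bounded_bound[OF C(2)[of i] i pi]
        by (auto simp: d_def dist_norm inner_diff_left)
      then have "x \<in> cbox (lo i) (hi i)"
        using xb yb by (force simp: mem_box lo_def hi_def abs_le_iff)
      then show "x \<in> (\<Union>i. cbox (lo i) (hi i))" by blast
    qed
    have vol: "emeasure lborel (cbox (lo i) (hi i)) = ennreal ((2 * d i) ^ k)" for i
    proof -
      have "(\<Prod>b\<in>Basis. (hi i - lo i) \<bullet> b) = (\<Prod>b\<in>Basis. if b \<in> D then 2 * d i else 1)"
        by (intro prod.cong) (auto simp: hi_def lo_def inner_diff_left)
      also have "\<dots> = (2 * d i) ^ k"
        using D by (simp add: prod.If_cases Int_absorb1)
      finally show ?thesis
        by (subst emeasure_lborel_cbox) (auto simp: lo_def hi_def d0)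
    qed
    have "1 = emeasure lborel (cbox (0::'a) One)" by (subst emeasure_lborel_cbox) auto
    also have "\<dots> \<le> emeasure lborel (\<Union>i. cbox (lo i) (hi i))" by (rule emeasure_mono[OF sub]) auto
    also have "\<dots> \<le> (\<Sum>i. emeasure lborel (cbox (lo i) (hi i)))"
      by (rule emeasure_subadditive_countably) auto
    also have "\<dots> = (\<Sum>i. ennreal ?c * ?v (C i))"
    proof (rule arg_cong[of _ _ suminf], rule ext)
      fix i
      have "(2 * d i) ^ k = (4 * (d i / 2)) ^ k" by simp
      also have "\<dots> = ?c * (unit_ball_vol (real k) * (d i / 2) ^ k)"
        unfolding power_mult_distrib using ub0 by simp
      finally have "(2 * d i) ^ k = ?c * (unit_ball_vol (real k) * (d i / 2) ^ k)" .
      then show "emeasure lborel (cbox (lo i) (hi i)) = ennreal ?c * ?v (C i)"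
        unfolding vol using ub ub0 d0[of i] by (subst ennreal_mult[symmetric]) (auto simp: d_def)
    qed
    also have "\<dots> = ennreal ?c * (\<Sum>i. ?v (C i))" by simp
    also have "\<dots> < ennreal ?c * ennreal (1 / ?c)"
      using C(3) ub by (intro ennreal_mult_strict_left_mono) auto
    also have "\<dots> = 1" using ub ub0 by (subst ennreal_mult[symmetric]) auto
    finally show False by simp
  qed
  also have "\<dots> \<le> ennreal ?c * hausdorff_measure k (coord_cube D)"
    by (intro mult_left_mono hausdorff_premeasure_le_measure) auto
  finally have "1 \<le> ennreal ?c * hausdorff_measure k (coord_cube D)" .
  then have "hausdorff_measure k (coord_cube D) \<noteq> 0" by (intro notI) simp
  then show ?thesis by (simp add: zero_less_iff_neq_zero)
qed

text \<open>A dilated cube, shifted by m in the directions of D, contains the intersection. Finite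
  measure of balls in a coordinate subspace is what sigma-finiteness rests on.\<close>

lemma hausdorff_measure_coord_bounded_finite:
  fixes D :: "'a::euclidean_space set"
  assumes D: "D \<subseteq> Basis" "card D = k" and k: "k \<ge> 1"
  shows "hausdorff_measure k (cball 0 m \<inter> {x. \<forall>b\<in>Basis - D. x \<bullet> b = 0}) < top"
proof (cases "m > 0")
  case m: True
  define f where "f x = (2 * m) *\<^sub>R x - m *\<^sub>R (\<Sum>b\<in>D. b)" for x :: 'a
  have s: "(\<Sum>c\<in>D. c) \<bullet> b = (if b \<in> D then 1 else 0)" if "b \<in> Basis" for b
  proof -
    have fD: "finite D" using D finite_Basis finite_subset by blast
    have "(\<Sum>c\<in>D. c) \<bullet> b = (\<Sum>c\<in>D. if c = b then 1 else 0)"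
      unfolding inner_sum_left by (intro sum.cong) (use D that in \<open>auto simp: inner_Basis\<close>)
    then show ?thesis using fD by simp
  qed
  have sub: "cball 0 m \<inter> {x. \<forall>b\<in>Basis - D. x \<bullet> b = 0} \<subseteq> f ` coord_cube D"
  proof
    fix x assume x: "x \<in> cball 0 m \<inter> {x. \<forall>b\<in>Basis - D. x \<bullet> b = 0}"
    define y where "y = (1 / (2 * m)) *\<^sub>R (x + m *\<^sub>R (\<Sum>b\<in>D. b))"
    have "f y = x" using m by (simp add: f_def y_def)
    moreover have "y \<in> coord_cube D"
    proof -
      have "\<bar>x \<bullet> b\<bar> \<le> m" if "b \<in> Basis" for b using Basis_le_norm[OF that, of x] x by auto
      then have xm: "- m \<le> x \<bullet> b \<and> x \<bullet> b \<le> m" if "b \<in> Basis" for b using that by (force simp: abs_le_iff)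
      have "if b \<in> D then 0 \<le> y \<bullet> b \<and> y \<bullet> b \<le> 1 else y \<bullet> b = 0" if "b \<in> Basis" for b
        using that x m s[OF that] xm[OF that] by (simp add: y_def inner_add_left field_simps)
      then show ?thesis by (auto simp: coord_cube_def)
    qed
    ultimately show "x \<in> f ` coord_cube D" by blast
  qed
  have "hausdorff_measure k (f ` coord_cube D) \<le> ennreal ((2 * m) ^ k) * hausdorff_measure k (coord_cube D)"
    by (rule hausdorff_measure_lipschitz_image[OF k])
      (use m in \<open>auto simp: f_def dist_norm simp flip: scaleR_diff_right\<close>)
  also have "\<dots> < top"
    using hausdorff_measure_coord_cube_finite[OF D k] by (auto simp: ennreal_mult_less_top)
  finally show ?thesis using hausdorff_measure_mono[OF sub, of k] by (rule le_less_trans[rotated])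
next
  case False
  have "cball 0 m \<inter> {x. \<forall>b\<in>Basis - D. x \<bullet> b = 0} \<subseteq> coord_cube D"
  proof
    fix x assume "x \<in> cball 0 m \<inter> {x. \<forall>b\<in>Basis - D. x \<bullet> b = 0}"
    then have "norm x \<le> m" by simp
    then have "norm x \<le> 0" using False by linarith
    then show "x \<in> coord_cube D" by (simp add: coord_cube_def)
  qed
  then show ?thesis
    using hausdorff_measure_coord_cube_finite[OF D k] hausdorff_measure_mono le_less_trans by blast
qed

lemma sigma_finite_measure_cballI:
  fixes M :: "'a::euclidean_space measure"
  assumes sets: "sets M = sets borel" and fin: "\<And>m::nat. emeasure M (cball 0 (real m)) < top"
  shows "sigma_finite_measure M"
proof
  have sp: "space M = UNIV" using sets_eq_imp_space_eq[OF sets] by simp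
  let ?A = "range (\<lambda>m::nat. cball (0::'a) (real m))"
  have "\<Union>?A = space M" using real_arch_simple by (auto simp: sp)
  then show "\<exists>A. countable A \<and> A \<subseteq> sets M \<and> \<Union>A = space M \<and> (\<forall>a\<in>A. emeasure M a \<noteq> \<infinity>)"
    using fin by (intro exI[of _ ?A]) (auto simp: sets less_top)
qed

lemma hausdorff_measure_translate:
  fixes A :: "'a::real_normed_vector set"
  assumes k: "k \<ge> 1"
  shows "hausdorff_measure k {x. x + a \<in> A} = hausdorff_measure k A"
proof -
  have "{x. x + a \<in> A} = (\<lambda>x. x - a) ` A" by (force simp: image_iff intro: exI[of _ "_ + a"])
  then show ?thesis using hausdorff_measure_isometry[OF k, of A "\<lambda>x. x - a"] by (simp add: dist_norm)
qed

text \<open>In full dimension the Hausdorff measure serves as a carrier of the Lipschitz estimate: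
  the constant c cancels when that estimate is transferred to \<open>lborel\<close>, so it is never
  evaluated.\<close>

lemma hausdorff_measure_eq_lborel:
  obtains c :: real where "0 < c"
    "\<And>E. E \<in> sets borel \<Longrightarrow> hausdorff_measure DIM('a::euclidean_space) (E :: 'a set) = ennreal c * emeasure lborel E"
proof -
  let ?n = "DIM('a)"
  have n: "?n \<ge> 1" using DIM_positive[where 'a='a] by simp
  have H: "E \<in> sets borel \<Longrightarrow> emeasure (hausdorff_borel ?n) E = hausdorff_measure ?n E" for E :: "'a set"
    by (rule emeasure_hausdorff_borel[OF n])
  have ball: "hausdorff_measure ?n (cball (0::'a) m) < top" for m
    using hausdorff_measure_coord_bounded_finite[of "Basis :: 'a set" ?n m] n by simp
  have sf: "sigma_finite_measure (hausdorff_borel ?n :: 'a measure)"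
    by (rule sigma_finite_measure_cballI) (auto simp: H ball)
  let ?F = "cbox 0 (One::'a)"
  let ?c = "hausdorff_measure ?n {x. - x \<in> ?F}"
  have Fm: "{x. - x \<in> ?F} \<in> sets borel"
    using measurable_sets_borel[of uminus borel ?F] by (simp add: vimage_def)
  have main: "hausdorff_measure ?n E = ?c * emeasure lborel E" if E: "E \<in> sets borel" for E :: "'a set"
  proof -
    have "emeasure (hausdorff_borel ?n) E * emeasure lborel ?F = emeasure lborel E * emeasure (hausdorff_borel ?n) {x. - x \<in> ?F}"
    proof (rule translation_invariant_eq_lborel[OF _ sf _ E])
      fix a :: 'a and A :: "'a set" assume A: "A \<in> sets borel"
      have "{x. x + a \<in> A} \<in> sets borel"
        using measurable_sets_borel[of "\<lambda>x. x + a" borel A] A by (simp add: vimage_def)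
      then show "emeasure (hausdorff_borel ?n) {x. x + a \<in> A} = emeasure (hausdorff_borel ?n) A"
        using A by (simp add: H hausdorff_measure_translate[OF n])
    qed auto
    moreover have "emeasure lborel ?F = 1" by (subst emeasure_lborel_cbox) auto
    ultimately show ?thesis using E Fm by (simp add: H mult.commute)
  qed
  obtain m where "\<forall>y\<in>?F. norm y \<le> m" using bounded_cbox[of 0 "One::'a"] by (auto simp: bounded_iff)
  then have "{x. - x \<in> ?F} \<subseteq> cball 0 m" by (metis (mono_tags, lifting) mem_Collect_eq mem_cball_0 norm_minus_cancel subsetI)
  then have fin: "?c < top" using hausdorff_measure_mono ball le_less_trans by blast
  have pos: "?c \<noteq> 0"
  proof
    assume "?c = 0"
    moreover have "closed (coord_cube (Basis::'a set))"
    proof -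
      have "coord_cube (Basis::'a set) = cbox 0 One" by (auto simp: coord_cube_def mem_box)
      then show ?thesis by (metis closed_cbox)
    qed
    ultimately show False
      using main[of "coord_cube Basis"] hausdorff_measure_coord_cube_pos[of "Basis :: 'a set" ?n] n by simp
  qed
  show thesis
  proof (rule that[of "enn2real ?c"])
    show "0 < enn2real ?c" using pos fin by (simp add: enn2real_positive_iff zero_less_iff_neq_zero)
    show "hausdorff_measure ?n E = ennreal (enn2real ?c) * emeasure lborel E" if "E \<in> sets borel" for E :: "'a set"
      using main[OF that] fin by simp
  qed
qed

lemma emeasure_lborel_lipschitz_image:
  fixes f :: "'a::euclidean_space \<Rightarrow> 'a"
  assumes L: "0 < L" and lip: "\<And>x y. x \<in> A \<Longrightarrow> y \<in> A \<Longrightarrow> dist (f x) (f y) \<le> L * dist x y"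
    and A: "A \<in> sets borel" "f ` A \<in> sets borel"
  shows "emeasure lborel (f ` A) \<le> ennreal (L ^ DIM('a)) * emeasure lborel A"
proof -
  obtain c where c: "0 < c" "\<And>E::'a set. E \<in> sets borel \<Longrightarrow> hausdorff_measure DIM('a) E = ennreal c * emeasure lborel E"
    using hausdorff_measure_eq_lborel by blast
  have n: "DIM('a) \<ge> 1" using DIM_positive[where 'a='a] by simp
  have "ennreal c * emeasure lborel (f ` A) \<le> ennreal c * (ennreal (L ^ DIM('a)) * emeasure lborel A)"
    using hausdorff_measure_lipschitz_image[of _ L A f, OF n L lip] A by (simp add: c mult.left_commute)
  then show ?thesis using c(1) by (subst (asm) ennreal_mult_le_mult_iff) auto
qed

section \<open>Hyperplanes and their product with a line\<close>

definition hplane :: "'a::euclidean_space \<Rightarrow> 'a set" where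
  "hplane e = {x. x \<bullet> e = 0}"

lemma closed_hplane: "closed (hplane e)"
  unfolding hplane_def using closed_hyperplane[of e 0] by (simp add: inner_commute)

lemma orthogonal_image_cball_hplane:
  fixes f :: "'a::euclidean_space \<Rightarrow> 'a"
  assumes f: "orthogonal_transformation f"
  shows "f ` (cball 0 m \<inter> hplane e) = cball 0 m \<inter> hplane (f e)"
proof -
  have surj: "surj f" using f by (simp add: orthogonal_transformation_surj)
  have iso: "f x \<bullet> f e = x \<bullet> e" "norm (f x) = norm x" for x
    using f by (auto simp: orthogonal_transformation_def orthogonal_transformation_norm)
  show ?thesis
  proof (intro subset_antisym subsetI)
    fix y assume y: "y \<in> cball 0 m \<inter> hplane (f e)"
    obtain x where "y = f x" using surj by (metis surjD)
    with y iso show "y \<in> f ` (cball 0 m \<inter> hplane e)" by (auto simp: hplane_def)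
  qed (use iso in \<open>auto simp: hplane_def\<close>)
qed

lemma orthogonal_transformation_unit_vectors:
  fixes a b :: "'a::euclidean_space"
  assumes ab: "norm a = 1" "norm b = 1"
  obtains f where "orthogonal_transformation f" "f a = b"
proof (cases "a = b")
  case True
  show thesis by (rule that[of "\<lambda>x. x"]) (auto simp: True)
next
  case False
  define w where "w = a - b"
  \<comment> \<open>The Householder reflection in the hyperplane orthogonal to a - b, which swaps
    the unit vectors a and b.\<close>
  define f where "f x = x - (2 * (x \<bullet> w) / (w \<bullet> w)) *\<^sub>R w" for x
  have w0: "w \<bullet> w \<noteq> 0" using False by (simp add: w_def)
  have lin: "linear f"
    by (rule linearI) (auto simp: f_def inner_add_left algebra_simps add_divide_distrib)
  have "f x \<bullet> f y = x \<bullet> y" for x y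
  proof -
    define q r s where "q = w \<bullet> w" and "r = x \<bullet> w" and "s = y \<bullet> w"
    have q0: "q \<noteq> 0" using w0 by (simp add: q_def)
    have "f x \<bullet> f y = x \<bullet> y - (2 * s / q) * r - (2 * r / q) * s + (2 * r / q) * (2 * s / q) * q"
      unfolding f_def q_def[symmetric] r_def[symmetric] s_def[symmetric]
      by (simp only: inner_diff_left inner_diff_right inner_scaleR_left inner_scaleR_right
          q_def[symmetric] r_def[symmetric] s_def[symmetric] inner_commute[of w y]) (simp add: algebra_simps)
    also have "\<dots> = x \<bullet> y" using q0 by (simp add: field_simps)
    finally show ?thesis .
  qed
  then have orth: "orthogonal_transformation f" using lin by (simp add: orthogonal_transformation_def)
  have "a \<bullet> a = 1" "b \<bullet> b = 1" using ab by (simp_all add: dot_square_norm)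
  then have "w \<bullet> w = 2 * (a \<bullet> w)"
    by (simp add: w_def inner_diff_left inner_diff_right inner_commute[of b a])
  then have "f a = b" using w0 by (simp add: f_def w_def)
  then show thesis using that orth by blast
qed

lemma hausdorff_cball_hplane_eq:
  fixes e e' :: "'a::euclidean_space"
  assumes k: "k \<ge> 1" and e: "norm e = 1" "norm e' = 1"
  shows "hausdorff_measure k (cball 0 m \<inter> hplane e) = hausdorff_measure k (cball 0 m \<inter> hplane e')"
proof -
  obtain f where f: "orthogonal_transformation f" "f e = e'" using orthogonal_transformation_unit_vectors[OF e] .
  have "dist (f x) (f y) = dist x y" for x y
    using f(1) by (metis dist_norm linear_diff orthogonal_transformation)
  then show ?thesis
    using hausdorff_measure_isometry[OF k, of "cball 0 m \<inter> hplane e" f] orthogonal_image_cball_hplane[OF f(1)] f(2) by simp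
qed

lemma hausdorff_cball_hplane_finite:
  fixes e :: "'a::euclidean_space"
  assumes dim: "DIM('a) \<ge> 2" and e: "norm e = 1"
  shows "hausdorff_measure (DIM('a) - 1) (cball 0 m \<inter> hplane e) < top"
proof -
  obtain b :: 'a where b: "b \<in> Basis" using nonempty_Basis by blast
  have "{x. \<forall>c\<in>Basis - (Basis - {b}). x \<bullet> c = 0} = hplane b" using b by (auto simp: hplane_def)
  then have "hausdorff_measure (DIM('a) - 1) (cball 0 m \<inter> hplane b) < top"
    using hausdorff_measure_coord_bounded_finite[of "Basis - {b}" "DIM('a) - 1" m] b dim by simp
  then show ?thesis using hausdorff_cball_hplane_eq[of "DIM('a) - 1" e b m] e b dim by simp
qed

text \<open>Hausdorff measure on the hyperplane orthogonal to e times length along e, carried to the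
  space by addition. Its ratio to \<open>lborel\<close> is the normalisation of (n-1)-dimensional
  Hausdorff measure on hyperplanes.\<close>

definition hplane_product :: "'a::euclidean_space \<Rightarrow> 'a measure" where
  "hplane_product e = distr (density (hausdorff_borel (DIM('a) - 1)) (indicator (hplane e)) \<Otimes>\<^sub>M lborel) borel
     (\<lambda>(x, t). x + t *\<^sub>R e)"

lemma sets_hplane_product [simp, measurable_cong]: "sets (hplane_product e) = sets borel"
  by (simp add: hplane_product_def)

context
  fixes e :: "'a::euclidean_space"
  assumes dim: "DIM('a) \<ge> 2" and e: "norm e = 1"
begin

lemma ee: "e \<bullet> e = 1" using e by (simp add: dot_square_norm)

lemma emeasure_density_hplane:
  assumes A: "A \<in> sets borel"
  shows "emeasure (density (hausdorff_borel (DIM('a) - 1)) (indicator (hplane e))) A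
    = hausdorff_measure (DIM('a) - 1) (A \<inter> hplane e)"
proof -
  have [measurable]: "hplane e \<in> sets borel" by (simp add: closed_hplane)
  show ?thesis using dim A by (simp add: emeasure_restricted emeasure_hausdorff_borel Int_commute)
qed

text \<open>On the whole space the (n-1)-dimensional measure is not sigma-finite; restricting it to
  the hyperplane is what makes Fubini available.\<close>

lemma sigma_finite_density_hplane:
  "sigma_finite_measure (density (hausdorff_borel (DIM('a) - 1)) (indicator (hplane e)) :: 'a measure)"
proof (rule sigma_finite_measure_cballI)
  show "emeasure (density (hausdorff_borel (DIM('a) - 1)) (indicator (hplane e))) (cball 0 (real m)) < top" for m
    by (subst emeasure_density_hplane) (rule borel_closed[OF closed_cball], rule hausdorff_cball_hplane_finite[OF dim e])
qed simp

lemma emeasure_hplane_product: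
  assumes E[measurable]: "E \<in> sets borel"
  shows "emeasure (hplane_product e) E = (\<integral>\<^sup>+t. hausdorff_measure (DIM('a) - 1) ({x. x + t *\<^sub>R e \<in> E} \<inter> hplane e) \<partial>lborel)"
proof -
  let ?N = "density (hausdorff_borel (DIM('a) - 1)) (indicator (hplane e)) :: 'a measure"
  interpret P: pair_sigma_finite ?N lborel
    by (intro pair_sigma_finite.intro sigma_finite_density_hplane sigma_finite_lborel)
  have [measurable]: "(\<lambda>(x, t). x + t *\<^sub>R e) \<in> ?N \<Otimes>\<^sub>M lborel \<rightarrow>\<^sub>M borel"
    by measurable
  let ?S = "(\<lambda>(x, t). x + t *\<^sub>R e) -` E \<inter> space (?N \<Otimes>\<^sub>M lborel)"
  have "emeasure (hplane_product e) E = emeasure (?N \<Otimes>\<^sub>M lborel) ?S"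
    unfolding hplane_product_def by (rule emeasure_distr) measurable
  also have "\<dots> = (\<integral>\<^sup>+t. emeasure ?N ((\<lambda>x. (x, t)) -` ?S) \<partial>lborel)"
    by (rule P.emeasure_pair_measure_alt2) measurable
  also have "\<dots> = (\<integral>\<^sup>+t. hausdorff_measure (DIM('a) - 1) ({x. x + t *\<^sub>R e \<in> E} \<inter> hplane e) \<partial>lborel)"
  proof (rule nn_integral_cong)
    fix t
    have "(\<lambda>x. (x, t)) -` ?S = {x. x + t *\<^sub>R e \<in> E}" by (auto simp: space_pair_measure)
    moreover have "{x. x + t *\<^sub>R e \<in> E} \<in> sets borel"
      using measurable_sets_borel[of "\<lambda>x. x + t *\<^sub>R e" borel E] E by (simp add: vimage_def)
    ultimately show "emeasure ?N ((\<lambda>x. (x, t)) -` ?S) = hausdorff_measure (DIM('a) - 1) ({x. x + t *\<^sub>R e \<in> E} \<inter> hplane e)"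
      by (simp only: emeasure_density_hplane)
  qed
  finally show ?thesis .
qed

lemma hplane_product_cball_finite: "emeasure (hplane_product e) (cball 0 m) < top"
proof -
  let ?k = "DIM('a) - 1"
  have "emeasure (hplane_product e) (cball 0 m)
      \<le> (\<integral>\<^sup>+t. hausdorff_measure ?k (cball 0 m \<inter> hplane e) * indicator {-m..m} t \<partial>lborel)"
    unfolding emeasure_hplane_product[OF borel_closed[OF closed_cball]]
  proof (rule nn_integral_mono)
    fix t :: real
    have *: "norm x \<le> m \<and> \<bar>t\<bar> \<le> m" if "x \<in> hplane e" "norm (x + t *\<^sub>R e) \<le> m" for x
    proof -
      have "(norm (x + t *\<^sub>R e))\<^sup>2 = (norm x)\<^sup>2 + t\<^sup>2"
        using that(1) ee unfolding power2_norm_eq_inner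
        by (simp add: hplane_def inner_add_left inner_add_right inner_commute[of e x] power2_eq_square)
      moreover have "(norm (x + t *\<^sub>R e))\<^sup>2 \<le> m\<^sup>2" using that(2) by (intro power_mono) auto
      ultimately have "(norm x)\<^sup>2 + t\<^sup>2 \<le> m\<^sup>2" by simp
      then have "(norm x)\<^sup>2 \<le> m\<^sup>2" "\<bar>t\<bar>\<^sup>2 \<le> m\<^sup>2"
        using zero_le_power2[of t] zero_le_power2[of "norm x"] unfolding power2_abs by linarith+
      moreover have "0 \<le> m" using that(2) norm_ge_zero order_trans by blast
      ultimately show ?thesis by (meson power2_le_imp_le)
    qed
    show "hausdorff_measure ?k ({x. x + t *\<^sub>R e \<in> cball 0 m} \<inter> hplane e)
        \<le> hausdorff_measure ?k (cball 0 m \<inter> hplane e) * indicator {-m..m} t"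
    proof (cases "t \<in> {-m..m}")
      case True
      then show ?thesis using * by (auto intro!: hausdorff_measure_mono)
    next
      case False
      then have "{x. x + t *\<^sub>R e \<in> cball 0 m} \<inter> hplane e = {}" using * by (force simp: abs_le_iff)
      then show ?thesis using dim by (simp add: hausdorff_measure_empty)
    qed
  qed
  also have "\<dots> = hausdorff_measure ?k (cball 0 m \<inter> hplane e) * emeasure lborel {-m..m}"
    by (rule nn_integral_cmult_indicator) auto
  also have "\<dots> < top"
    using hausdorff_cball_hplane_finite[OF dim e] by (cases "-m \<le> m") (auto simp: ennreal_mult_less_top)
  finally show ?thesis .
qed

text \<open>The component of a orthogonal to e is absorbed in every slice by translation invariance
  of the Hausdorff measure, the component along e by that of \<open>lborel\<close>.\<close>

lemma hplane_product_translate: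
  assumes A: "A \<in> sets borel"
  shows "emeasure (hplane_product e) {x. x + a \<in> A} = emeasure (hplane_product e) A"
proof -
  let ?k = "DIM('a) - 1"
  have k: "?k \<ge> 1" using dim by simp
  define s where "s = a \<bullet> e"
  define a' where "a' = a - s *\<^sub>R e"
  have a: "a = a' + s *\<^sub>R e" by (simp add: a'_def)
  have a'e: "a' \<bullet> e = 0" using ee by (simp add: a'_def s_def inner_diff_left)
  let ?h = "\<lambda>t. hausdorff_measure ?k ({x. x + t *\<^sub>R e \<in> A} \<inter> hplane e)"
  have Am: "{x. x + a \<in> A} \<in> sets borel"
    using measurable_sets_borel[of "\<lambda>x. x + a" borel A] A by (simp add: vimage_def)
  have "emeasure (hplane_product e) {x. x + a \<in> A} = (\<integral>\<^sup>+t. ?h (s + t) \<partial>lborel)"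
    unfolding emeasure_hplane_product[OF Am]
  proof (rule nn_integral_cong)
    fix t
    have "{x. x + t *\<^sub>R e \<in> {x. x + a \<in> A}} \<inter> hplane e = {x. x + a' \<in> {x. x + (s + t) *\<^sub>R e \<in> A} \<inter> hplane e}"
      using a'e by (subst a) (auto simp: hplane_def inner_add_left algebra_simps)
    then show "hausdorff_measure ?k ({x. x + t *\<^sub>R e \<in> {x. x + a \<in> A}} \<inter> hplane e) = ?h (s + t)"
      by (simp only: hausdorff_measure_translate[OF k])
  qed
  also have "\<dots> = (\<integral>\<^sup>+t. ?h t \<partial>lborel)"
  proof -
    let ?N = "density (hausdorff_borel ?k) (indicator (hplane e)) :: 'a measure"
    interpret P: pair_sigma_finite ?N lborel
      by (intro pair_sigma_finite.intro sigma_finite_density_hplane sigma_finite_lborel)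
    have [measurable]: "A \<in> sets borel" by (rule A)
    have [measurable]: "(\<lambda>(x, t). x + t *\<^sub>R e) \<in> ?N \<Otimes>\<^sub>M lborel \<rightarrow>\<^sub>M borel" by measurable
    let ?S = "(\<lambda>(x, t). x + t *\<^sub>R e) -` A \<inter> space (?N \<Otimes>\<^sub>M lborel)"
    have S: "?S \<in> sets (?N \<Otimes>\<^sub>M lborel)" by measurable
    have m: "(\<lambda>t. emeasure ?N ((\<lambda>x. (x, t)) -` ?S)) \<in> borel_measurable lborel"
      by (rule P.measurable_emeasure_Pair2[OF S])
    have "emeasure ?N ((\<lambda>x. (x, t)) -` ?S) = ?h t" for t
    proof -
      have "(\<lambda>x. (x, t)) -` ?S = {x. x + t *\<^sub>R e \<in> A}" by (auto simp: space_pair_measure)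
      moreover have "{x. x + t *\<^sub>R e \<in> A} \<in> sets borel"
        using measurable_sets_borel[of "\<lambda>x. x + t *\<^sub>R e" borel A] A by (simp add: vimage_def)
      ultimately show ?thesis by (simp only: emeasure_density_hplane)
    qed
    with m have [measurable]: "?h \<in> borel_measurable borel" by (simp only: measurable_lborel2 measurable_lborel1)
    have "(\<integral>\<^sup>+t. ?h t \<partial>lborel) = (\<integral>\<^sup>+t. ?h t \<partial>distr lborel borel ((+) s))" by (simp add: lborel_distr_plus)
    also have "\<dots> = (\<integral>\<^sup>+t. ?h (s + t) \<partial>lborel)" by (rule nn_integral_distr) measurable
    finally show ?thesis by (rule sym)
  qed
  also have "\<dots> = emeasure (hplane_product e) A" by (rule emeasure_hplane_product[OF A, symmetric])
  finally show ?thesis .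
qed

lemma hplane_product_eq:
  assumes "E \<in> sets borel" "F \<in> sets borel"
  shows "emeasure (hplane_product e) E * emeasure lborel F = emeasure lborel E * emeasure (hplane_product e) {x. - x \<in> F}"
  by (rule translation_invariant_eq_lborel[OF sets_hplane_product _ hplane_product_translate assms])
    (auto intro!: sigma_finite_measure_cballI hplane_product_cball_finite)

end


text \<open>Each direction has its own factor \<open>c e\<close>. Directions are compared on the
  cylinder \<open>Z e\<close>: an orthogonal map between two directions carries one cylinder to the
  other, so neither the volumes nor the Hausdorff measures of the bases differ, and the volume can
  be cancelled.\<close>

lemma hplane_product_eq_lborel:
  assumes dim: "DIM('a::euclidean_space) \<ge> 2"
  obtains \<kappa> :: real where "0 < \<kappa>"
    "\<And>(e::'a) E. norm e = 1 \<Longrightarrow> E \<in> sets borel \<Longrightarrow>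
       emeasure (hplane_product e) E = ennreal \<kappa> * emeasure lborel E"
proof -
  let ?k = "DIM('a) - 1"
  let ?F = "cbox 0 (One::'a)"
  define c where "c e = emeasure (hplane_product e) {x. - x \<in> ?F}" for e :: 'a
  have main: "emeasure (hplane_product e) E = emeasure lborel E * c e"
    if "norm e = 1" "E \<in> sets borel" for e :: 'a and E
  proof -
    have "emeasure lborel ?F = 1" by (subst emeasure_lborel_cbox) auto
    then show ?thesis using hplane_product_eq[OF dim that, of ?F] by (simp add: c_def)
  qed
  define Z where "Z e = {x. norm (x - (x \<bullet> e) *\<^sub>R e) \<le> 1 \<and> 0 \<le> x \<bullet> e \<and> x \<bullet> e \<le> 1}" for e :: 'a
  have Zb: "Z e \<in> sets borel" for e
  proof -
    have "closed (Z e)"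
      unfolding Z_def by (intro closed_Collect_conj closed_Collect_le continuous_intros)
    then show ?thesis by (rule borel_closed)
  qed
  have HZ: "emeasure (hplane_product e) (Z e) = hausdorff_measure ?k (cball 0 1 \<inter> hplane e)" if e: "norm e = 1" for e :: 'a
  proof -
    have "e \<bullet> e = 1" using e by (simp add: dot_square_norm)
    then have "{x. x + t *\<^sub>R e \<in> Z e} \<inter> hplane e = (if t \<in> {0..1} then cball 0 1 \<inter> hplane e else {})" for t
      by (auto simp: Z_def hplane_def inner_add_left)
    then have "emeasure (hplane_product e) (Z e)
        = (\<integral>\<^sup>+t. hausdorff_measure ?k (cball 0 1 \<inter> hplane e) * indicator {0..1::real} t \<partial>lborel)"
      unfolding emeasure_hplane_product[OF dim e Zb] using dim
      by (intro nn_integral_cong) (auto simp: hausdorff_measure_empty)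
    then show ?thesis by (subst (asm) nn_integral_cmult_indicator) auto
  qed
  have lZ: "emeasure lborel (Z e') \<le> emeasure lborel (Z e)" if e: "norm e = 1" "norm e' = 1" for e e'
  proof -
    obtain f where f: "orthogonal_transformation f" "f e = e'" using orthogonal_transformation_unit_vectors[OF e] .
    have lin: "linear f" using f(1) by (rule orthogonal_transformation_linear)
    have iso: "f x \<bullet> e' = x \<bullet> e" for x using f by (auto simp: orthogonal_transformation_def)
    have nf: "norm (f x - (x \<bullet> e) *\<^sub>R e') = norm (x - (x \<bullet> e) *\<^sub>R e)" for x
      using orthogonal_transformation_norm[OF f(1), of "x - (x \<bullet> e) *\<^sub>R e"] f(2) lin
      by (simp add: linear_diff linear_scale)
    have fZ: "f ` Z e = Z e'"
    proof (intro subset_antisym subsetI)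
      fix y assume y: "y \<in> Z e'"
      obtain x where "y = f x" using orthogonal_transformation_surj[OF f(1)] by (metis surjD)
      with y iso nf show "y \<in> f ` Z e" by (auto simp: Z_def)
    qed (use iso nf in \<open>auto simp: Z_def\<close>)
    have "emeasure lborel (f ` Z e) \<le> ennreal (1 ^ DIM('a)) * emeasure lborel (Z e)"
    proof (rule emeasure_lborel_lipschitz_image)
      show "dist (f x) (f y) \<le> 1 * dist x y" for x y
        using orthogonal_transformation_norm[OF f(1), of "x - y"] lin by (simp add: dist_norm linear_diff)
    qed (auto simp: fZ Zb)
    then show ?thesis by (simp add: fZ)
  qed
  have Zfin: "emeasure lborel (Z e) < top" if "norm e = 1" for e
  proof -
    have "Z e \<subseteq> cball 0 2"
    proof
      fix x assume x: "x \<in> Z e"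
      have "norm x \<le> norm (x - (x \<bullet> e) *\<^sub>R e) + norm ((x \<bullet> e) *\<^sub>R e)"
        using norm_triangle_ineq[of "x - (x \<bullet> e) *\<^sub>R e" "(x \<bullet> e) *\<^sub>R e"] by simp
      with x that show "x \<in> cball 0 2" by (simp add: Z_def)
    qed
    then have "emeasure lborel (Z e) \<le> emeasure lborel (cball (0::'a) 2)" by (rule emeasure_mono) auto
    also have "\<dots> < top" by (simp add: emeasure_cball less_top[symmetric])
    finally show ?thesis .
  qed
  have Zpos: "emeasure lborel (Z e) \<noteq> 0" if e: "norm e = 1" for e
  proof -
    have ee: "e \<bullet> e = 1" using e by (simp add: dot_square_norm)
    have "ball ((1/2) *\<^sub>R e) (1/2) \<subseteq> Z e"
    proof
      fix x assume "x \<in> ball ((1/2) *\<^sub>R e) (1/2)"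
      define y where "y = x - (1/2) *\<^sub>R e"
      have y: "norm y < 1/2" using \<open>x \<in> _\<close> by (simp add: y_def dist_norm norm_minus_commute)
      have "x = y + (1/2) *\<^sub>R e" by (simp add: y_def)
      then have xe: "x \<bullet> e = y \<bullet> e + 1/2" "x - (x \<bullet> e) *\<^sub>R e = y - (y \<bullet> e) *\<^sub>R e"
        using ee by (simp_all add: inner_add_left algebra_simps)
      have ye: "\<bar>y \<bullet> e\<bar> \<le> norm y" using Cauchy_Schwarz_ineq2[of y e] e by simp
      have "norm (y - (y \<bullet> e) *\<^sub>R e) \<le> norm y + \<bar>y \<bullet> e\<bar>" using norm_triangle_ineq4[of y "(y \<bullet> e) *\<^sub>R e"] e by simp
      moreover have "0 \<le> y \<bullet> e + 1/2" "y \<bullet> e + 1/2 \<le> 1" using y ye unfolding abs_le_iff by linarith+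
      ultimately show "x \<in> Z e" using y ye xe by (simp add: Z_def)
    qed
    then have "emeasure lborel (ball ((1/2) *\<^sub>R e) (1/2)) \<le> emeasure lborel (Z e)"
      by (rule emeasure_mono) (simp add: Zb)
    moreover have "emeasure lborel (ball ((1/2) *\<^sub>R e) (1/2)) > 0"
      by (simp add: emeasure_ball)
    ultimately show ?thesis by auto
  qed
  have c_eq: "c e = c e'" if e: "norm e = 1" "norm e' = 1" for e e'
  proof -
    have "emeasure lborel (Z e) = emeasure lborel (Z e')" using lZ e by (intro antisym) auto
    moreover have "emeasure lborel (Z e) * c e = emeasure lborel (Z e') * c e'"
      using HZ[OF e(1)] HZ[OF e(2)] main[OF e(1) Zb] main[OF e(2) Zb]
        hausdorff_cball_hplane_eq[of ?k e e' 1] e dim by simp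
    ultimately show ?thesis using Zfin[OF e(1)] Zpos[OF e(1)] by (auto simp: ennreal_mult_cancel_left)
  qed
  obtain b :: 'a where b: "b \<in> Basis" using nonempty_Basis by blast
  have nb: "norm b = 1" using b by simp
  have cfin: "c b < top"
  proof -
    obtain m where "\<forall>y\<in>?F. norm y \<le> m" using bounded_cbox[of 0 "One::'a"] by (auto simp: bounded_iff)
    then have "{x. - x \<in> ?F} \<subseteq> cball 0 m" by (metis (mono_tags, lifting) mem_Collect_eq mem_cball_0 norm_minus_cancel subsetI)
    then have "c b \<le> emeasure (hplane_product b) (cball 0 m)" unfolding c_def by (rule emeasure_mono) simp
    then show ?thesis using hplane_product_cball_finite[OF dim nb] le_less_trans by blast
  qed
  \<comment> \<open>For a coordinate direction b the slices of the unit cube are coordinate cubes,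
    whose measure is positive.\<close>
  have cpos: "c b \<noteq> 0"
  proof
    assume "c b = 0"
    then have "emeasure (hplane_product b) ?F = 0" using main[OF nb, of ?F] by simp
    moreover have "emeasure (hplane_product b) ?F = hausdorff_measure ?k (coord_cube (Basis - {b}))"
    proof -
      have eq: "{x. x + t *\<^sub>R b \<in> ?F} \<inter> hplane b = (if t \<in> {0..1} then coord_cube (Basis - {b}) else {})" for t
      proof -
        have "(x \<in> {x. x + t *\<^sub>R b \<in> ?F} \<inter> hplane b) \<longleftrightarrow> (t \<in> {0..1} \<and> x \<in> coord_cube (Basis - {b}))" for x
        proof -
          have c: "(x + t *\<^sub>R b) \<bullet> c = x \<bullet> c + (if c = b then t else 0)" if "c \<in> Basis" for c
            using b that by (simp add: inner_add_left inner_Basis)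
          have "x \<in> {x. x + t *\<^sub>R b \<in> ?F} \<inter> hplane b \<longleftrightarrow>
              x \<bullet> b = 0 \<and> (\<forall>c\<in>Basis. 0 \<le> x \<bullet> c + (if c = b then t else 0) \<and> x \<bullet> c + (if c = b then t else 0) \<le> 1)"
            by (simp add: mem_box hplane_def c conj_commute cong: ball_cong)
          also have "\<dots> \<longleftrightarrow> t \<in> {0..1} \<and> (\<forall>c\<in>Basis. if c \<in> Basis - {b} then 0 \<le> x \<bullet> c \<and> x \<bullet> c \<le> 1 else x \<bullet> c = 0)"
            using b by (smt (verit, best) DiffI Diff_iff atLeastAtMost_iff singletonI singletonD)
          finally show ?thesis by (simp add: coord_cube_def)
        qed
        then show ?thesis by auto
      qed
      have "emeasure (hplane_product b) ?F
          = (\<integral>\<^sup>+t. hausdorff_measure ?k (coord_cube (Basis - {b})) * indicator {0..1::real} t \<partial>lborel)"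
        unfolding emeasure_hplane_product[OF dim nb borel_closed[OF closed_cbox]] eq using dim
        by (intro nn_integral_cong) (auto simp: hausdorff_measure_empty)
      then show ?thesis by (subst (asm) nn_integral_cmult_indicator) auto
    qed
    moreover have "0 < hausdorff_measure ?k (coord_cube (Basis - {b}))"
      by (rule hausdorff_measure_coord_cube_pos) (use b dim in auto)
    ultimately show False by simp
  qed
  show thesis
  proof (rule that[of "enn2real (c b)"])
    show "0 < enn2real (c b)" using cpos cfin by (simp add: enn2real_positive_iff zero_less_iff_neq_zero)
    fix e :: 'a and E assume e: "norm e = 1" "E \<in> sets (borel::'a measure)"
    show "emeasure (hplane_product e) E = ennreal (enn2real (c b)) * emeasure lborel E"
      using main[OF e] c_eq[OF e(1) nb] cfin by (simp add: mult.commute)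
  qed
qed

section \<open>Area of a flat piece from the volume of its cone\<close>

definition cone01 :: "'a::real_vector set \<Rightarrow> 'a set" where
  "cone01 A = (\<lambda>(t, x). t *\<^sub>R x) ` ({0..1} \<times> A)"

lemma compact_cone01:
  fixes A :: "'a::real_normed_vector set"
  shows "compact A \<Longrightarrow> compact (cone01 A)"
  unfolding cone01_def by (intro compact_continuous_image compact_Times compact_Icc) (auto intro!: continuous_intros simp: case_prod_beta)

text \<open>Base times height over n: the hyperplane has distance a = 1/|p| from the origin, the
  slice of the cone at height t is B moved into \<open>hplane e\<close> and scaled by t/a, and
  integrating (t/a)^(n-1) gives a/n. Curved pieces of a level set are later compared with flat ones,
  for which this identity is exact.\<close>

lemma hausdorff_measure_flat_cone:
  fixes B :: "'a::euclidean_space set"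
  assumes dim: "DIM('a) \<ge> 2"
    and \<kappa>: "0 < \<kappa>" "\<And>(e::'a) E. norm e = 1 \<Longrightarrow> E \<in> sets borel \<Longrightarrow>
       emeasure (hplane_product e) E = ennreal \<kappa> * emeasure lborel E"
    and B: "compact B" "B \<subseteq> {y. p \<bullet> y = 1}" and p: "p \<noteq> 0"
  shows "hausdorff_measure (DIM('a) - 1) B = ennreal (\<kappa> * DIM('a) * norm p) * emeasure lborel (cone01 B)"
proof -
  let ?k = "DIM('a) - 1"
  have k: "?k \<ge> 1" using dim by simp
  define a where "a = 1 / norm p"
  have a: "a > 0" using p by (simp add: a_def)
  define e where "e = a *\<^sub>R p"
  have e: "norm e = 1" using p by (simp add: e_def a_def)
  have ee: "e \<bullet> e = 1" using e by (simp add: dot_square_norm)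
  have Be: "y \<bullet> e = a" if "y \<in> B" for y using B that by (auto simp: e_def inner_commute)
  define B0 where "B0 = (\<lambda>y. y - a *\<^sub>R e) ` B"
  have HB0: "hausdorff_measure ?k B0 = hausdorff_measure ?k B"
    unfolding B0_def by (rule hausdorff_measure_isometry[OF k]) (simp add: dist_norm)
  have slice: "{x. x + t *\<^sub>R e \<in> cone01 B} \<inter> hplane e = (if 0 < t \<and> t \<le> a then (*\<^sub>R) (t / a) ` B0 else {})" if "t \<noteq> 0" for t
  proof -
    have "x \<in> {x. x + t *\<^sub>R e \<in> cone01 B} \<inter> hplane e \<longleftrightarrow> 0 < t \<and> t \<le> a \<and> x \<in> (*\<^sub>R) (t / a) ` B0" for x
    proof
      assume "x \<in> {x. x + t *\<^sub>R e \<in> cone01 B} \<inter> hplane e"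
      then obtain s y where s: "0 \<le> s" "s \<le> 1" "y \<in> B" "x + t *\<^sub>R e = s *\<^sub>R y" and x: "x \<bullet> e = 0"
        by (auto simp: cone01_def hplane_def)
      have "(x + t *\<^sub>R e) \<bullet> e = s * a" using s Be by simp
      then have t: "t = s * a" using x ee by (simp add: inner_add_left)
      then have "x = (t / a) *\<^sub>R (y - a *\<^sub>R e)" using s(4) a by (simp add: algebra_simps)
      then show "0 < t \<and> t \<le> a \<and> x \<in> (*\<^sub>R) (t / a) ` B0"
        using s t a that by (auto simp: B0_def mult_left_le_one_le)
    next
      assume "0 < t \<and> t \<le> a \<and> x \<in> (*\<^sub>R) (t / a) ` B0"
      then obtain y where t: "0 < t" "t \<le> a" and y: "y \<in> B" "x = (t / a) *\<^sub>R (y - a *\<^sub>R e)" by (auto simp: B0_def)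
      have "x + t *\<^sub>R e = (t / a) *\<^sub>R y" using y a by (simp add: algebra_simps)
      moreover have "0 \<le> t / a" "t / a \<le> 1" using t a by (auto simp: field_simps)
      ultimately have "x + t *\<^sub>R e \<in> cone01 B" using y by (auto simp: cone01_def intro!: image_eqI[of _ _ "(t / a, y)"])
      moreover have "x \<bullet> e = 0" using y Be ee by (simp add: inner_diff_left)
      ultimately show "x \<in> {x. x + t *\<^sub>R e \<in> cone01 B} \<inter> hplane e" by (simp add: hplane_def)
    qed
    then show ?thesis by auto
  qed
  have "ennreal \<kappa> * emeasure lborel (cone01 B) = emeasure (hplane_product e) (cone01 B)"
    by (rule \<kappa>(2)[OF e, symmetric]) (use compact_cone01[OF B(1)] in \<open>auto intro: borel_compact\<close>)
  also have "\<dots> = (\<integral>\<^sup>+t. hausdorff_measure ?k ({x. x + t *\<^sub>R e \<in> cone01 B} \<inter> hplane e) \<partial>lborel)"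
    by (rule emeasure_hplane_product[OF dim e]) (use compact_cone01[OF B(1)] in \<open>auto intro: borel_compact\<close>)
  also have "\<dots> = (\<integral>\<^sup>+t. hausdorff_measure ?k B * (ennreal ((t / a) ^ ?k) * indicator {0..a} t) \<partial>lborel)"
  proof (rule nn_integral_cong_AE)
    have "AE t in lborel. t \<noteq> (0::real)" by (rule AE_lborel_singleton)
    then show "AE t in lborel. hausdorff_measure ?k ({x. x + t *\<^sub>R e \<in> cone01 B} \<inter> hplane e)
        = hausdorff_measure ?k B * (ennreal ((t / a) ^ ?k) * indicator {0..a} t)"
    proof eventually_elim
      case (elim t)
      show ?case
      proof (cases "0 < t \<and> t \<le> a")
        case True
        then show ?thesis
          using hausdorff_measure_scale[OF k, of "t / a" B0] a HB0 by (simp only: slice[OF elim]) (simp add: mult.commute)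
      next
        case False
        then have "indicator {0..a} t = (0::ennreal)" using elim by auto
        then show ?thesis using False k by (simp only: slice[OF elim]) (simp add: hausdorff_measure_empty)
      qed
    qed
  qed
  also have "\<dots> = hausdorff_measure ?k B * (\<integral>\<^sup>+t. ennreal ((t / a) ^ ?k) * indicator {0..a} t \<partial>lborel)"
    by (rule nn_integral_cmult) measurable
  also have "(\<integral>\<^sup>+t. ennreal ((t / a) ^ ?k) * indicator {0..a} t \<partial>lborel) = ennreal (a / DIM('a))"
  proof -
    let ?G = "\<lambda>t. a * (t / a) ^ DIM('a) / DIM('a)"
    have "(\<integral>\<^sup>+t. ennreal ((t / a) ^ ?k) * indicator {0..a} t \<partial>lborel) = ennreal (?G a - ?G 0)"
    proof (rule nn_integral_FTC_Icc)
      fix t assume "t \<in> {0..a}"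
      then show "0 \<le> (t / a) ^ ?k" using a by simp
      have "((\<lambda>t. a * (t / a) ^ Suc m / real (Suc m)) has_real_derivative (t / a) ^ m) (at t)" for m
        using a by (auto intro!: derivative_eq_intros simp del: of_nat_Suc power_Suc)
      from this[of ?k] show "(?G has_real_derivative (t / a) ^ ?k) (at t)"
        using dim by (simp only: Suc_diff_1 DIM_positive)
    qed (use a in auto)
    moreover have "?G a - ?G 0 = a / DIM('a)" using a dim by (simp add: power_0_left)
    ultimately show ?thesis by (simp only:)
  qed
  finally have eq: "ennreal \<kappa> * emeasure lborel (cone01 B) = hausdorff_measure ?k B * ennreal (a / DIM('a))" .
  have "ennreal (\<kappa> * DIM('a) * norm p) * emeasure lborel (cone01 B)
      = ennreal (DIM('a) * norm p) * (ennreal \<kappa> * emeasure lborel (cone01 B))"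
    using \<kappa>(1) by (simp add: ennreal_mult mult.assoc mult.left_commute mult.commute)
  also have "\<dots> = hausdorff_measure ?k B * (ennreal (DIM('a) * norm p) * ennreal (a / DIM('a)))"
    unfolding eq by (simp only: mult.left_commute)
  also have "ennreal (DIM('a) * norm p) * ennreal (a / DIM('a)) = 1"
    using a p by (subst ennreal_mult[symmetric]) (auto simp: a_def)
  finally show ?thesis by simp
qed

subsection \<open>Directional derivatives of gauges\<close>

text \<open>Difference quotients of a convex function decrease with the step, so for a gauge the
  infimum along the steps 1/(j+1) is the one-sided directional derivative. A countable infimum keeps
  it measurable and defines it at every point.\<close>

definition dird :: "('a::real_vector \<Rightarrow> real) \<Rightarrow> 'a \<Rightarrow> 'a \<Rightarrow> real" where
  "dird g x v = (INF j. real (Suc j) * (g (x + (1 / real (Suc j)) *\<^sub>R v) - g x))"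

definition sgrad :: "('a::euclidean_space \<Rightarrow> real) \<Rightarrow> 'a \<Rightarrow> 'a" where
  "sgrad g x = (\<Sum>b\<in>Basis. dird g x b *\<^sub>R b)"

text \<open>Two-sided differentiability along the coordinate axes only; for a gauge this already
  yields the full derivative (\<open>dird_eq_sgrad\<close>, \<open>frechet\<close>).\<close>

definition regpt :: "('a::euclidean_space \<Rightarrow> real) \<Rightarrow> 'a \<Rightarrow> bool" where
  "regpt g x \<longleftrightarrow> (\<forall>b\<in>Basis. dird g x (- b) = - dird g x b)"

text \<open>The model is the support function of a convex body between the balls of radius m and M
  around the origin. As g need not be even, estimates in the directions v and -v are
  separate.\<close>

locale sublinear_gauge =
  fixes g :: "'a::euclidean_space \<Rightarrow> real" and m M :: real
  assumes sub: "\<And>x y. g (x + y) \<le> g x + g y"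
    and hom: "\<And>t x. 0 \<le> t \<Longrightarrow> g (t *\<^sub>R x) = t * g x"
    and m_pos: "0 < m"
    and lower: "\<And>x. m * norm x \<le> g x"
    and upper: "\<And>x. g x \<le> M * norm x"
begin

lemma g_0 [simp]: "g 0 = 0"
  using hom[of 0 0] by simp

lemma g_nonneg: "0 \<le> g x"
  using lower[of x] m_pos by (meson mult_nonneg_nonneg norm_ge_zero less_imp_le order_trans)

lemma g_pos: "x \<noteq> 0 \<Longrightarrow> 0 < g x"
  using lower[of x] m_pos by (meson less_le_trans mult_pos_pos zero_less_norm_iff)

lemma g_lipschitz: "\<bar>g x - g y\<bar> \<le> M * norm (x - y)"
  using sub[of y "x - y"] sub[of x "y - x"] upper[of "x - y"] upper[of "y - x"]
  by (simp add: norm_minus_commute abs_le_iff)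

lemma M_ge_m: "m \<le> M"
proof -
  obtain b :: 'a where "b \<in> Basis" using nonempty_Basis by blast
  then show ?thesis using lower[of b] upper[of b] by simp
qed

lemma M_pos: "0 < M" using m_pos M_ge_m by linarith

lemma continuous_on_g: "continuous_on S g"
proof (rule continuous_on_subset[OF lipschitz_on_continuous_on])
  show "M-lipschitz_on UNIV g"
    using g_lipschitz M_pos by (intro lipschitz_onI) (auto simp: dist_real_def dist_norm)
qed auto

lemma measurable_g [measurable]: "g \<in> borel_measurable borel"
  by (intro borel_measurable_continuous_onI continuous_on_g)

lemma quotient_mono:
  assumes "0 < s" "s \<le> t"
  shows "(g (x + s *\<^sub>R v) - g x) / s \<le> (g (x + t *\<^sub>R v) - g x) / t"
proof -
  have t: "0 < t" using assms by simp
  have "x + s *\<^sub>R v = (1 - s / t) *\<^sub>R x + (s / t) *\<^sub>R (x + t *\<^sub>R v)"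
    using t by (simp add: algebra_simps)
  then have "g (x + s *\<^sub>R v) \<le> g ((1 - s / t) *\<^sub>R x) + g ((s / t) *\<^sub>R (x + t *\<^sub>R v))"
    by (metis sub)
  also have "\<dots> = (1 - s / t) * g x + (s / t) * g (x + t *\<^sub>R v)"
    using assms t by (simp add: hom)
  finally show ?thesis using assms t by (simp add: field_simps)
qed

lemma quotient_ge: "0 < s \<Longrightarrow> - g (- v) \<le> (g (x + s *\<^sub>R v) - g x) / s"
  using sub[of "x + s *\<^sub>R v" "s *\<^sub>R (- v)"] hom[of s "- v"] by (simp add: field_simps)

lemma quotient_le: "0 < s \<Longrightarrow> (g (x + s *\<^sub>R v) - g x) / s \<le> g v"
  using sub[of x "s *\<^sub>R v"] hom[of s v] by (simp add: field_simps)

lemma dird_quotient: "real (Suc j) * (g (x + (1 / real (Suc j)) *\<^sub>R v) - g x)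
    = (g (x + (1 / real (Suc j)) *\<^sub>R v) - g x) / (1 / real (Suc j))"
  by (simp add: mult.commute)

lemma bdd_below_quotients: "bdd_below (range (\<lambda>j. real (Suc j) * (g (x + (1 / real (Suc j)) *\<^sub>R v) - g x)))"
proof (rule bdd_belowI)
  fix z assume "z \<in> range (\<lambda>j. real (Suc j) * (g (x + (1 / real (Suc j)) *\<^sub>R v) - g x))"
  then show "- g (- v) \<le> z" by (auto simp only: dird_quotient intro!: quotient_ge) simp
qed

lemma dird_LIMSEQ: "(\<lambda>j. real (Suc j) * (g (x + (1 / real (Suc j)) *\<^sub>R v) - g x)) \<longlonglongrightarrow> dird g x v"
  unfolding dird_def
proof (rule LIMSEQ_decseq_INF[OF bdd_below_quotients])
  show "decseq (\<lambda>j. real (Suc j) * (g (x + (1 / real (Suc j)) *\<^sub>R v) - g x))"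
    unfolding dird_quotient by (intro decseq_SucI quotient_mono) (auto simp: field_simps)
qed

lemma dird_le_quotient:
  assumes "0 < s" shows "dird g x v \<le> (g (x + s *\<^sub>R v) - g x) / s"
proof -
  obtain j where j: "inverse (real (Suc j)) < s" using reals_Archimedean assms by blast
  have "dird g x v \<le> real (Suc j) * (g (x + (1 / real (Suc j)) *\<^sub>R v) - g x)"
    unfolding dird_def by (rule cINF_lower[OF bdd_below_quotients]) simp
  also have "\<dots> \<le> (g (x + s *\<^sub>R v) - g x) / s"
    unfolding dird_quotient using j by (intro quotient_mono) (auto simp: inverse_eq_divide)
  finally show ?thesis .
qed

lemma dird_geI:
  assumes "\<And>s. 0 < s \<Longrightarrow> c \<le> (g (x + s *\<^sub>R v) - g x) / s"
  shows "c \<le> dird g x v"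
proof (rule LIMSEQ_le_const[OF dird_LIMSEQ], intro exI allI impI)
  show "c \<le> real (Suc j) * (g (x + (1 / real (Suc j)) *\<^sub>R v) - g x)" for j
    unfolding dird_quotient by (rule assms) simp
qed

lemma dird_le: "dird g x v \<le> g v"
  using dird_le_quotient[of 1 x v] quotient_le[of 1 x v] by linarith

lemma dird_subadd: "dird g x (v + w) \<le> dird g x v + dird g x w"
proof (rule LIMSEQ_le_const[OF tendsto_add[OF dird_LIMSEQ dird_LIMSEQ]], intro exI allI impI)
  fix j :: nat
  define s where "s = 1 / real (Suc j)"
  have s: "s > 0" by (simp add: s_def)
  have "x + (s / 2) *\<^sub>R (v + w) = (1/2) *\<^sub>R (x + s *\<^sub>R v) + (1/2) *\<^sub>R (x + s *\<^sub>R w)"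
    by (simp add: algebra_simps flip: scaleR_left.add)
  then have "g (x + (s / 2) *\<^sub>R (v + w)) \<le> g ((1/2) *\<^sub>R (x + s *\<^sub>R v)) + g ((1/2) *\<^sub>R (x + s *\<^sub>R w))"
    by (metis sub)
  also have "\<dots> = g (x + s *\<^sub>R v) / 2 + g (x + s *\<^sub>R w) / 2" by (simp add: hom)
  finally have "(2 * g (x + (s / 2) *\<^sub>R (v + w)) - 2 * g x) / s \<le> (g (x + s *\<^sub>R v) + g (x + s *\<^sub>R w) - 2 * g x) / s"
    using s by (intro divide_right_mono) auto
  then have "(g (x + (s / 2) *\<^sub>R (v + w)) - g x) / (s / 2) \<le> (g (x + s *\<^sub>R v) - g x) / s + (g (x + s *\<^sub>R w) - g x) / s"
    by (simp add: diff_divide_distrib add_divide_distrib mult.commute)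
  then show "dird g x (v + w) \<le> real (Suc j) * (g (x + (1 / real (Suc j)) *\<^sub>R v) - g x)
     + real (Suc j) * (g (x + (1 / real (Suc j)) *\<^sub>R w) - g x)"
    unfolding dird_quotient unfolding s_def[symmetric] using dird_le_quotient[of "s / 2" x "v + w"] s
    by (meson half_gt_zero order_trans)
qed

lemma dird_scale: assumes t: "0 < t" shows "dird g x (t *\<^sub>R v) = t * dird g x v"
proof -
  have le: "dird g x (t *\<^sub>R v) \<le> t * dird g x v" if t: "0 < t" for t v
  proof (rule LIMSEQ_le_const[OF tendsto_mult_left[OF dird_LIMSEQ]], intro exI allI impI)
    fix j :: nat
    show "dird g x (t *\<^sub>R v) \<le> t * (real (Suc j) * (g (x + (1 / real (Suc j)) *\<^sub>R v) - g x))"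
      using dird_le_quotient[of "1 / (t * real (Suc j))" x "t *\<^sub>R v"] t
      by (simp add: mult_ac del: of_nat_Suc)
  qed
  have "dird g x v \<le> (1 / t) * dird g x (t *\<^sub>R v)" using le[of "1 / t" "t *\<^sub>R v"] t by simp
  then show ?thesis using le[OF t, of v] t by (simp add: field_simps)
qed

lemma dird_0: "dird g x 0 = 0"
  by (simp add: dird_def)

text \<open>Differentiating a 1-homogeneous function lowers the degree to 0, so gradient and
  regularity are constant along rays. This is what lets area on the level g = 1 be read off from
  cones.\<close>

lemma dird_cone: assumes t: "0 < t" shows "dird g (t *\<^sub>R x) v = dird g x v"
proof -
  have le: "dird g (t *\<^sub>R x) v \<le> dird g x v" if t: "0 < t" for t x
  proof (rule LIMSEQ_le_const[OF dird_LIMSEQ], intro exI allI impI)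
    fix j :: nat
    define s where "s = 1 / real (Suc j)"
    have s: "s > 0" by (simp add: s_def)
    have "t *\<^sub>R x + (t * s) *\<^sub>R v = t *\<^sub>R (x + s *\<^sub>R v)" by (simp add: algebra_simps)
    then have "g (t *\<^sub>R x + (t * s) *\<^sub>R v) = t * g (x + s *\<^sub>R v)"
      using t by (simp only: hom less_imp_le)
    then have "(g (t *\<^sub>R x + (t * s) *\<^sub>R v) - g (t *\<^sub>R x)) / (t * s) = (g (x + s *\<^sub>R v) - g x) / s"
      using t s by (simp add: hom right_diff_distrib[symmetric])
    then show "dird g (t *\<^sub>R x) v \<le> real (Suc j) * (g (x + (1 / real (Suc j)) *\<^sub>R v) - g x)"
      unfolding dird_quotient using dird_le_quotient[of "t * s" "t *\<^sub>R x" v] t s by (simp add: s_def)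
  qed
  show ?thesis using le[OF t, of x] le[of "1 / t" "t *\<^sub>R x"] t by simp
qed

lemma dird_self: "dird g x x = g x"
proof (rule antisym)
  show "dird g x x \<le> g x" by (rule dird_le)
  show "g x \<le> dird g x x"
  proof (rule dird_geI)
    fix s :: real assume s: "0 < s"
    have "x + s *\<^sub>R x = (1 + s) *\<^sub>R x" by (simp add: algebra_simps)
    then have "g (x + s *\<^sub>R x) = (1 + s) * g x" using s by (simp only: hom)
    then show "g x \<le> (g (x + s *\<^sub>R x) - g x) / s" using s by (simp add: field_simps)
  qed
qed

lemma dird_at_0: "dird g 0 v = g v"
  by (rule antisym[OF dird_le dird_geI]) (simp add: hom)

lemma sgrad_cone: "0 < t \<Longrightarrow> sgrad g (t *\<^sub>R x) = sgrad g x"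
  by (simp add: sgrad_def dird_cone)

lemma regpt_cone: "0 < t \<Longrightarrow> regpt g (t *\<^sub>R x) \<longleftrightarrow> regpt g x"
  by (simp add: regpt_def dird_cone)

text \<open>At the origin the one-sided derivatives in the directions b and -b are both positive.
  Regularity thus excludes the origin, and later arguments obtain g z > 0 from it.\<close>

lemma not_regpt_0: "\<not> regpt g 0"
proof
  assume r: "regpt g 0"
  obtain b :: 'a where b: "b \<in> Basis" using nonempty_Basis by blast
  then have "g (- b) = - g b" using r by (simp add: regpt_def dird_at_0)
  then show False using g_pos[of b] g_nonneg[of "- b"] b by force
qed

text \<open>The directional derivative is sublinear in v, so expanding v in the basis bounds it
  above by the linear form. Its values at v and -v have a nonnegative sum, so the upper bounds at v
  and -v leave no room.\<close>

lemma dird_eq_sgrad: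
  assumes r: "regpt g x" shows "dird g x v = sgrad g x \<bullet> v"
proof -
  have sums: "dird g x (\<Sum>b\<in>B. f b) \<le> (\<Sum>b\<in>B. dird g x (f b))" if "finite B" for B and f :: "'a \<Rightarrow> 'a"
    using that
  proof induction
    case (insert b B)
    then show ?case using dird_subadd[of x "f b" "\<Sum>b\<in>B. f b"] by simp
  qed (simp add: dird_0)
  have le: "dird g x v \<le> sgrad g x \<bullet> v" for v
  proof -
    have "dird g x v = dird g x (\<Sum>b\<in>Basis. (v \<bullet> b) *\<^sub>R b)" by (simp add: euclidean_representation)
    also have "\<dots> \<le> (\<Sum>b\<in>Basis. dird g x ((v \<bullet> b) *\<^sub>R b))" by (rule sums) simp
    also have "\<dots> = (\<Sum>b\<in>Basis. dird g x b * (b \<bullet> v))"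
    proof (rule sum.cong[OF refl])
      fix b :: 'a assume b: "b \<in> Basis"
      consider "v \<bullet> b = 0" | "v \<bullet> b > 0" | "v \<bullet> b < 0" by linarith
      then show "dird g x ((v \<bullet> b) *\<^sub>R b) = dird g x b * (b \<bullet> v)"
      proof cases
        case 3
        have "dird g x ((v \<bullet> b) *\<^sub>R b) = dird g x ((- (v \<bullet> b)) *\<^sub>R (- b))" by simp
        also have "\<dots> = - (v \<bullet> b) * dird g x (- b)" using 3 by (subst dird_scale) auto
        also have "\<dots> = dird g x b * (b \<bullet> v)" using r b by (simp add: regpt_def inner_commute)
        finally show ?thesis .
      qed (simp_all add: dird_0 dird_scale inner_commute)
    qed
    also have "\<dots> = sgrad g x \<bullet> v" by (simp add: sgrad_def inner_sum_left)
    finally show ?thesis .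
  qed
  have "0 \<le> dird g x v + dird g x (- v)" using dird_subadd[of x v "- v"] by (simp add: dird_0)
  then show ?thesis using le[of v] le[of "- v"] by simp
qed

lemma subgradient:
  assumes r: "regpt g x" shows "g x + sgrad g x \<bullet> (y - x) \<le> g y"
  using dird_le_quotient[of 1 x "y - x"] dird_eq_sgrad[OF r, of "y - x"] by simp

lemma sgrad_inner_le: "regpt g x \<Longrightarrow> sgrad g x \<bullet> v \<le> g v"
  using dird_le[of x v] dird_eq_sgrad by simp

lemma sgrad_inner_self: "regpt g x \<Longrightarrow> sgrad g x \<bullet> x = g x"
  using dird_self[of x] dird_eq_sgrad by simp

lemma norm_sgrad_le:
  assumes "regpt g x" shows "norm (sgrad g x) \<le> M"
proof (cases "sgrad g x = 0")
  case False
  have "norm (sgrad g x) * norm (sgrad g x) \<le> M * norm (sgrad g x)"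
    using sgrad_inner_le[OF assms, of "sgrad g x"] upper[of "sgrad g x"]
    by (simp add: power2_eq_square flip: power2_norm_eq_inner)
  then show ?thesis using False by simp
qed (use M_pos in simp)

lemma norm_sgrad_ge:
  assumes r: "regpt g x" shows "m \<le> norm (sgrad g x)"
proof -
  have x: "x \<noteq> 0" using r not_regpt_0 by auto
  have "m * norm x \<le> norm (sgrad g x) * norm x"
    using lower[of x] sgrad_inner_self[OF r] norm_cauchy_schwarz[of "sgrad g x" x] by linarith
  then show ?thesis using x by simp
qed

text \<open>The lower bound is the subgradient inequality. For the upper bound, x + v is the average
  of n points, each obtained from x by n times one coordinate component of v, and convexity reduces
  the claim to finitely many one-dimensional estimates.\<close>

lemma frechet:
  assumes r: "regpt g x" and \<epsilon>: "0 < \<epsilon>"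
  obtains \<delta> where "0 < \<delta>" "\<And>y. norm (y - x) < \<delta> \<Longrightarrow> \<bar>g y - g x - sgrad g x \<bullet> (y - x)\<bar> \<le> \<epsilon> * norm (y - x)"
proof -
  define n where "n = real DIM('a)"
  have n: "n \<ge> 1" unfolding n_def using DIM_positive[where 'a='a] by (simp add: Suc_leI)
  define W where "W = (Basis \<union> uminus ` Basis :: 'a set)"
  have "\<exists>\<delta>>0. \<forall>s. 0 \<le> s \<and> s \<le> \<delta> \<longrightarrow> g (x + s *\<^sub>R w) \<le> g x + s * (sgrad g x \<bullet> w + \<epsilon> / n)" for w
  proof -
    have "eventually (\<lambda>j. real (Suc j) * (g (x + (1 / real (Suc j)) *\<^sub>R w) - g x) < dird g x w + \<epsilon> / n) sequentially"
      using \<epsilon> n by (intro order_tendstoD[OF dird_LIMSEQ]) simp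
    then obtain j where j: "(g (x + (1 / real (Suc j)) *\<^sub>R w) - g x) / (1 / real (Suc j)) < dird g x w + \<epsilon> / n"
      unfolding dird_quotient eventually_sequentially by blast
    show ?thesis
    proof (intro exI[of _ "1 / real (Suc j)"] conjI allI impI)
      fix s assume s: "0 \<le> s \<and> s \<le> 1 / real (Suc j)"
      show "g (x + s *\<^sub>R w) \<le> g x + s * (sgrad g x \<bullet> w + \<epsilon> / n)"
      proof (cases "s = 0")
        case False
        then have "(g (x + s *\<^sub>R w) - g x) / s \<le> sgrad g x \<bullet> w + \<epsilon> / n"
          using quotient_mono[of s "1 / real (Suc j)" x w] j s dird_eq_sgrad[OF r, of w] by linarith
        moreover have "0 < s" using False s by simp
        ultimately show ?thesis by (simp add: pos_divide_le_eq mult.commute)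
      qed simp
    qed simp
  qed
  then obtain d where d: "\<And>w. 0 < d w" "\<And>w s. 0 \<le> s \<Longrightarrow> s \<le> d w \<Longrightarrow> g (x + s *\<^sub>R w) \<le> g x + s * (sgrad g x \<bullet> w + \<epsilon> / n)"
    by metis
  \<comment> \<open>The averaging stretches every coordinate step by n, hence the division.\<close>
  define \<delta> where "\<delta> = Min (d ` W) / n"
  have fW: "finite (d ` W)" "d ` W \<noteq> {}" using nonempty_Basis by (auto simp: W_def)
  have "0 < Min (d ` W)" using fW d(1) by (subst Min_gr_iff) auto
  then have \<delta>: "0 < \<delta>" using n by (simp add: \<delta>_def)
  have \<delta>d: "n * s \<le> d w" if "w \<in> W" "s < \<delta>" for s w
  proof -
    have "n * s \<le> Min (d ` W)" using that n by (simp add: \<delta>_def field_simps)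
    also have "\<dots> \<le> d w" using fW that by (intro Min_le) auto
    finally show ?thesis .
  qed
  have up: "g y \<le> g x + sgrad g x \<bullet> (y - x) + \<epsilon> * norm (y - x)" if y: "norm (y - x) < \<delta>" for y
  proof -
    define v where "v = y - x"
    have sums: "g (\<Sum>b\<in>B. f b) \<le> (\<Sum>b\<in>B. g (f b))" if "finite B" for B and f :: "'a \<Rightarrow> 'a"
      using that
    proof induction
      case (insert b B)
      then show ?case using sub[of "f b" "\<Sum>b\<in>B. f b"] by simp
    qed simp
    have xs: "(\<Sum>b\<in>(Basis::'a set). (1 / n) *\<^sub>R x) = x"
    proof -
      have "(\<Sum>b\<in>(Basis::'a set). (1 / n) *\<^sub>R x) = n *\<^sub>R ((1 / n) *\<^sub>R x)"
        unfolding n_def by (rule sum_constant_scaleR)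
      also have "\<dots> = x" using n by simp
      finally show ?thesis .
    qed
    have "y = (\<Sum>b\<in>(Basis::'a set). (1 / n) *\<^sub>R x) + (\<Sum>b\<in>Basis. (v \<bullet> b) *\<^sub>R b)"
      unfolding xs by (simp add: v_def euclidean_representation)
    also have "\<dots> = (\<Sum>b\<in>Basis. (1 / n) *\<^sub>R (x + (n * (v \<bullet> b)) *\<^sub>R b))"
      using n by (simp add: scaleR_add_right flip: sum.distrib)
    finally have "g y \<le> (\<Sum>b\<in>Basis. g ((1 / n) *\<^sub>R (x + (n * (v \<bullet> b)) *\<^sub>R b)))"
      using sums[OF finite_Basis] by metis
    also have "\<dots> = (\<Sum>b\<in>Basis. g (x + (n * (v \<bullet> b)) *\<^sub>R b) / n)"
      using n by (intro sum.cong refl) (subst hom, auto)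
    also have "\<dots> \<le> (\<Sum>b\<in>Basis. g x / n + (v \<bullet> b) * (sgrad g x \<bullet> b) + norm v * (\<epsilon> / n))"
    proof (rule sum_mono)
      fix b :: 'a assume b: "b \<in> Basis"
      define w where "w = (if v \<bullet> b \<ge> 0 then b else - b)"
      define s where "s = \<bar>v \<bullet> b\<bar>"
      have w: "w \<in> W" using b by (auto simp: w_def W_def)
      have s: "0 \<le> s" "s \<le> norm v" using Basis_le_norm[OF b, of v] by (auto simp: s_def)
      then have "s < \<delta>" using y by (simp add: v_def)
      then have "g (x + (n * s) *\<^sub>R w) \<le> g x + (n * s) * (sgrad g x \<bullet> w + \<epsilon> / n)"
        using s n w \<delta>d by (intro d) auto
      also have "(n * s) *\<^sub>R w = (n * (v \<bullet> b)) *\<^sub>R b" by (simp add: w_def s_def)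
      finally have "g (x + (n * (v \<bullet> b)) *\<^sub>R b) / n \<le> (g x + (n * s) * (sgrad g x \<bullet> w + \<epsilon> / n)) / n"
        using n by (intro divide_right_mono) auto
      also have "\<dots> = g x / n + s * (sgrad g x \<bullet> w) + s * (\<epsilon> / n)" using n by (simp add: field_simps)
      also have "s * (sgrad g x \<bullet> w) = (v \<bullet> b) * (sgrad g x \<bullet> b)" by (simp add: s_def w_def)
      also have "s * (\<epsilon> / n) \<le> norm v * (\<epsilon> / n)" using s \<epsilon> n by (intro mult_right_mono) auto
      finally show "g (x + (n * (v \<bullet> b)) *\<^sub>R b) / n \<le> g x / n + (v \<bullet> b) * (sgrad g x \<bullet> b) + norm v * (\<epsilon> / n)"
        by simp
    qed
    also have "\<dots> = g x + sgrad g x \<bullet> v + \<epsilon> * norm v"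
    proof -
      have "(\<Sum>b\<in>Basis. (v \<bullet> b) * (sgrad g x \<bullet> b)) = sgrad g x \<bullet> v"
        by (subst euclidean_inner) (simp add: mult.commute)
      then show ?thesis using n by (simp add: sum.distrib flip: n_def)
    qed
    finally show ?thesis by (simp add: v_def)
  qed
  show thesis
  proof (rule that[OF \<delta>])
    fix y assume "norm (y - x) < \<delta>"
    then show "\<bar>g y - g x - sgrad g x \<bullet> (y - x)\<bar> \<le> \<epsilon> * norm (y - x)"
      using up[of y] subgradient[OF r, of y] \<epsilon> by simp
  qed
qed

section \<open>Differentiability almost everywhere\<close>

lemma measurable_dird [measurable]: "(\<lambda>x. dird g x v) \<in> borel_measurable borel"
  by (rule borel_measurable_LIMSEQ_real[OF dird_LIMSEQ]) measurable

lemma measurable_sgrad [measurable]: "sgrad g \<in> borel_measurable borel"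
  unfolding sgrad_def by measurable

lemma measurable_regpt [measurable]: "Measurable.pred borel (regpt g)"
  unfolding regpt_def by measurable

text \<open>At a kink the left slope is smaller than the right slope and a rational lies between
  them. Slopes of a convex function increase along the line, so different kinks receive different
  rationals.\<close>

lemma countable_nonreg_line: "countable {t. dird g (x + t *\<^sub>R v) v + dird g (x + t *\<^sub>R v) (- v) \<noteq> 0}"
proof -
  let ?S = "{t. dird g (x + t *\<^sub>R v) v + dird g (x + t *\<^sub>R v) (- v) \<noteq> 0}"
  define r where "r t = dird g (x + t *\<^sub>R v) v" for t
  define l where "l t = - dird g (x + t *\<^sub>R v) (- v)" for t
  have "\<exists>q::rat. l t < of_rat q \<and> of_rat q < r t" if "t \<in> ?S" for t
  proof -
    have "0 \<le> r t - l t"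
      using dird_subadd[of "x + t *\<^sub>R v" v "- v"] by (simp add: dird_0 r_def l_def)
    moreover have "r t - l t \<noteq> 0" using that by (simp add: r_def l_def)
    ultimately show ?thesis by (intro of_rat_dense) simp
  qed
  then obtain q :: "real \<Rightarrow> rat" where q: "\<And>t. t \<in> ?S \<Longrightarrow> l t < of_rat (q t) \<and> of_rat (q t) < r t" by metis
  have lr: "r s \<le> l t" if "s < t" for s t
  proof -
    have "r s \<le> (g ((x + s *\<^sub>R v) + (t - s) *\<^sub>R v) - g (x + s *\<^sub>R v)) / (t - s)"
      unfolding r_def using that by (intro dird_le_quotient) simp
    moreover have "- l t \<le> (g ((x + t *\<^sub>R v) + (t - s) *\<^sub>R (- v)) - g (x + t *\<^sub>R v)) / (t - s)"
      unfolding l_def minus_minus using that by (intro dird_le_quotient) simp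
    ultimately show ?thesis using that by (simp add: algebra_simps diff_divide_distrib)
  qed
  have "inj_on q ?S"
  proof (rule inj_onI)
    have ne: "q s \<noteq> q t" if "s \<in> ?S" "t \<in> ?S" "s < t" for s t
      using q[OF that(1)] q[OF that(2)] lr[OF that(3)] by force
    fix s t assume "s \<in> ?S" "t \<in> ?S" "q s = q t"
    then show "s = t" using ne[of s t] ne[of t s] by (cases s t rule: linorder_cases) auto
  qed
  then show ?thesis by (rule countable_image_inj_on[rotated]) auto
qed

text \<open>Averaging the measure of the bad set over its translates by t v, for t between 0 and 1,
  and exchanging the integrals reduces the claim to lines in direction v, where the bad set is
  countable. No coordinates adapted to v enter.\<close>

lemma AE_dird: "AE x in lborel. dird g x v + dird g x (- v) = 0"
proof -
  define N where "N = {x. dird g x v + dird g x (- v) \<noteq> 0}"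
  have N[measurable]: "N \<in> sets borel" unfolding N_def by measurable
  have "emeasure lborel N = (\<integral>\<^sup>+t. emeasure lborel N * indicator {0..1::real} t \<partial>lborel)"
    by (subst nn_integral_cmult_indicator) auto
  also have "\<dots> = (\<integral>\<^sup>+t. (\<integral>\<^sup>+x. indicator N (x + t *\<^sub>R v) * indicator {0..1} t \<partial>lborel) \<partial>lborel)"
  proof (rule nn_integral_cong)
    fix t
    have "emeasure lborel N = (\<integral>\<^sup>+x. indicator N x \<partial>distr lborel borel ((+) (t *\<^sub>R v)))"
      by (simp add: lborel_distr_plus)
    also have "\<dots> = (\<integral>\<^sup>+x. indicator N (x + t *\<^sub>R v) \<partial>lborel)"
      by (subst nn_integral_distr) (auto simp: add.commute)
    finally show "emeasure lborel N * indicator {0..1} t = (\<integral>\<^sup>+x. indicator N (x + t *\<^sub>R v) * indicator {0..1} t \<partial>lborel)"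
      by (subst nn_integral_multc) auto
  qed
  also have "\<dots> = (\<integral>\<^sup>+x. (\<integral>\<^sup>+t. indicator N (x + t *\<^sub>R v) * indicator {0..1} t \<partial>lborel) \<partial>lborel)"
    by (rule lborel_pair.Fubini') measurable
  also have "\<dots> = (\<integral>\<^sup>+(x::'a). 0 \<partial>lborel)"
  proof (rule nn_integral_cong)
    fix x :: 'a
    have "{t. x + t *\<^sub>R v \<in> N} \<in> null_sets lborel"
      using countable_nonreg_line[of x v] by (intro countable_imp_null_set_lborel) (simp add: N_def)
    then have "AE t in lborel. \<not> x + t *\<^sub>R v \<in> N" by (intro AE_I'[of "{t. x + t *\<^sub>R v \<in> N}"]) auto
    then have "(\<integral>\<^sup>+t. indicator N (x + t *\<^sub>R v) * indicator {0..1::real} t \<partial>lborel) = (\<integral>\<^sup>+t. 0 \<partial>(lborel :: real measure))"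
      by (intro nn_integral_cong_AE) (auto elim!: eventually_mono)
    then show "(\<integral>\<^sup>+t. indicator N (x + t *\<^sub>R v) * indicator {0..1::real} t \<partial>lborel) = 0" by simp
  qed
  finally have "N \<in> null_sets lborel" by (auto intro: null_setsI)
  then show ?thesis by (intro AE_I'[of N]) (auto simp: N_def)
qed

lemma AE_regpt: "AE x in lborel. regpt g x"
proof -
  have "AE x in lborel. \<forall>b\<in>Basis. dird g x b + dird g x (- b) = 0"
    by (intro AE_finite_allI AE_dird) simp
  then show ?thesis by eventually_elim (auto simp: regpt_def)
qed

section \<open>The unit body of a gauge\<close>

definition body :: "'a set" where "body = {x. g x \<le> 1}"

lemma body_subset: "body \<subseteq> cball 0 (1 / m)"
proof
  fix x assume "x \<in> body"
  then have "m * norm x \<le> 1" using lower[of x] by (simp add: body_def)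
  then show "x \<in> cball 0 (1 / m)" using m_pos by (simp add: field_simps)
qed

lemma cball_subset_body: "cball 0 (1 / M) \<subseteq> body"
proof
  fix x :: 'a assume "x \<in> cball 0 (1 / M)"
  then have "M * norm x \<le> 1" using M_pos by (simp add: field_simps)
  then show "x \<in> body" using upper[of x] by (simp add: body_def)
qed

lemma compact_body: "compact body"
proof -
  have "closed body" unfolding body_def by (intro closed_Collect_le continuous_intros continuous_on_g)
  moreover have "bounded body" using body_subset bounded_cball bounded_subset by blast
  ultimately show ?thesis by (simp add: compact_eq_bounded_closed)
qed

lemma body_borel [measurable]: "body \<in> sets borel"
  using compact_body by (simp add: borel_compact)

lemma emeasure_body_finite: "emeasure lborel body < top"
  using emeasure_bounded_finite[OF compact_imp_bounded[OF compact_body]] by simp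

lemma convex_body: "convex body"
  unfolding convex_def body_def
proof clarsimp
  fix x y and u v :: real
  assume a: "g x \<le> 1" "g y \<le> 1" "0 \<le> u" "0 \<le> v" "u + v = 1"
  have "g (u *\<^sub>R x + v *\<^sub>R y) \<le> u * g x + v * g y" using sub[of "u *\<^sub>R x" "v *\<^sub>R y"] a by (simp add: hom)
  also have "\<dots> \<le> u * 1 + v * 1" using a by (intro add_mono mult_left_mono) auto
  finally show "g (u *\<^sub>R x + v *\<^sub>R y) \<le> 1" using a by simp
qed

lemma frontier_body: "frontier body = {x. g x = 1}"
proof -
  have "interior body = {x. g x < 1}"
  proof (rule subset_antisym)
    have "open {x. g x < 1}" by (intro open_Collect_less continuous_intros continuous_on_g)
    then show "{x. g x < 1} \<subseteq> interior body" by (rule interior_maximal[rotated]) (auto simp: body_def)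
    show "interior body \<subseteq> {x. g x < 1}"
    proof
      fix x assume x: "x \<in> interior body"
      then obtain e where e: "e > 0" "ball x e \<subseteq> body" using mem_interior by blast
      show "x \<in> {x. g x < 1}"
      proof (cases "x = 0")
        case False
        define s where "s = e / (2 * norm x)"
        have s: "s > 0" using e False by (simp add: s_def)
        have "dist x ((1 + s) *\<^sub>R x) = s * norm x" using s by (simp add: dist_norm algebra_simps)
        then have "(1 + s) *\<^sub>R x \<in> ball x e" using e False by (simp add: s_def)
        then have "(1 + s) * g x \<le> 1" using e(2) s by (auto simp: body_def hom)
        moreover have "0 < s * g x" using s g_pos[OF False] by simp
        ultimately show ?thesis by (simp add: algebra_simps)
      qed simp
    qed
  qed
  moreover have "closure body = body" using compact_imp_closed[OF compact_body] by simp
  ultimately show ?thesis by (auto simp: frontier_def body_def)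
qed

lemma null_level: "{x. g x = 1} \<in> null_sets lborel"
proof -
  have "negligible (frontier body)" by (rule negligible_convex_frontier[OF convex_body])
  then have "emeasure lebesgue {x. g x = 1} = 0"
    by (simp add: negligible_iff_null_sets null_sets_def frontier_body)
  moreover have "{x. g x = 1} \<in> sets borel" by measurable
  ultimately show ?thesis by (simp add: null_sets_def)
qed

end

subsection \<open>The area formula for the unit level of a gauge\<close>

lemma emeasure_lborel_scaleR_image:
  fixes S :: "'a::euclidean_space set"
  assumes c: "0 < c" and S: "compact S"
  shows "emeasure lborel ((*\<^sub>R) c ` S) \<le> ennreal (c ^ DIM('a)) * emeasure lborel S"
proof (rule emeasure_lborel_lipschitz_image[OF c])
  show "dist (c *\<^sub>R x) (c *\<^sub>R y) \<le> c * dist x y" for x y :: 'a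
    using c by (simp add: dist_norm flip: scaleR_diff_right)
  show "(*\<^sub>R) c ` S \<in> sets borel" by (intro borel_compact compact_continuous_image S continuous_intros)
qed (use S in \<open>auto intro: borel_compact\<close>)

text \<open>Inner regularity reduces a comparison of measures to compact sets, whose cones and
  continuous images are again compact and hence measurable.\<close>

lemma emeasure_le_of_compact:
  fixes \<mu> :: "'a::euclidean_space measure"
  assumes \<mu>: "sets \<mu> = sets borel" "finite_measure \<mu>" and A: "A \<in> sets borel"
    and le: "\<And>C. compact C \<Longrightarrow> C \<subseteq> A \<Longrightarrow> emeasure \<mu> C \<le> c"
  shows "emeasure \<mu> A \<le> c"
proof -
  have "emeasure \<mu> (space \<mu>) \<noteq> \<infinity>" using \<mu>(2) by (simp add: finite_measure.emeasure_finite)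
  then show ?thesis
    using inner_regular[OF \<mu>(1) _ A] le by (auto intro!: SUP_least)
qed

lemma emeasure_le_countable_cover:
  assumes sets: "sets \<mu> = sets \<nu>" and I: "countable I" and P: "\<And>i. i \<in> I \<Longrightarrow> P i \<in> sets \<nu>"
    and le: "\<And>i A. i \<in> I \<Longrightarrow> A \<in> sets \<nu> \<Longrightarrow> A \<subseteq> P i \<Longrightarrow> emeasure \<mu> A \<le> c * emeasure \<nu> A"
    and A: "A \<in> sets \<nu>" "A \<subseteq> (\<Union>i\<in>I. P i)"
  shows "emeasure \<mu> A \<le> c * emeasure \<nu> A"
proof (cases "I = {}")
  case True then show ?thesis using A by simp
next
  case False
  define Q where "Q n = P (from_nat_into I n)" for n
  define D where "D n = A \<inter> disjointed Q n" for n
  have iI: "from_nat_into I n \<in> I" for n using False by (simp add: from_nat_into)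
  have Q: "Q n \<in> sets \<nu>" for n using P iI by (simp add: Q_def)
  have D: "D n \<in> sets \<nu>" for n
    unfolding D_def using A Q sets.range_disjointed_sets[of Q \<nu>] by (intro sets.Int) auto
  have AD: "A = (\<Union>n. D n)"
  proof -
    have "(\<Union>i\<in>I. P i) = (\<Union>n. Q n)"
    proof -
      have "(\<Union>n. Q n) = (\<Union>i\<in>range (from_nat_into I). P i)" by (simp add: Q_def)
      also have "range (from_nat_into I) = I" using False I by (rule range_from_nat_into)
      finally show ?thesis by (rule sym)
    qed
    then have "A \<subseteq> (\<Union>n. disjointed Q n)" using A by (simp add: UN_disjointed_eq)
    then show ?thesis by (auto simp: D_def)
  qed
  have disj: "disjoint_family D"
    unfolding D_def disjoint_family_on_def
  proof (intro ballI impI)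
    fix i j :: nat assume "i \<noteq> j"
    then have "disjointed Q i \<inter> disjointed Q j = {}"
      using disjoint_family_disjointed[of Q] by (simp add: disjoint_family_on_def)
    then show "A \<inter> disjointed Q i \<inter> (A \<inter> disjointed Q j) = {}" by auto
  qed
  have Dm: "range D \<subseteq> sets \<mu>" "range D \<subseteq> sets \<nu>" using D sets by auto
  have "emeasure \<mu> A = (\<Sum>n. emeasure \<mu> (D n))" unfolding AD by (rule suminf_emeasure[OF Dm(1) disj, symmetric])
  also have "\<dots> \<le> (\<Sum>n. c * emeasure \<nu> (D n))"
  proof (intro suminf_le summableI)
    fix n show "emeasure \<mu> (D n) \<le> c * emeasure \<nu> (D n)"
      by (rule le[OF iI D]) (use disjointed_subset[of Q n] in \<open>auto simp: D_def Q_def\<close>)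
  qed
  also have "\<dots> = c * emeasure \<nu> A"
    unfolding AD using suminf_emeasure[OF Dm(2) disj] by simp
  finally show ?thesis .
qed

lemma ennreal_le_all_factors:
  fixes x y :: ennreal
  assumes "\<And>c. 1 < c \<Longrightarrow> x \<le> ennreal c * y" "y < top"
  shows "x \<le> y"
proof (cases y)
  case (real r)
  have "(\<lambda>n. ennreal ((1 + 1 / real (Suc n)) * r)) \<longlonglongrightarrow> ennreal ((1 + 0) * r)"
    by (intro tendsto_ennrealI tendsto_intros LIMSEQ_Suc lim_1_over_n)
  moreover have "x \<le> ennreal ((1 + 1 / real (Suc n)) * r)" for n
    using assms(1)[of "1 + 1 / real (Suc n)"] real by (simp add: ennreal_mult)
  ultimately have "x \<le> ennreal ((1 + 0) * r)" by (intro LIMSEQ_le_const) auto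
  then show ?thesis using real by simp
qed (use assms in auto)

locale gauge_area = sublinear_gauge g m M for g :: "'a::euclidean_space \<Rightarrow> real" and m M +
  fixes \<kappa> :: real
  assumes dim: "DIM('a) \<ge> 2" and \<kappa>_pos: "0 < \<kappa>"
    and \<kappa>: "\<And>(e::'a) E. norm e = 1 \<Longrightarrow> E \<in> sets borel \<Longrightarrow>
       emeasure (hplane_product e) E = ennreal \<kappa> * emeasure lborel E"
begin

abbreviation "H \<equiv> hausdorff_measure (DIM('a) - 1) :: 'a set \<Rightarrow> ennreal"

lemma k_ge_1: "(DIM('a) - 1) \<ge> 1" using dim by simp

lemma n_pos: "0 < real DIM('a)" using dim by simp

section \<open>The cone measure on the level set\<close>

definition cone_density :: "'a measure" where
  "cone_density = density lborel (\<lambda>z. ennreal (\<kappa> * DIM('a) * norm (sgrad g z)) * indicator {z. 0 < g z \<and> g z \<le> 1} z)"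

text \<open>The candidate for the area of the level set: the mass \<kappa> n |grad g| dz on the
  body, pushed radially outward. For a piece lying in the hyperplane p . y = 1 with gradient p it is
  the value given by \<open>hausdorff_measure_flat_cone\<close>.\<close>

definition cone_area :: "'a measure" where
  "cone_area = distr cone_density borel (\<lambda>z. z /\<^sub>R g z)"

lemma sets_cone_area [simp, measurable_cong]: "sets cone_area = sets borel"
  by (simp add: cone_area_def)

lemma sets_cone_density [simp, measurable_cong]: "sets cone_density = sets borel"
  by (simp add: cone_density_def)

lemma emeasure_cone_area:
  assumes [measurable]: "A \<in> sets borel"
  shows "emeasure cone_area A =
    (\<integral>\<^sup>+z. ennreal (\<kappa> * DIM('a) * norm (sgrad g z)) * indicator {z. 0 < g z \<and> g z \<le> 1 \<and> z /\<^sub>R g z \<in> A} z \<partial>lborel)"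
proof -
  have vm [measurable]: "(\<lambda>z. z /\<^sub>R g z) -` A \<in> sets borel"
    by (rule measurable_sets_borel[OF _ assms]) measurable
  have "emeasure cone_area A = emeasure cone_density ((\<lambda>z. z /\<^sub>R g z) -` A)"
    unfolding cone_area_def by (subst emeasure_distr) (auto simp: cone_density_def)
  also have "\<dots> = (\<integral>\<^sup>+z. (ennreal (\<kappa> * DIM('a) * norm (sgrad g z)) * indicator {z. 0 < g z \<and> g z \<le> 1} z)
      * indicator ((\<lambda>z. z /\<^sub>R g z) -` A) z \<partial>lborel)"
    unfolding cone_density_def
    by (rule emeasure_density) (use vm in measurable)
  also have "\<dots> = (\<integral>\<^sup>+z. ennreal (\<kappa> * DIM('a) * norm (sgrad g z)) * indicator {z. 0 < g z \<and> g z \<le> 1 \<and> z /\<^sub>R g z \<in> A} z \<partial>lborel)"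
    by (intro nn_integral_cong) (auto split: split_indicator)
  finally show ?thesis .
qed

lemma finite_cone_area: "finite_measure cone_area"
proof
  have "emeasure cone_area (space cone_area) = emeasure cone_area UNIV"
    by (simp add: cone_area_def)
  also have "\<dots> \<le> (\<integral>\<^sup>+z. ennreal (\<kappa> * DIM('a) * M) * indicator body z \<partial>lborel)"
    unfolding emeasure_cone_area[OF borel_open[OF open_UNIV]]
  proof (rule nn_integral_mono_AE)
    show "AE z in lborel. ennreal (\<kappa> * DIM('a) * norm (sgrad g z)) * indicator {z. 0 < g z \<and> g z \<le> 1 \<and> z /\<^sub>R g z \<in> UNIV} z
        \<le> ennreal (\<kappa> * DIM('a) * M) * indicator body z"
      using AE_regpt
    proof eventually_elim
      case (elim z)
      then show ?case using norm_sgrad_le[OF elim] \<kappa>_pos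
        by (auto simp: body_def split: split_indicator intro!: ennreal_leI mult_left_mono)
    qed
  qed
  also have "\<dots> = ennreal (\<kappa> * DIM('a) * M) * emeasure lborel body"
    using compact_body by (intro nn_integral_cmult_indicator) (auto intro: borel_compact)
  also have "\<dots> < top" using emeasure_body_finite by (simp add: ennreal_mult_less_top)
  finally show "emeasure cone_area (space cone_area) \<noteq> \<infinity>" by simp
qed

lemma compact_level: "compact {x. g x = 1}"
proof -
  have "compact (frontier body)" using compact_body by (rule compact_frontier)
  then show ?thesis by (simp add: frontier_body)
qed

lemma cone01_level:
  assumes A: "A \<subseteq> {x. g x = 1}"
  shows "z \<in> cone01 A \<and> z \<noteq> 0 \<longleftrightarrow> 0 < g z \<and> g z \<le> 1 \<and> z /\<^sub>R g z \<in> A"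
proof
  assume z: "z \<in> cone01 A \<and> z \<noteq> 0"
  then obtain t x where t: "0 \<le> t" "t \<le> 1" "x \<in> A" "z = t *\<^sub>R x" by (auto simp: cone01_def)
  have "t \<noteq> 0" using z t by auto
  moreover have gz: "g z = t" using t A by (auto simp: hom)
  ultimately show "0 < g z \<and> g z \<le> 1 \<and> z /\<^sub>R g z \<in> A" using t by auto
next
  assume z: "0 < g z \<and> g z \<le> 1 \<and> z /\<^sub>R g z \<in> A"
  then have "z \<in> cone01 A"
    by (auto simp: cone01_def intro!: image_eqI[of _ _ "(g z, z /\<^sub>R g z)"])
  moreover have "z \<noteq> 0" using z by auto
  ultimately show "z \<in> cone01 A \<and> z \<noteq> 0" by blast
qed

lemma cone01_subset_body: "A \<subseteq> {x. g x = 1} \<Longrightarrow> cone01 A \<subseteq> body"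
  using cone01_level[of A] by (force simp: body_def)

lemma cone_area_compact_le:
  assumes A: "compact A" "A \<subseteq> {x. g x = 1}" and c: "\<And>x. x \<in> A \<Longrightarrow> norm (sgrad g x) \<le> c"
  shows "emeasure cone_area A \<le> ennreal (\<kappa> * DIM('a) * c) * emeasure lborel (cone01 A)"
proof -
  have Ab: "A \<in> sets borel" using A by (simp add: borel_compact)
  have Cb: "cone01 A \<in> sets borel" using compact_cone01[OF A(1)] by (simp add: borel_compact)
  have "emeasure cone_area A \<le> (\<integral>\<^sup>+z. ennreal (\<kappa> * DIM('a) * c) * indicator (cone01 A) z \<partial>lborel)"
    unfolding emeasure_cone_area[OF Ab]
  proof (rule nn_integral_mono)
    fix z :: 'a
    have "sgrad g (z /\<^sub>R g z) = sgrad g z" if "0 < g z" using that by (simp add: sgrad_cone)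
    then show "ennreal (\<kappa> * DIM('a) * norm (sgrad g z)) * indicator {z. 0 < g z \<and> g z \<le> 1 \<and> z /\<^sub>R g z \<in> A} z
        \<le> ennreal (\<kappa> * DIM('a) * c) * indicator (cone01 A) z"
      using c[of "z /\<^sub>R g z"] cone01_level[OF A(2), of z] \<kappa>_pos
      by (auto split: split_indicator intro!: ennreal_leI mult_left_mono)
  qed
  then show ?thesis using Cb by (simp add: nn_integral_cmult_indicator)
qed

lemma cone_area_compact_ge:
  assumes A: "compact A" "A \<subseteq> {x. g x = 1}" and c: "\<And>x. x \<in> A \<Longrightarrow> c \<le> norm (sgrad g x)"
  shows "ennreal (\<kappa> * DIM('a) * c) * emeasure lborel (cone01 A) \<le> emeasure cone_area A"
proof -
  have Ab: "A \<in> sets borel" using A by (simp add: borel_compact)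
  have Cb: "cone01 A \<in> sets borel" using compact_cone01[OF A(1)] by (simp add: borel_compact)
  have "(\<integral>\<^sup>+z. ennreal (\<kappa> * DIM('a) * c) * indicator (cone01 A) z \<partial>lborel) \<le> emeasure cone_area A"
    unfolding emeasure_cone_area[OF Ab]
  proof (rule nn_integral_mono_AE)
    have "AE z::'a in lborel. z \<noteq> 0" by (rule AE_lborel_singleton)
    then show "AE z in lborel. ennreal (\<kappa> * DIM('a) * c) * indicator (cone01 A) z
        \<le> ennreal (\<kappa> * DIM('a) * norm (sgrad g z)) * indicator {z. 0 < g z \<and> g z \<le> 1 \<and> z /\<^sub>R g z \<in> A} z"
    proof eventually_elim
      case (elim z)
      have "sgrad g (z /\<^sub>R g z) = sgrad g z" if "0 < g z" using that by (simp add: sgrad_cone)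
      then show ?case
        using c[of "z /\<^sub>R g z"] cone01_level[OF A(2), of z] \<kappa>_pos elim
        by (auto split: split_indicator intro!: ennreal_leI mult_left_mono)
    qed
  qed
  then show ?thesis using Cb by (simp add: nn_integral_cmult_indicator)
qed

text \<open>A crude bound that uses no differentiability. On the sector where p . x is at least
  |x|/n, with p a basis vector or its negative, radial projection to the hyperplane p . y = 1 has
  the Lipschitz inverse y / g y, and flat pieces are already known. The bound makes the level area
  finite and absolutely continuous with respect to cone volume.\<close>

lemma hausdorff_compact_le_cone:
  obtains C :: real where "0 \<le> C"
    "\<And>A. compact A \<Longrightarrow> A \<subseteq> {x. g x = 1} \<Longrightarrow> H A \<le> ennreal C * emeasure lborel (cone01 A)"
proof -
  \<comment> \<open>1/m comes from the factor 1 / g y, and n M / m^2 from the variation of 1/g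
    multiplied by |z|, with |z| \<le> n on the projected sector.\<close>
  define L where "L = 1 / m + DIM('a) * (M / (m * m))"
  have L: "0 < L" unfolding L_def using m_pos M_pos by (intro add_pos_nonneg) auto
  define W where "W = (Basis \<union> uminus ` Basis :: 'a set)"
  have fW: "finite W" by (simp add: W_def)
  have nW: "norm p = 1" if "p \<in> W" for p using that by (auto simp: W_def)
  define C1 where "C1 = L ^ (DIM('a) - 1) * (\<kappa> * DIM('a) * (DIM('a) * M) ^ DIM('a))"
  have C1: "0 \<le> C1" using L \<kappa>_pos M_pos by (simp add: C1_def)
  have piece: "H {x \<in> A. norm x \<le> DIM('a) * (p \<bullet> x)} \<le> ennreal C1 * emeasure lborel (cone01 A)"
    if A: "compact A" "A \<subseteq> {x. g x = 1}" and p: "p \<in> W" for A p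
  proof -
    define Ap where "Ap = {x \<in> A. norm x \<le> DIM('a) * (p \<bullet> x)}"
    define B where "B = (\<lambda>x. x /\<^sub>R (p \<bullet> x)) ` Ap"
    have np: "norm p = 1" by (rule nW[OF p])
    have ApA: "Ap \<subseteq> A" by (auto simp: Ap_def)
    have "closed {x. norm x \<le> DIM('a) * (p \<bullet> x)}" by (intro closed_Collect_le continuous_intros)
    from compact_Int_closed[OF A(1) this] have cAp: "compact Ap"
      by (simp add: Ap_def Collect_conj_eq)
    have px: "0 < p \<bullet> x" if "x \<in> Ap" for x
    proof -
      have "x \<noteq> 0" using that A(2) ApA by auto
      then have "0 < norm x" by simp
      also have "norm x \<le> DIM('a) * (p \<bullet> x)" using that by (simp add: Ap_def)
      finally show ?thesis using n_pos by (simp add: zero_less_mult_iff)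
    qed
    have cB: "compact B" unfolding B_def
      by (intro compact_continuous_image cAp continuous_intros) (use px in force)
    have B1: "B \<subseteq> {y. p \<bullet> y = 1}" using px by (force simp: B_def)
    have Bn: "1 \<le> norm y \<and> norm y \<le> DIM('a)" if yB: "y \<in> B" for y
    proof
      show "1 \<le> norm y" using B1 yB norm_cauchy_schwarz[of p y] np by auto
      obtain x where x: "x \<in> Ap" "y = x /\<^sub>R (p \<bullet> x)" using yB unfolding B_def by blast
      then show "norm y \<le> DIM('a)"
        using px[OF x(1)] by (simp add: Ap_def inverse_eq_divide pos_divide_le_eq)
    qed
    have gB: "m \<le> g y" if "y \<in> B" for y
    proof -
      have "m * 1 \<le> m * norm y" using Bn[OF that] m_pos by (intro mult_left_mono) auto
      then show ?thesis using lower[of y] by simp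
    qed
    define f where "f y = y /\<^sub>R g y" for y
    have fB: "f ` B = Ap"
    proof -
      have "f (x /\<^sub>R (p \<bullet> x)) = x" if "x \<in> Ap" for x
        using px[OF that] that A by (auto simp: f_def hom Ap_def)
      then show ?thesis by (auto simp: B_def image_image)
    qed
    have "H Ap \<le> ennreal (L ^ (DIM('a) - 1)) * H B"
      unfolding fB[symmetric]
    proof (rule hausdorff_measure_lipschitz_image[OF k_ge_1 L])
      fix y z assume yz: "y \<in> B" "z \<in> B"
      have gy: "m \<le> g y" and gz: "m \<le> g z" using gB yz by auto
      have "f y - f z = (1 / g y) *\<^sub>R (y - z) + (1 / g y - 1 / g z) *\<^sub>R z"
        by (simp add: f_def algebra_simps inverse_eq_divide)
      then have "norm (f y - f z) \<le> norm ((1 / g y) *\<^sub>R (y - z)) + norm ((1 / g y - 1 / g z) *\<^sub>R z)"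
        by (metis norm_triangle_ineq)
      also have "norm ((1 / g y) *\<^sub>R (y - z)) \<le> 1 / m * norm (y - z)"
      proof -
        have "1 / g y \<le> 1 / m" using gy m_pos by (intro divide_left_mono) auto
        moreover have "norm ((1 / g y) *\<^sub>R (y - z)) = 1 / g y * norm (y - z)" using gy m_pos by simp
        ultimately show ?thesis by (metis mult_right_mono norm_ge_zero)
      qed
      also have "norm ((1 / g y - 1 / g z) *\<^sub>R z) \<le> (M * norm (y - z) / (m * m)) * DIM('a)"
      proof -
        have "\<bar>1 / g y - 1 / g z\<bar> = \<bar>g z - g y\<bar> / (g y * g z)"
          using gy gz m_pos by (simp add: divide_simps abs_mult)
        also have "\<dots> \<le> (M * norm (y - z)) / (m * m)"
          using g_lipschitz[of z y] gy gz m_pos by (intro frac_le mult_mono) (auto simp: norm_minus_commute)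
        finally have le: "\<bar>1 / g y - 1 / g z\<bar> \<le> M * norm (y - z) / (m * m)" .
        have "norm ((1 / g y - 1 / g z) *\<^sub>R z) = \<bar>1 / g y - 1 / g z\<bar> * norm z" by simp
        also have "\<dots> \<le> (M * norm (y - z) / (m * m)) * DIM('a)"
          using le Bn[OF yz(2)] m_pos M_pos by (intro mult_mono) auto
        finally show ?thesis .
      qed
      also have "1 / m * norm (y - z) + (M * norm (y - z) / (m * m)) * DIM('a) = L * norm (y - z)"
        by (simp add: L_def algebra_simps)
      finally show "dist (f y) (f z) \<le> L * dist y z" by (simp add: dist_norm)
    qed
    also have "H B = ennreal (\<kappa> * DIM('a) * norm p) * emeasure lborel (cone01 B)"
      using hausdorff_measure_flat_cone[OF dim \<kappa>_pos \<kappa> cB B1] np by fastforce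
    also have "emeasure lborel (cone01 B) \<le> emeasure lborel ((*\<^sub>R) (DIM('a) * M) ` cone01 A)"
    proof (rule emeasure_mono)
      \<comment> \<open>On the sector 1 = g x is at most n M (p . x), so the radial projection
        stretches by at most n M.\<close>
      show "cone01 B \<subseteq> (*\<^sub>R) (DIM('a) * M) ` cone01 A"
      proof
        fix z assume "z \<in> cone01 B"
        then obtain t x where t: "0 \<le> t" "t \<le> 1" and x: "x \<in> Ap" and z: "z = t *\<^sub>R (x /\<^sub>R (p \<bullet> x))"
          by (auto simp: cone01_def B_def)
        have "1 \<le> M * norm x" using upper[of x] x A by (auto simp: Ap_def)
        also have "\<dots> \<le> M * (DIM('a) * (p \<bullet> x))" using x M_pos by (intro mult_left_mono) (auto simp: Ap_def)
        finally have 1: "1 \<le> DIM('a) * M * (p \<bullet> x)" by (simp add: mult_ac)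
        define s where "s = t / (DIM('a) * M * (p \<bullet> x))"
        have "0 \<le> s" "s \<le> 1" using t 1 by (auto simp: s_def divide_simps)
        moreover have "z = (DIM('a) * M) *\<^sub>R (s *\<^sub>R x)"
          using n_pos M_pos by (simp add: z s_def divide_inverse mult_ac)
        ultimately show "z \<in> (*\<^sub>R) (DIM('a) * M) ` cone01 A"
          using x ApA by (auto simp: cone01_def intro!: image_eqI[of _ _ "s *\<^sub>R x"] image_eqI[of _ _ "(s, x)"])
      qed
      show "(*\<^sub>R) (DIM('a) * M) ` cone01 A \<in> sets lborel"
        using compact_cone01[OF A(1)] by (auto intro!: borel_compact compact_continuous_image continuous_intros)
    qed
    also have "emeasure lborel ((*\<^sub>R) (DIM('a) * M) ` cone01 A) \<le> ennreal ((DIM('a) * M) ^ DIM('a)) * emeasure lborel (cone01 A)"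
      using n_pos M_pos compact_cone01[OF A(1)] by (intro emeasure_lborel_scaleR_image) auto
    finally have "H Ap \<le> ennreal (L ^ (DIM('a) - 1)) * (ennreal (\<kappa> * DIM('a) * norm p) * (ennreal ((DIM('a) * M) ^ DIM('a)) * emeasure lborel (cone01 A)))"
      by (simp add: mult_left_mono)
    also have "\<dots> = ennreal C1 * emeasure lborel (cone01 A)"
      using L \<kappa>_pos M_pos np by (simp add: C1_def ennreal_mult mult.assoc)
    finally show ?thesis by (simp add: Ap_def)
  qed
  show thesis
  proof (rule that)
    show "0 \<le> card W * C1" using C1 by simp
    fix A :: "'a set" assume A: "compact A" "A \<subseteq> {x. g x = 1}"
    have "A \<subseteq> (\<Union>p\<in>W. {x \<in> A. norm x \<le> DIM('a) * (p \<bullet> x)})"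
    proof
      fix x assume x: "x \<in> A"
      have "\<exists>b\<in>Basis. norm x \<le> DIM('a) * \<bar>x \<bullet> b\<bar>"
      proof (rule ccontr)
        assume "\<not> ?thesis"
        then have "(\<Sum>b\<in>Basis. \<bar>x \<bullet> b\<bar>) < (\<Sum>b\<in>(Basis::'a set). norm x / DIM('a))"
          using n_pos by (intro sum_strict_mono) (auto simp: field_simps not_le)
        then show False using norm_le_l1[of x] n_pos by simp
      qed
      then obtain b where b: "b \<in> Basis" "norm x \<le> DIM('a) * \<bar>x \<bullet> b\<bar>" by blast
      define p where "p = (if x \<bullet> b \<ge> 0 then b else - b)"
      have "p \<in> W" "norm x \<le> DIM('a) * (p \<bullet> x)" using b by (auto simp: p_def W_def inner_commute)
      then show "x \<in> (\<Union>p\<in>W. {x \<in> A. norm x \<le> DIM('a) * (p \<bullet> x)})" using x by blast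
    qed
    then have "H A \<le> H (\<Union>p\<in>W. {x \<in> A. norm x \<le> DIM('a) * (p \<bullet> x)})" by (rule hausdorff_measure_mono)
    also have "\<dots> \<le> (\<Sum>p\<in>W. H {x \<in> A. norm x \<le> DIM('a) * (p \<bullet> x)})"
      by (rule hausdorff_measure_finite_UN_le[OF k_ge_1 fW])
    also have "\<dots> \<le> (\<Sum>p\<in>W. ennreal C1 * emeasure lborel (cone01 A))" by (intro sum_mono piece A)
    also have "\<dots> = ennreal (card W * C1) * emeasure lborel (cone01 A)"
      using C1 by (simp add: ennreal_mult ennreal_of_nat_eq_real_of_nat mult.assoc)
    finally show "H A \<le> ennreal (card W * C1) * emeasure lborel (cone01 A)" .
  qed
qed

section \<open>Comparison of Hausdorff measure and cone measure\<close>

definition level_area :: "'a measure" where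
  "level_area = density (hausdorff_borel (DIM('a) - 1)) (indicator {x. g x = 1})"

lemma sets_level_area [simp, measurable_cong]: "sets level_area = sets borel"
  by (simp add: level_area_def)

lemma emeasure_level_area:
  assumes A: "A \<in> sets borel" shows "emeasure level_area A = H (A \<inter> {x. g x = 1})"
proof -
  have [measurable]: "{x. g x = 1} \<in> sets borel" using compact_level by (simp add: borel_compact)
  have "emeasure level_area A = emeasure (hausdorff_borel (DIM('a) - 1)) ({x. g x = 1} \<inter> A)"
    unfolding level_area_def by (rule emeasure_restricted) (auto simp: A)
  also have "\<dots> = H ({x. g x = 1} \<inter> A)"
    by (rule emeasure_hausdorff_borel[OF k_ge_1]) (use A in measurable)
  finally show ?thesis by (simp only: Int_commute)
qed

lemma finite_level_area: "finite_measure level_area"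
proof
  obtain C where C: "0 \<le> C" "\<And>A. compact A \<Longrightarrow> A \<subseteq> {x. g x = 1} \<Longrightarrow> H A \<le> ennreal C * emeasure lborel (cone01 A)"
    using hausdorff_compact_le_cone by blast
  have "space level_area = UNIV" by (simp add: level_area_def)
  then have "emeasure level_area (space level_area) = H {x. g x = 1}"
    using emeasure_level_area[OF borel_open[OF open_UNIV]] by simp
  also have "\<dots> \<le> ennreal C * emeasure lborel (cone01 {x. g x = 1})"
    by (rule C(2)[OF compact_level]) simp
  also have "\<dots> \<le> ennreal C * emeasure lborel body"
    using cone01_subset_body[of "{x. g x = 1}"] compact_body by (intro mult_left_mono emeasure_mono) (auto intro: borel_compact)
  also have "\<dots> < top" using emeasure_body_finite by (simp add: ennreal_mult_less_top)
  finally show "emeasure level_area (space level_area) \<noteq> \<infinity>" by simp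
qed

text \<open>Regularity is constant along rays, so the cone over a compact set of singular points
  consists of singular points and is a Lebesgue null set; the crude bound transfers this to the
  area.\<close>

lemma hausdorff_singular_null: "H {x. g x = 1 \<and> \<not> regpt g x} = 0"
proof -
  obtain C where C: "0 \<le> C" "\<And>A. compact A \<Longrightarrow> A \<subseteq> {x. g x = 1} \<Longrightarrow> H A \<le> ennreal C * emeasure lborel (cone01 A)"
    using hausdorff_compact_le_cone by blast
  let ?N = "{x. g x = 1 \<and> \<not> regpt g x}"
  have N: "?N \<in> sets borel" by measurable
  have "emeasure level_area ?N \<le> 0"
  proof (rule emeasure_le_of_compact[OF sets_level_area finite_level_area N])
    fix A assume A: "compact A" "A \<subseteq> ?N"
    have A1: "A \<subseteq> {x. g x = 1}" using A by auto
    have "emeasure lborel (cone01 A) = 0"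
    proof -
      have "\<not> regpt g z" if "z \<in> cone01 A" for z
      proof (cases "z = 0")
        case False
        then have "0 < g z" "z /\<^sub>R g z \<in> A" using cone01_level[OF A1, of z] that by auto
        then show ?thesis using A(2) regpt_cone[of "inverse (g z)" z] by auto
      qed (simp add: not_regpt_0)
      then have "AE z in lborel. z \<notin> cone01 A" using AE_regpt by (auto elim: eventually_mono)
      then show ?thesis
        using compact_cone01[OF A(1)] by (subst (asm) AE_iff_null_sets[symmetric]) (auto intro: borel_compact)
    qed
    moreover have "emeasure level_area A = H A"
      using emeasure_level_area[of A] A A1 by (simp add: borel_compact Int_absorb2)
    ultimately show "emeasure level_area A \<le> 0" using C(2)[OF A(1) A1] by simp
  qed
  then have "H (?N \<inter> {x. g x = 1}) = 0" using emeasure_level_area[OF N] by simp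
  moreover have "?N \<inter> {x. g x = 1} = ?N" by auto
  ultimately show ?thesis by simp
qed

text \<open>
  On a set where the gradient is nearly \<open>p\<close>, the shear that replaces \<open>p \<bullet> z\<close> by \<open>g z\<close> is nearly an
  isometry, and it flattens the level set \<open>g = 1\<close> into the hyperplane \<open>p \<bullet> y = 1\<close>.
\<close>

lemma area_nearly_flat:
  assumes A: "compact A" "A \<subseteq> {x. g x = 1}" and p: "p \<noteq> 0"
    and \<epsilon>: "0 \<le> \<epsilon>" "\<epsilon> \<le> m / 2" and \<eta>: "\<epsilon> * ((2 * M / m + 1) * (2 / m)) \<le> \<eta>" "\<eta> < 1"
    and reg: "\<And>x. x \<in> A \<Longrightarrow> regpt g x \<and> norm (sgrad g x - p) \<le> \<epsilon>"
    and flat: "\<And>x y. x \<in> A \<Longrightarrow> y \<in> A \<Longrightarrow> \<bar>p \<bullet> (x - y)\<bar> \<le> \<epsilon> * norm (x - y)"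
  shows "H A \<le> ennreal ((1 / (1 - \<eta>)) ^ (2 * DIM('a))) * emeasure cone_area A"
    and "emeasure cone_area A \<le> ennreal ((1 / (1 - \<eta>)) ^ (2 * DIM('a))) * H A"
proof -
  define \<Lambda> where "\<Lambda> = 1 / (1 - \<eta>)"
  have "0 \<le> \<epsilon> * ((2 * M / m + 1) * (2 / m))" using \<epsilon> m_pos M_pos by simp
  then have \<eta>0: "0 \<le> \<eta>" using \<eta> by linarith
  have \<Lambda>: "1 \<le> \<Lambda>" "0 < \<Lambda>" using \<eta> \<eta>0 by (auto simp: \<Lambda>_def field_simps)
  have \<Lambda>1: "1 + \<eta> \<le> \<Lambda>"
  proof -
    have "(1 + \<eta>) * (1 - \<eta>) \<le> 1" by (simp add: algebra_simps)
    then show ?thesis using \<eta> by (simp add: \<Lambda>_def pos_le_divide_eq)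
  qed
  define T where "T z = z + ((g z - p \<bullet> z) / (p \<bullet> p)) *\<^sub>R p" for z
  have near: "norm (T z - T w - (z - w)) \<le> \<eta> * norm (z - w)" if z: "z \<in> cone01 A" and w: "w \<in> cone01 A" for z w
  proof -
    obtain t x where t: "0 \<le> t" "t \<le> 1" "x \<in> A" "z = t *\<^sub>R x" using z by (auto simp: cone01_def)
    obtain s y where s: "0 \<le> s" "s \<le> 1" "y \<in> A" "w = s *\<^sub>R y" using w by (auto simp: cone01_def)
    have gx: "g x = 1" "g y = 1" using t s A by auto
    have ny: "norm y \<le> 1 / m" using lower[of y] gx m_pos by (simp add: field_simps)
    have gz: "g z = t" "g w = s" using t s gx by (auto simp: hom)
    have ts: "\<bar>t - s\<bar> \<le> M * norm (z - w)" using g_lipschitz[of z w] gz by simp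
    have p1: "\<bar>1 - p \<bullet> y\<bar> \<le> \<epsilon> / m"
    proof -
      have "1 - p \<bullet> y = (sgrad g y - p) \<bullet> y"
        using sgrad_inner_self[of y] reg[OF s(3)] gx by (simp add: inner_diff_left)
      also have "\<bar>\<dots>\<bar> \<le> norm (sgrad g y - p) * norm y" by (rule Cauchy_Schwarz_ineq2)
      also have "\<dots> \<le> \<epsilon> * (1 / m)" using reg[OF s(3)] ny \<epsilon> by (intro mult_mono) auto
      finally show ?thesis by simp
    qed
    have txy: "t * norm (x - y) \<le> (1 + M / m) * norm (z - w)"
    proof -
      have "t *\<^sub>R (x - y) = (z - w) - (t - s) *\<^sub>R y" by (simp add: t s algebra_simps)
      then have "t * norm (x - y) = norm ((z - w) - (t - s) *\<^sub>R y)" using t by (metis abs_of_nonneg norm_scaleR)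
      also have "\<dots> \<le> norm (z - w) + \<bar>t - s\<bar> * norm y" using norm_triangle_ineq4[of "z - w" "(t - s) *\<^sub>R y"] by simp
      also have "\<bar>t - s\<bar> * norm y \<le> (M * norm (z - w)) * (1 / m)" using ts ny by (intro mult_mono) auto
      finally show ?thesis by (simp add: algebra_simps)
    qed
    \<comment> \<open>Along the rays z = t x and w = s y the difference splits into a radial part,
      small because p . y is close to the product of y with its gradient, which is 1, and a part
      along the level set, small by \<open>flat\<close>.\<close>
    have "(g z - p \<bullet> z) - (g w - p \<bullet> w) = (t - s) * (1 - p \<bullet> y) - t * (p \<bullet> (x - y))"
      by (simp add: gz t(4) s(4) inner_diff_right algebra_simps) (simp add: \<open>z = _\<close>[symmetric] \<open>w = _\<close>[symmetric] gz)
    then have "\<bar>(g z - p \<bullet> z) - (g w - p \<bullet> w)\<bar> \<le> \<bar>t - s\<bar> * \<bar>1 - p \<bullet> y\<bar> + t * \<bar>p \<bullet> (x - y)\<bar>"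
      using t(1) by (simp add: abs_mult order_trans[OF abs_triangle_ineq4])
    also have "\<dots> \<le> (M * norm (z - w)) * (\<epsilon> / m) + t * (\<epsilon> * norm (x - y))"
      using ts p1 flat[OF t(3) s(3)] t(1) \<epsilon> m_pos M_pos by (intro add_mono mult_mono) auto
    also have "t * (\<epsilon> * norm (x - y)) \<le> \<epsilon> * ((1 + M / m) * norm (z - w))"
      using mult_left_mono[OF txy \<epsilon>(1)] by (simp add: mult_ac)
    finally have 1: "\<bar>(g z - p \<bullet> z) - (g w - p \<bullet> w)\<bar> \<le> \<epsilon> * (2 * M / m + 1) * norm (z - w)"
      by (simp add: algebra_simps)
    have np: "m / 2 \<le> norm p"
      using norm_sgrad_ge[of y] reg[OF s(3)] \<epsilon> norm_triangle_ineq2[of "sgrad g y" p] by linarith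
    have "T z - T w - (z - w) = ((g z - p \<bullet> z) / (p \<bullet> p) - (g w - p \<bullet> w) / (p \<bullet> p)) *\<^sub>R p"
      unfolding T_def scaleR_diff_left by simp
    then have "T z - T w - (z - w) = (((g z - p \<bullet> z) - (g w - p \<bullet> w)) / (p \<bullet> p)) *\<^sub>R p"
      by (simp only: diff_divide_distrib)
    then have "norm (T z - T w - (z - w)) = \<bar>(g z - p \<bullet> z) - (g w - p \<bullet> w)\<bar> / norm p"
      using p by (simp add: power2_norm_eq_inner[symmetric] power2_eq_square)
    also have "\<dots> \<le> (\<epsilon> * (2 * M / m + 1) * norm (z - w)) / (m / 2)"
      using 1 np m_pos by (intro frac_le) auto
    also have "\<dots> = \<epsilon> * ((2 * M / m + 1) * (2 / m)) * norm (z - w)" using m_pos by (simp add: field_simps)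
    also have "\<dots> \<le> \<eta> * norm (z - w)" using \<eta>(1) by (intro mult_right_mono) auto
    finally show ?thesis .
  qed
  have lip1: "dist (T z) (T w) \<le> \<Lambda> * dist z w" if "z \<in> cone01 A" "w \<in> cone01 A" for z w
  proof -
    have "norm (T z - T w) \<le> norm (z - w) + norm (T z - T w - (z - w))"
      using norm_triangle_ineq[of "z - w" "T z - T w - (z - w)"] by simp
    also have "\<dots> \<le> (1 + \<eta>) * norm (z - w)" using near[OF that] by (simp add: algebra_simps)
    also have "\<dots> \<le> \<Lambda> * norm (z - w)" using \<Lambda>1 by (intro mult_right_mono) auto
    finally show ?thesis by (simp add: dist_norm)
  qed
  have lip2: "dist z w \<le> \<Lambda> * dist (T z) (T w)" if "z \<in> cone01 A" "w \<in> cone01 A" for z w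
  proof -
    have "norm (z - w) \<le> norm (T z - T w) + norm (T z - T w - (z - w))"
      using norm_triangle_ineq4[of "T z - T w" "T z - T w - (z - w)"] by simp
    then have "(1 - \<eta>) * norm (z - w) \<le> norm (T z - T w)" using near[OF that] by (simp add: algebra_simps)
    then show ?thesis using \<eta> by (simp add: \<Lambda>_def dist_norm field_simps)
  qed
  have inj: "inj_on T (cone01 A)"
  proof (rule inj_onI)
    fix z w assume "z \<in> cone01 A" "w \<in> cone01 A" "T z = T w"
    with lip2[of z w] show "z = w" by simp
  qed
  have AC: "A \<subseteq> cone01 A" by (force simp: cone01_def intro: image_eqI[of _ _ "(1, _)"])
  have contT: "continuous_on S T" for S unfolding T_def by (intro continuous_intros continuous_on_g) (use p in auto)
  define B where "B = T ` A"
  have cB: "compact B" unfolding B_def by (intro compact_continuous_image contT A)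
  have B1: "B \<subseteq> {y. p \<bullet> y = 1}"
    using A(2) p by (auto simp: B_def T_def inner_add_right)
  have Thom: "T (t *\<^sub>R x) = t *\<^sub>R T x" if "0 \<le> t" for t x
    using that by (simp add: T_def hom algebra_simps diff_divide_distrib)
  have TC: "T ` cone01 A = cone01 B"
  proof -
    have "T ` cone01 A = (\<lambda>(t, x). T (t *\<^sub>R x)) ` ({0..1} \<times> A)"
      unfolding cone01_def image_image by (rule image_cong) auto
    also have "\<dots> = (\<lambda>(t, x). t *\<^sub>R T x) ` ({0..1} \<times> A)" by (intro image_cong) (auto simp: Thom)
    also have "\<dots> = cone01 B" unfolding cone01_def B_def by force
    finally show ?thesis .
  qed
  let ?V = "emeasure lborel"
  have bC: "cone01 A \<in> sets borel" "cone01 B \<in> sets borel"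
    using compact_cone01 A(1) cB by (auto intro: borel_compact)
  have h1: "H B \<le> ennreal (\<Lambda> ^ (DIM('a) - 1)) * H A"
    unfolding B_def by (rule hausdorff_measure_lipschitz_image[OF k_ge_1 \<Lambda>(2)]) (use lip1 AC in blast)
  have h2: "H A \<le> ennreal (\<Lambda> ^ (DIM('a) - 1)) * H B"
  proof -
    have "H (inv_into (cone01 A) T ` B) \<le> ennreal (\<Lambda> ^ (DIM('a) - 1)) * H B"
    proof (rule hausdorff_measure_lipschitz_image[OF k_ge_1 \<Lambda>(2)])
      fix u v assume "u \<in> B" "v \<in> B"
      then obtain x y where "x \<in> A" "y \<in> A" "u = T x" "v = T y" by (auto simp: B_def)
      then show "dist (inv_into (cone01 A) T u) (inv_into (cone01 A) T v) \<le> \<Lambda> * dist u v"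
        using lip2[of x y] AC inj by (auto simp: subset_iff)
    qed
    moreover have "inv_into (cone01 A) T ` B = A" unfolding B_def by (rule inv_into_image_cancel[OF inj AC])
    ultimately show ?thesis by simp
  qed
  have v1: "?V (cone01 B) \<le> ennreal (\<Lambda> ^ DIM('a)) * ?V (cone01 A)"
    unfolding TC[symmetric] by (rule emeasure_lborel_lipschitz_image[OF \<Lambda>(2) lip1]) (use bC in \<open>auto simp: TC\<close>)
  have v2: "?V (cone01 A) \<le> ennreal (\<Lambda> ^ DIM('a)) * ?V (cone01 B)"
  proof -
    have im: "inv_into (cone01 A) T ` cone01 B = cone01 A"
      unfolding TC[symmetric] by (rule inv_into_image_cancel[OF inj]) simp
    have "?V (inv_into (cone01 A) T ` cone01 B) \<le> ennreal (\<Lambda> ^ DIM('a)) * ?V (cone01 B)"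
    proof (rule emeasure_lborel_lipschitz_image[OF \<Lambda>(2)])
      fix u v assume "u \<in> cone01 B" "v \<in> cone01 B"
      then obtain x y where "x \<in> cone01 A" "y \<in> cone01 A" "u = T x" "v = T y" by (auto simp: TC[symmetric])
      then show "dist (inv_into (cone01 A) T u) (inv_into (cone01 A) T v) \<le> \<Lambda> * dist u v"
        using lip2[of x y] inj by auto
    qed (use bC im in auto)
    then show ?thesis by (simp add: im)
  qed
  have HB: "H B = ennreal (\<kappa> * DIM('a) * norm p) * ?V (cone01 B)"
    by (rule hausdorff_measure_flat_cone[OF dim \<kappa>_pos \<kappa> cB B1 p])
  have grad: "norm p \<le> \<Lambda> * norm (sgrad g x) \<and> norm (sgrad g x) \<le> \<Lambda> * norm p" if x: "x \<in> A" for x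
  proof -
    have s: "m \<le> norm (sgrad g x)" "norm (sgrad g x - p) \<le> \<epsilon>" using norm_sgrad_ge reg[OF x] by auto
    have np: "m / 2 \<le> norm p" using s \<epsilon> norm_triangle_ineq2[of "sgrad g x" p] by linarith
    have "1 * (2 / m) \<le> (2 * M / m + 1) * (2 / m)"
      by (rule mult_right_mono) (use m_pos M_pos in auto)
    from mult_left_mono[OF this \<epsilon>(1)] have "\<epsilon> * (2 / m) \<le> \<eta>" using \<eta>(1) by linarith
    then have em: "\<epsilon> \<le> \<eta> * (m / 2)" using m_pos by (simp add: field_simps)
    have "\<eta> * (m / 2) \<le> \<eta> * norm p" using np \<eta>0 by (rule mult_left_mono)
    moreover have "\<eta> * (m / 2) \<le> \<eta> * norm (sgrad g x)" using s m_pos \<eta>0 by (intro mult_left_mono) auto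
    moreover have "\<bar>norm (sgrad g x) - norm p\<bar> \<le> \<epsilon>"
      using s(2) norm_triangle_ineq3[of "sgrad g x" p] by linarith
    ultimately have "norm p \<le> (1 + \<eta>) * norm (sgrad g x)" "norm (sgrad g x) \<le> (1 + \<eta>) * norm p"
      using em by (auto simp: algebra_simps abs_le_iff)
    then show ?thesis using \<Lambda>1 by (meson mult_right_mono norm_ge_zero order_trans)
  qed
  \<comment> \<open>n - 1 factors come from the areas of A and its flattening, n from the volumes of
    the cones and one from comparing |grad g| with |p|.\<close>
  have lam_pow: "ennreal (\<Lambda> ^ (DIM('a) - 1)) * (ennreal (\<Lambda> ^ DIM('a)) * ennreal \<Lambda>) = ennreal (\<Lambda> ^ (2 * DIM('a)))"
  proof -
    have "(DIM('a) - 1) + DIM('a) + 1 = 2 * DIM('a)" using dim by simp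
    then have "\<Lambda> ^ (DIM('a) - 1) * (\<Lambda> ^ DIM('a) * \<Lambda>) = \<Lambda> ^ (2 * DIM('a))" by (metis power_add power_one_right mult.assoc)
    then show ?thesis using \<Lambda> by (simp add: ennreal_mult[symmetric])
  qed
  have c1: "emeasure cone_area A \<le> ennreal \<Lambda> * (ennreal (\<kappa> * DIM('a) * norm p) * ?V (cone01 A))"
  proof -
    have "emeasure cone_area A \<le> ennreal (\<kappa> * DIM('a) * (\<Lambda> * norm p)) * ?V (cone01 A)"
      by (rule cone_area_compact_le[OF A]) (use grad in auto)
    also have "\<kappa> * DIM('a) * (\<Lambda> * norm p) = \<Lambda> * (\<kappa> * DIM('a) * norm p)" by (simp add: mult_ac)
    also have "ennreal \<dots> = ennreal \<Lambda> * ennreal (\<kappa> * DIM('a) * norm p)"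
      using \<Lambda> \<kappa>_pos by (intro ennreal_mult) auto
    finally show ?thesis by (simp only: mult.assoc)
  qed
  have c2: "ennreal (\<kappa> * DIM('a) * norm p) * ?V (cone01 A) \<le> ennreal \<Lambda> * emeasure cone_area A"
  proof -
    have "\<kappa> * DIM('a) * norm p = \<Lambda> * (\<kappa> * DIM('a) * (norm p / \<Lambda>))" using \<Lambda> by simp
    also have "ennreal \<dots> = ennreal \<Lambda> * ennreal (\<kappa> * DIM('a) * (norm p / \<Lambda>))"
      using \<Lambda> \<kappa>_pos by (intro ennreal_mult) auto
    finally have "ennreal (\<kappa> * DIM('a) * norm p) * ?V (cone01 A) = ennreal \<Lambda> * (ennreal (\<kappa> * DIM('a) * (norm p / \<Lambda>)) * ?V (cone01 A))"
      by (simp only: mult.assoc)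
    also have "\<dots> \<le> ennreal \<Lambda> * emeasure cone_area A"
      by (intro mult_left_mono cone_area_compact_ge[OF A]) (use grad \<Lambda> in \<open>auto simp: field_simps\<close>)
    finally show ?thesis .
  qed
  have "H A \<le> ennreal (\<Lambda> ^ (DIM('a) - 1)) * (ennreal (\<kappa> * DIM('a) * norm p) * (ennreal (\<Lambda> ^ DIM('a)) * ?V (cone01 A)))"
    by (rule order_trans[OF h2]) (unfold HB, intro mult_left_mono v1, auto)
  also have "\<dots> = ennreal (\<Lambda> ^ (DIM('a) - 1)) * (ennreal (\<Lambda> ^ DIM('a)) * (ennreal (\<kappa> * DIM('a) * norm p) * ?V (cone01 A)))"
    by (simp only: mult.left_commute)
  also have "\<dots> \<le> ennreal (\<Lambda> ^ (DIM('a) - 1)) * (ennreal (\<Lambda> ^ DIM('a)) * (ennreal \<Lambda> * emeasure cone_area A))"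
    by (intro mult_left_mono c2) auto
  also have "\<dots> = ennreal (\<Lambda> ^ (2 * DIM('a))) * emeasure cone_area A" unfolding lam_pow[symmetric] by (simp only: mult.assoc)
  finally show "H A \<le> ennreal ((1 / (1 - \<eta>)) ^ (2 * DIM('a))) * emeasure cone_area A" by (simp only: \<Lambda>_def)
  have "emeasure cone_area A \<le> ennreal \<Lambda> * (ennreal (\<kappa> * DIM('a) * norm p) * (ennreal (\<Lambda> ^ DIM('a)) * ?V (cone01 B)))"
    by (rule order_trans[OF c1]) (intro mult_left_mono v2, auto)
  also have "\<dots> = ennreal \<Lambda> * (ennreal (\<Lambda> ^ DIM('a)) * H B)" unfolding HB by (simp only: mult.left_commute)
  also have "\<dots> \<le> ennreal \<Lambda> * (ennreal (\<Lambda> ^ DIM('a)) * (ennreal (\<Lambda> ^ (DIM('a) - 1)) * H A))"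
    by (intro mult_left_mono h1) auto
  also have "\<dots> = ennreal (\<Lambda> ^ (2 * DIM('a))) * H A" unfolding lam_pow[symmetric] by (simp only: mult_ac)
  finally show "emeasure cone_area A \<le> ennreal ((1 / (1 - \<eta>)) ^ (2 * DIM('a))) * H A" by (simp only: \<Lambda>_def)
qed

text \<open>A piece is indexed by an approximate gradient p, a centre c and a scale j. At a regular
  point the tangential estimate with the true gradient holds below some scale; replacing the
  gradient by a nearby p from a countable dense set costs another \<epsilon>/2.\<close>

lemma area_pieces:
  assumes \<epsilon>: "0 < \<epsilon>"
  obtains I :: "('a \<times> 'a \<times> nat) set" and P where "countable I"
    "\<And>i. i \<in> I \<Longrightarrow> P i \<in> sets borel" "\<And>i. P i \<subseteq> {x. g x = 1}"
    "{x. g x = 1 \<and> regpt g x} \<subseteq> (\<Union>i\<in>I. P i)"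
    "\<And>i x. x \<in> P i \<Longrightarrow> regpt g x \<and> norm (sgrad g x - fst i) \<le> \<epsilon>"
    "\<And>i x y. x \<in> P i \<Longrightarrow> y \<in> P i \<Longrightarrow> \<bar>fst i \<bullet> (x - y)\<bar> \<le> \<epsilon> * norm (x - y)"
proof -
  obtain D :: "'a set" where D: "countable D" "\<And>X. open X \<Longrightarrow> X \<noteq> {} \<Longrightarrow> \<exists>d\<in>D. d \<in> X"
    using countable_dense_setE by metis
  have dense: "\<exists>d\<in>D. dist x d < r" if "r > 0" for x r
    using D(2)[of "ball x r"] that by auto
  define I where "I = D \<times> D \<times> (UNIV :: nat set)"
  \<comment> \<open>Only points y of the level set are tested. The condition survives limits of x
    because the bound on the distance is strict, so \<open>Q p j\<close> is closed and hence
    Borel.\<close>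
  define Q where "Q p j = {x. g x = 1 \<and> (\<forall>y. g y = 1 \<longrightarrow> norm (y - x) < 1 / real (Suc j) \<longrightarrow> \<bar>p \<bullet> (y - x)\<bar> \<le> \<epsilon> * norm (y - x))}" for p j
  \<comment> \<open>The radius is half the scale, so that two points of a piece are closer than
    1/(j+1) and the condition \<open>Q\<close> at one of them applies to the other.\<close>
  define P where "P = (\<lambda>(p, c, j). {x. regpt g x \<and> norm (sgrad g x - p) \<le> \<epsilon> / 2 \<and> dist x c < 1 / (2 * real (Suc j))} \<inter> Q p j)"
  have Qb: "Q p j \<in> sets borel" for p j
  proof -
    have "closed (Q p j)"
    proof (subst closed_sequential_limits, intro allI impI)
      fix x l assume xl: "(\<forall>n. x n \<in> Q p j) \<and> x \<longlonglongrightarrow> l"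
      have "(\<lambda>n. g (x n)) \<longlonglongrightarrow> g l"
        using continuous_on_tendsto_compose[OF continuous_on_g[of UNIV], of x l] xl by auto
      moreover have "(\<lambda>n. g (x n)) = (\<lambda>n. 1)" using xl by (auto simp: Q_def)
      ultimately have gl: "g l = 1" by (simp add: LIMSEQ_const_iff)
      moreover have "\<bar>p \<bullet> (y - l)\<bar> \<le> \<epsilon> * norm (y - l)" if y: "g y = 1" "norm (y - l) < 1 / real (Suc j)" for y
      proof (rule LIMSEQ_le)
        show "(\<lambda>n. \<bar>p \<bullet> (y - x n)\<bar>) \<longlonglongrightarrow> \<bar>p \<bullet> (y - l)\<bar>" "(\<lambda>n. \<epsilon> * norm (y - x n)) \<longlonglongrightarrow> \<epsilon> * norm (y - l)"
          using xl by (auto intro!: tendsto_intros)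
        have "(\<lambda>n. norm (y - x n)) \<longlonglongrightarrow> norm (y - l)" using xl by (auto intro!: tendsto_intros)
        then have "eventually (\<lambda>n. norm (y - x n) < 1 / real (Suc j)) sequentially"
          using y(2) by (rule order_tendstoD)
        then obtain N where "\<And>n. n \<ge> N \<Longrightarrow> norm (y - x n) < 1 / real (Suc j)" by (auto simp: eventually_sequentially)
        then show "\<exists>N. \<forall>n\<ge>N. \<bar>p \<bullet> (y - x n)\<bar> \<le> \<epsilon> * norm (y - x n)"
          using xl y(1) by (intro exI[of _ N]) (auto simp: Q_def)
      qed
      ultimately show "l \<in> Q p j" by (simp add: Q_def)
    qed
    then show ?thesis by (rule borel_closed)
  qed
  show thesis
  proof (rule that[of I P])
    show "countable I" using D(1) by (auto simp: I_def)
    show "P i \<in> sets borel" for i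
    proof (cases i)
      case (fields p c j)
      have [measurable]: "Q p j \<in> sets borel" by (rule Qb)
      have "{x. regpt g x \<and> norm (sgrad g x - p) \<le> \<epsilon> / 2 \<and> dist x c < 1 / (2 * real (Suc j))} \<in> sets borel"
        by measurable
      then show ?thesis unfolding fields P_def prod.case by (rule sets.Int) (rule Qb)
    qed
    show "P i \<subseteq> {x. g x = 1}" for i by (cases i) (auto simp: P_def Q_def)
    show "regpt g x \<and> norm (sgrad g x - fst i) \<le> \<epsilon>" if "x \<in> P i" for i x
      using that \<epsilon> by (cases i) (auto simp: P_def)
    show "\<bar>fst i \<bullet> (x - y)\<bar> \<le> \<epsilon> * norm (x - y)" if "x \<in> P i" "y \<in> P i" for i x y
    proof (cases i)
      case (fields p c j)
      have "dist x y \<le> dist x c + dist y c" by (rule dist_triangle2)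
      also have "\<dots> < 1 / (2 * real (Suc j)) + 1 / (2 * real (Suc j))"
        using that fields by (intro add_strict_mono) (auto simp: P_def)
      also have "\<dots> = 1 / real (Suc j)" by (simp add: divide_simps)
      finally have "norm (x - y) < 1 / real (Suc j)" by (simp add: dist_norm)
      then show ?thesis using that fields by (auto simp: P_def Q_def)
    qed
    show "{x. g x = 1 \<and> regpt g x} \<subseteq> (\<Union>i\<in>I. P i)"
    proof
      fix x assume x: "x \<in> {x. g x = 1 \<and> regpt g x}"
      obtain p where p: "p \<in> D" "dist (sgrad g x) p < \<epsilon> / 2" using dense[of "\<epsilon> / 2" "sgrad g x"] \<epsilon> by auto
      obtain \<delta> where \<delta>: "0 < \<delta>" "\<And>y. norm (y - x) < \<delta> \<Longrightarrow> \<bar>g y - g x - sgrad g x \<bullet> (y - x)\<bar> \<le> \<epsilon> / 2 * norm (y - x)"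
        using frechet[of x "\<epsilon> / 2"] x \<epsilon> by auto
      obtain j where j: "inverse (real (Suc j)) < \<delta>" using reals_Archimedean \<delta>(1) by blast
      obtain c where c: "c \<in> D" "dist x c < 1 / (2 * real (Suc j))" using dense[of "1 / (2 * real (Suc j))" x] by auto
      have "\<bar>p \<bullet> (y - x)\<bar> \<le> \<epsilon> * norm (y - x)" if y: "g y = 1" "norm (y - x) < 1 / real (Suc j)" for y
      proof -
        have "norm (y - x) < \<delta>" using y j by (simp add: inverse_eq_divide)
        then have 1: "\<bar>sgrad g x \<bullet> (y - x)\<bar> \<le> \<epsilon> / 2 * norm (y - x)" using \<delta>(2)[of y] y x by simp
        have "\<bar>(sgrad g x - p) \<bullet> (y - x)\<bar> \<le> norm (sgrad g x - p) * norm (y - x)" by (rule Cauchy_Schwarz_ineq2)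
        also have "\<dots> \<le> \<epsilon> / 2 * norm (y - x)" using p(2) by (intro mult_right_mono) (auto simp: dist_norm)
        finally have 2: "\<bar>(sgrad g x - p) \<bullet> (y - x)\<bar> \<le> \<epsilon> / 2 * norm (y - x)" .
        have "p \<bullet> (y - x) = sgrad g x \<bullet> (y - x) - (sgrad g x - p) \<bullet> (y - x)" by (simp add: inner_diff_left)
        then have "\<bar>p \<bullet> (y - x)\<bar> \<le> \<bar>sgrad g x \<bullet> (y - x)\<bar> + \<bar>(sgrad g x - p) \<bullet> (y - x)\<bar>"
          by (simp only: abs_triangle_ineq4)
        also have "\<dots> \<le> \<epsilon> / 2 * norm (y - x) + \<epsilon> / 2 * norm (y - x)" by (rule add_mono[OF 1 2])
        finally show ?thesis by simp
      qed
      then have "x \<in> P (p, c, j)" using x p c by (auto simp: P_def Q_def dist_norm)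
      then show "x \<in> (\<Union>i\<in>I. P i)" using p c by (auto simp: I_def intro!: bexI[of _ "(p, c, j)"])
    qed
  qed
qed

text \<open>The estimate for nearly flat sets applies to compact subsets of a piece; inner
  regularity extends it to Borel subsets of the piece, countable additivity to the union of the
  pieces. As c > 1 is arbitrary, the two measures are forced to agree.\<close>

lemma level_area_cone_area_le:
  assumes c: "1 < (c::real)" and A: "A \<in> sets borel" "A \<subseteq> {x. g x = 1 \<and> regpt g x}"
  shows "emeasure level_area A \<le> ennreal c * emeasure cone_area A"
    and "emeasure cone_area A \<le> ennreal c * emeasure level_area A"
proof -
  have "((\<lambda>\<eta>::real. (1 / (1 - \<eta>)) ^ (2 * DIM('a))) \<longlongrightarrow> (1 / (1 - 0)) ^ (2 * DIM('a))) (at_right 0)"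
    by (intro tendsto_intros) auto
  then have "eventually (\<lambda>\<eta>::real. (1 / (1 - \<eta>)) ^ (2 * DIM('a)) < c) (at_right 0)"
    using c by (intro order_tendstoD) auto
  moreover have "eventually (\<lambda>\<eta>::real. \<eta> < 1) (at_right 0)" by (rule order_tendstoD(2)[OF tendsto_ident_at]) simp
  ultimately have "eventually (\<lambda>\<eta>::real. (1 / (1 - \<eta>)) ^ (2 * DIM('a)) < c \<and> \<eta> < 1 \<and> 0 < \<eta>) (at_right 0)"
    using eventually_at_right_less[of "0::real"] by eventually_elim auto
  then obtain \<eta> :: real where \<eta>: "(1 / (1 - \<eta>)) ^ (2 * DIM('a)) < c" "\<eta> < 1" "0 < \<eta>"
    using eventually_happens' trivial_limit_at_right_real by blast
  \<comment> \<open>The largest value allowed by the two smallness conditions of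
    \<open>area_nearly_flat\<close>.\<close>
  define \<epsilon> where "\<epsilon> = min (m / 2) (\<eta> / ((2 * M / m + 1) * (2 / m)))"
  have q: "0 < (2 * M / m + 1) * (2 / m)" using m_pos M_pos by (intro mult_pos_pos add_pos_pos) auto
  have \<epsilon>: "0 < \<epsilon>" "\<epsilon> \<le> m / 2" "\<epsilon> * ((2 * M / m + 1) * (2 / m)) \<le> \<eta>"
  proof -
    have "0 < \<eta> / ((2 * M / m + 1) * (2 / m))" by (rule divide_pos_pos[OF \<eta>(3) q])
    then show "0 < \<epsilon>" "\<epsilon> \<le> m / 2" using m_pos unfolding \<epsilon>_def by (simp_all only: min_less_iff_conj min.cobounded1) simp
    have "\<epsilon> * ((2 * M / m + 1) * (2 / m)) \<le> (\<eta> / ((2 * M / m + 1) * (2 / m))) * ((2 * M / m + 1) * (2 / m))"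
      using q by (intro mult_right_mono) (auto simp: \<epsilon>_def)
    also have "\<eta> / Q * Q = \<eta>" if "0 < Q" for Q using that by simp
    note this[OF q]
    finally show "\<epsilon> * ((2 * M / m + 1) * (2 / m)) \<le> \<eta>" .
  qed
  obtain I :: "('a \<times> 'a \<times> nat) set" and P where P: "countable I"
    "\<And>i. i \<in> I \<Longrightarrow> P i \<in> sets borel" "\<And>i. P i \<subseteq> {x. g x = 1}"
    "{x. g x = 1 \<and> regpt g x} \<subseteq> (\<Union>i\<in>I. P i)"
    "\<And>i x. x \<in> P i \<Longrightarrow> regpt g x \<and> norm (sgrad g x - fst i) \<le> \<epsilon>"
    "\<And>i x y. x \<in> P i \<Longrightarrow> y \<in> P i \<Longrightarrow> \<bar>fst i \<bullet> (x - y)\<bar> \<le> \<epsilon> * norm (x - y)"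
    using area_pieces[OF \<epsilon>(1)] by blast
  have compact_le: "emeasure level_area C \<le> ennreal c * emeasure cone_area C"
    "emeasure cone_area C \<le> ennreal c * emeasure level_area C" if C: "compact C" "C \<subseteq> P i" for C i
  proof -
    have C1: "C \<subseteq> {x. g x = 1}" using C P(3) by blast
    have HC: "emeasure level_area C = H C"
      using emeasure_level_area[of C] C C1 by (simp add: borel_compact Int_absorb2)
    have "emeasure level_area C \<le> ennreal ((1 / (1 - \<eta>)) ^ (2 * DIM('a))) * emeasure cone_area C
      \<and> emeasure cone_area C \<le> ennreal ((1 / (1 - \<eta>)) ^ (2 * DIM('a))) * emeasure level_area C"
    proof (cases "C = {}")
      case False
      then obtain x where x: "x \<in> C" by blast
      have "fst i \<noteq> 0"
      proof
        assume "fst i = 0"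
        then have "norm (sgrad g x) \<le> \<epsilon>" using P(5)[of x i] x C by auto
        moreover have "m \<le> norm (sgrad g x)" using norm_sgrad_ge P(5)[of x i] x C by auto
        ultimately show False using \<epsilon> m_pos by linarith
      qed
      note flat = area_nearly_flat[OF C(1) C1 this less_imp_le[OF \<epsilon>(1)] \<epsilon>(2,3) \<eta>(2)]
      have reg: "regpt g x \<and> norm (sgrad g x - fst i) \<le> \<epsilon>" if "x \<in> C" for x using P(5) C that by blast
      have nf: "\<bar>fst i \<bullet> (x - y)\<bar> \<le> \<epsilon> * norm (x - y)" if "x \<in> C" "y \<in> C" for x y using P(6) C that by blast
      show ?thesis unfolding HC
        by (intro conjI flat[OF reg nf])
    qed simp
    moreover have "ennreal ((1 / (1 - \<eta>)) ^ (2 * DIM('a))) \<le> ennreal c" using \<eta>(1) by (intro ennreal_leI) simp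
    ultimately show "emeasure level_area C \<le> ennreal c * emeasure cone_area C"
      "emeasure cone_area C \<le> ennreal c * emeasure level_area C"
      by (meson mult_right_mono order_trans zero_le)+
  qed
  have mono: "ennreal c * emeasure N C \<le> ennreal c * emeasure N B" if "C \<subseteq> B" "B \<in> sets N" for N :: "'a measure" and B C
    using that by (intro mult_left_mono emeasure_mono) auto
  have cover: "A \<subseteq> (\<Union>i\<in>I. P i)" using A P(4) by blast
  show "emeasure level_area A \<le> ennreal c * emeasure cone_area A"
  proof (rule emeasure_le_countable_cover[OF _ P(1), of _ _ P])
    fix i B assume B: "i \<in> I" "B \<in> sets cone_area" "B \<subseteq> P i"
    show "emeasure level_area B \<le> ennreal c * emeasure cone_area B"
    proof (rule emeasure_le_of_compact[OF sets_level_area finite_level_area])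
      fix C assume C: "compact C" "C \<subseteq> B"
      with B compact_le(1)[of C i] mono[of C B cone_area]
      show "emeasure level_area C \<le> ennreal c * emeasure cone_area B" by (meson order_trans)
    qed (use B in simp)
  qed (use A cover P(2) in auto)
  show "emeasure cone_area A \<le> ennreal c * emeasure level_area A"
  proof (rule emeasure_le_countable_cover[OF _ P(1), of _ _ P])
    fix i B assume B: "i \<in> I" "B \<in> sets level_area" "B \<subseteq> P i"
    show "emeasure cone_area B \<le> ennreal c * emeasure level_area B"
    proof (rule emeasure_le_of_compact[OF sets_cone_area finite_cone_area])
      fix C assume C: "compact C" "C \<subseteq> B"
      with B compact_le(2)[of C i] mono[of C B level_area]
      show "emeasure cone_area C \<le> ennreal c * emeasure level_area B" by (meson order_trans)
    qed (use B in simp)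
  qed (use A cover P(2) in auto)
qed

theorem hausdorff_level_area:
  assumes A: "A \<in> sets borel" "A \<subseteq> {x. g x = 1 \<and> regpt g x}"
  shows "H A = emeasure cone_area A"
proof -
  have fin: "emeasure level_area A < top" "emeasure cone_area A < top"
    using finite_measure.emeasure_finite[OF finite_level_area, of A]
      finite_measure.emeasure_finite[OF finite_cone_area, of A]
    unfolding infinity_ennreal_def top.not_eq_extremum by this
  have "emeasure level_area A = emeasure cone_area A"
  proof (rule antisym)
    show "emeasure level_area A \<le> emeasure cone_area A"
      by (rule ennreal_le_all_factors[OF level_area_cone_area_le(1)[OF _ A] fin(2)])
    show "emeasure cone_area A \<le> emeasure level_area A"
      by (rule ennreal_le_all_factors[OF level_area_cone_area_le(2)[OF _ A] fin(1)])
  qed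
  moreover have "A \<inter> {x. g x = 1} = A" using A by auto
  ultimately show ?thesis using emeasure_level_area[OF A(1)] by simp
qed

end

subsection \<open>The general volume of a body\<close>

lemma measurable_borel_sphere_iff:
  "f \<in> N \<rightarrow>\<^sub>M borel_sphere \<longleftrightarrow> f \<in> space N \<rightarrow> sphere 0 1 \<and> f \<in> N \<rightarrow>\<^sub>M borel"
  using measurable_restrict_space2_iff[of f N borel "sphere 0 1"] by auto

context gauge_area
begin

lemma support_fun_body:
  assumes r: "regpt g z" shows "support_fun body (sgn (sgrad g z)) = 1 / norm (sgrad g z)"
proof -
  define p where "p = sgrad g z"
  have p: "0 < norm p" using norm_sgrad_ge[OF r] m_pos unfolding p_def by linarith
  have z: "0 < g z" using r not_regpt_0 by (intro g_pos) auto
  have sg: "x \<bullet> sgn p = (p \<bullet> x) / norm p" for x by (simp add: sgn_div_norm inner_commute divide_inverse mult.commute)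
  have ub: "x \<bullet> sgn p \<le> 1 / norm p" if "x \<in> body" for x
    unfolding sg using sgrad_inner_le[OF r, of x] that p by (intro divide_right_mono) (auto simp: p_def body_def)
  have mem: "z /\<^sub>R g z \<in> body" using z by (simp add: body_def hom)
  have att: "(z /\<^sub>R g z) \<bullet> sgn p = 1 / norm p"
    unfolding sg using sgrad_inner_self[OF r] z by (simp add: p_def)
  show ?thesis
    unfolding support_fun_def p_def[symmetric]
  proof (rule cSup_eq_maximum)
    show "1 / norm p \<in> (\<lambda>x. x \<bullet> sgn p) ` body" by (rule rev_image_eqI[OF mem]) (rule att[symmetric])
  qed (use ub in blast)
qed

text \<open>A unit normal u at x, rescaled to q = u / (x . u), satisfies q . y \<le> g y with
  equality at x, so q is dominated by the directional derivative, which is linear with gradient p.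
  Testing the direction q - p gives q = p. The ball inside the body makes x . u positive.\<close>

lemma outer_unit_normals_body:
  assumes r: "regpt g x" and gx: "g x = 1"
  shows "outer_unit_normals body x = {sgn (sgrad g x)}"
proof -
  define p where "p = sgrad g x"
  have p: "0 < norm p" using norm_sgrad_ge[OF r] m_pos unfolding p_def by linarith
  have "sgn p \<in> outer_unit_normals body x"
  proof -
    have "(y - x) \<bullet> sgn p \<le> 0" if "y \<in> body" for y
    proof -
      have "p \<bullet> (y - x) \<le> 0"
        using sgrad_inner_le[OF r, of y] sgrad_inner_self[OF r] gx that
        by (simp add: p_def body_def inner_diff_right)
      then show ?thesis using p by (simp add: sgn_div_norm inner_commute[of "y - x" p] mult_nonneg_nonpos)
    qed
    then show ?thesis using p by (auto simp: outer_unit_normals_def norm_sgn)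
  qed
  moreover have "u = sgn p" if u: "u \<in> outer_unit_normals body x" for u
  proof -
    have nu: "norm u = 1" and le: "\<And>y. y \<in> body \<Longrightarrow> y \<bullet> u \<le> x \<bullet> u"
      using u by (auto simp: outer_unit_normals_def inner_diff_left)
    have "(1 / M) *\<^sub>R u \<in> body" by (rule subsetD[OF cball_subset_body]) (use M_pos nu in simp)
    from le[OF this] have "1 / M \<le> x \<bullet> u" using nu by (simp add: dot_square_norm)
    moreover have "0 < 1 / M" using M_pos by simp
    ultimately have xu: "0 < x \<bullet> u" by linarith
    define q where "q = u /\<^sub>R (x \<bullet> u)"
    have q: "q \<bullet> y \<le> g y" for y
    proof (cases "y = 0")
      case False
      then have gy: "0 < g y" by (rule g_pos)
      then have "(y /\<^sub>R g y) \<bullet> u \<le> x \<bullet> u" by (intro le) (simp add: body_def hom)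
      then have "y \<bullet> u \<le> g y * (x \<bullet> u)" using gy by (simp add: field_simps)
      then show ?thesis using xu by (simp add: q_def inner_commute field_simps)
    qed simp
    have qx: "q \<bullet> x = 1" using xu by (simp add: q_def inner_commute)
    have "q \<bullet> v \<le> p \<bullet> v" for v
    proof -
      have "q \<bullet> v \<le> dird g x v"
      proof (rule dird_geI)
        fix s :: real assume s: "0 < s"
        have "1 + s * (q \<bullet> v) \<le> g (x + s *\<^sub>R v)" using q[of "x + s *\<^sub>R v"] qx by (simp add: inner_add_right)
        then show "q \<bullet> v \<le> (g (x + s *\<^sub>R v) - g x) / s" using s gx by (simp add: field_simps)
      qed
      then show ?thesis using dird_eq_sgrad[OF r] by (simp add: p_def)
    qed
    from this[of "q - p"] have "(q - p) \<bullet> (q - p) \<le> 0" by (simp add: inner_diff_left)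
    then have "(q - p) \<bullet> (q - p) = 0" using inner_ge_zero[of "q - p"] by linarith
    then have qp: "q = p" by simp
    have "u = (x \<bullet> u) *\<^sub>R q" using xu by (simp add: q_def)
    then have "sgn u = sgn ((x \<bullet> u) *\<^sub>R q)" by (rule arg_cong)
    also have "\<dots> = sgn p" using xu by (simp add: sgn_scaleR qp)
    finally show ?thesis using nu by (simp add: sgn_div_norm)
  qed
  ultimately show ?thesis unfolding p_def[symmetric] by blast
qed

text \<open>The default basis vector at nonregular points keeps the values on the sphere everywhere,
  as a map into \<open>borel_sphere\<close> requires; only a null set sees it.\<close>

definition gnormal :: "'a \<Rightarrow> 'a" where
  "gnormal z = (if regpt g z then sgn (sgrad g z) else (SOME b. b \<in> Basis))"

lemma norm_gnormal: "norm (gnormal z) = 1"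
proof -
  have "(SOME b. b \<in> (Basis::'a set)) \<in> Basis" by (simp add: some_in_eq nonempty_Basis)
  moreover have "norm (sgn (sgrad g z)) = 1" if "regpt g z"
    using norm_sgrad_ge[OF that] m_pos by (auto simp: norm_sgn)
  ultimately show ?thesis by (simp add: gnormal_def)
qed

lemma measurable_gnormal_borel [measurable]: "gnormal \<in> borel \<rightarrow>\<^sub>M borel"
proof -
  have "gnormal = (\<lambda>z. if regpt g z then inverse (norm (sgrad g z)) *\<^sub>R sgrad g z else (SOME b. b \<in> Basis))"
    by (auto simp: gnormal_def sgn_div_norm fun_eq_iff)
  also have "\<dots> \<in> borel \<rightarrow>\<^sub>M borel" by measurable
  finally show ?thesis .
qed

lemma measurable_gnormal: "gnormal \<in> cone_density \<rightarrow>\<^sub>M borel_sphere"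
  unfolding measurable_borel_sphere_iff
proof
  show "gnormal \<in> space cone_density \<rightarrow> sphere 0 1" by (auto simp: norm_gnormal)
  have "(cone_density \<rightarrow>\<^sub>M borel) = (borel \<rightarrow>\<^sub>M (borel :: 'a measure))"
    by (rule measurable_cong_sets) auto
  then show "gnormal \<in> cone_density \<rightarrow>\<^sub>M borel" using measurable_gnormal_borel by simp
qed

lemma space_cone_density [simp]: "space cone_density = UNIV"
  by (simp add: cone_density_def)

text \<open>The Gauss preimage lies between the Borel set R and its union with the singular points,
  which are null for the outer measure. This squeeze gives its measure without deciding whether it
  is a Borel set.\<close>

lemma hausdorff_gauss_preimage:
  assumes \<eta>: "\<eta> \<in> sets (borel_sphere :: 'a measure)"
  shows "H (gauss_preimage body \<eta>) = emeasure (distr cone_density borel_sphere gnormal) \<eta>"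
proof -
  have \<eta>b [measurable]: "\<eta> \<in> sets borel"
    using \<eta> by (subst (asm) sets_restrict_space_iff) auto
  define R where "R = {x. g x = 1 \<and> regpt g x \<and> gnormal x \<in> \<eta>}"
  have Rb: "R \<in> sets borel" unfolding R_def by measurable
  have gR: "gauss_preimage body \<eta> \<subseteq> R \<union> {x. g x = 1 \<and> \<not> regpt g x}" "R \<subseteq> gauss_preimage body \<eta>"
    using outer_unit_normals_body by (auto simp: gauss_preimage_def frontier_body R_def gnormal_def)
  have "H (gauss_preimage body \<eta>) \<le> H R + H {x. g x = 1 \<and> \<not> regpt g x}"
    by (rule order_trans[OF hausdorff_measure_mono[OF gR(1)] hausdorff_measure_Un_le[OF k_ge_1]])
  then have "H (gauss_preimage body \<eta>) = H R"
    using hausdorff_measure_mono[OF gR(2), of "DIM('a) - 1"] by (simp only: hausdorff_singular_null add_0_right order_antisym)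
  also have "H R = emeasure cone_area R"
    by (rule hausdorff_level_area[OF Rb]) (auto simp: R_def)
  also have "\<dots> = (\<integral>\<^sup>+z. (ennreal (\<kappa> * DIM('a) * norm (sgrad g z)) * indicator {z. 0 < g z \<and> g z \<le> 1} z) * indicator (gnormal -` \<eta>) z \<partial>lborel)"
    unfolding emeasure_cone_area[OF Rb]
  proof (rule nn_integral_cong_AE)
    show "AE z in lborel. ennreal (\<kappa> * DIM('a) * norm (sgrad g z)) * indicator {z. 0 < g z \<and> g z \<le> 1 \<and> z /\<^sub>R g z \<in> R} z
      = (ennreal (\<kappa> * DIM('a) * norm (sgrad g z)) * indicator {z. 0 < g z \<and> g z \<le> 1} z) * indicator (gnormal -` \<eta>) z"
      using AE_regpt
    proof eventually_elim
      case (elim z)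
      have "z /\<^sub>R g z \<in> R \<longleftrightarrow> gnormal z \<in> \<eta>" if "0 < g z"
        using that elim regpt_cone[of "inverse (g z)" z] sgrad_cone[of "inverse (g z)" z]
        by (simp add: R_def gnormal_def hom)
      then show ?case by (auto split: split_indicator)
    qed
  qed
  also have "\<dots> = emeasure cone_density (gnormal -` \<eta>)"
    unfolding cone_density_def
    by (rule emeasure_density[symmetric]) (use measurable_sets_borel[OF measurable_gnormal_borel \<eta>b] in measurable)
  also have "\<dots> = emeasure (distr cone_density borel_sphere gnormal) \<eta>"
    by (subst emeasure_distr[OF measurable_gnormal \<eta>]) simp
  finally show ?thesis .
qed

text \<open>On all Borel subsets of the sphere the set function equals a genuine measure, so
  \<open>measure_of\<close> returns that measure and countable additivity is inherited.\<close>

lemma surface_area_measure_body: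
  "surface_area_measure body = distr cone_density borel_sphere gnormal"
proof -
  let ?N = "distr cone_density (borel_sphere :: 'a measure) gnormal"
  have "surface_area_measure body = measure_of (sphere 0 1) (sets borel_sphere) (emeasure ?N)"
    unfolding surface_area_measure_def
  proof (rule measure_of_eq)
    show "sets borel_sphere \<subseteq> Pow (sphere (0::'a) 1)"
      using sets.space_closed[of "borel_sphere :: 'a measure"] by (simp add: space_restrict_space)
    fix a assume "a \<in> sigma_sets (sphere (0::'a) 1) (sets borel_sphere)"
    then have "a \<in> sets (borel_sphere :: 'a measure)"
      using sets.sigma_sets_eq[of "borel_sphere :: 'a measure"] by (simp add: space_restrict_space)
    then show "H (gauss_preimage body a) = emeasure ?N a" by (rule hausdorff_gauss_preimage)
  qed
  also have "\<dots> = measure_of (space ?N) (sets ?N) (emeasure ?N)"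
    by (simp add: space_restrict_space)
  also have "\<dots> = ?N" by (rule measure_of_of_measure)
  finally show ?thesis .
qed

end

text \<open>For p = grad g the factors are the area density \<kappa> n |p| and the value of G at
  support value 1/|p| and normal \<open>sgn p\<close>. Gradients at regular points are nonzero, so
  the default at p = 0 is met at most on a null set.\<close>

definition vol_density :: "real \<Rightarrow> (real \<Rightarrow> 'a::euclidean_space \<Rightarrow> real) \<Rightarrow> 'a \<Rightarrow> real" where
  "vol_density \<kappa> G p = (if p \<noteq> 0 then \<kappa> * DIM('a) * norm p * G (1 / norm p) (sgn p) else 0)"

lemma continuous_on_vol_density:
  fixes G :: "real \<Rightarrow> 'a::euclidean_space \<Rightarrow> real"
  assumes G: "continuous_on ({0<..} \<times> sphere 0 1) (\<lambda>(t, u). G t u)"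
  shows "continuous_on (- {0}) (vol_density \<kappa> G)"
proof -
  have sg: "continuous_on (- {0}) (\<lambda>p::'a. sgn p)"
    unfolding sgn_div_norm by (intro continuous_intros) auto
  have "continuous_on (- {0}) (\<lambda>p::'a. (\<lambda>(t, u). G t u) (1 / norm p, sgn p))"
    by (rule continuous_on_compose2[OF G]) (auto intro!: continuous_intros sg simp: norm_sgn)
  then have "continuous_on (- {0}) (\<lambda>p::'a. \<kappa> * DIM('a) * norm p * G (1 / norm p) (sgn p))"
    by (intro continuous_intros) simp
  then show ?thesis
    by (rule continuous_on_eq) (simp add: vol_density_def)
qed

lemma measurable_vol_density:
  fixes G :: "real \<Rightarrow> 'a::euclidean_space \<Rightarrow> real"
  assumes G: "continuous_on ({0<..} \<times> sphere 0 1) (\<lambda>(t, u). G t u)"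
  shows "vol_density \<kappa> G \<in> borel_measurable borel"
proof -
  have "(\<lambda>p. if p \<in> - {0} then vol_density \<kappa> G p else 0) \<in> borel_measurable borel"
    by (rule borel_measurable_continuous_on_if) (auto intro: continuous_on_vol_density[OF G])
  moreover have "(\<lambda>p. if p \<in> - {0} then vol_density \<kappa> G p else 0) = vol_density \<kappa> G"
    by (auto simp: vol_density_def)
  ultimately show ?thesis by simp
qed

context gauge_area
begin

lemma continuous_on_support_fun_body: "continuous_on S (support_fun body)"
proof -
  have bdd: "bdd_above ((\<lambda>x. x \<bullet> u) ` body)" for u
    by (rule compact_imp_bounded[THEN bounded_imp_bdd_above]) (intro compact_continuous_image compact_body continuous_intros)
  have ne: "body \<noteq> {}" using g_0 by (auto simp: body_def intro!: exI[of _ 0])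
  have "support_fun body u \<le> support_fun body v + (1 / m) * norm (u - v)" for u v
    unfolding support_fun_def[of body u]
  proof (rule cSUP_least[OF ne])
    fix x assume x: "x \<in> body"
    have "x \<bullet> u = x \<bullet> v + x \<bullet> (u - v)" by (simp add: inner_diff_right)
    also have "x \<bullet> v \<le> support_fun body v" unfolding support_fun_def by (rule cSUP_upper[OF x bdd])
    also have "x \<bullet> (u - v) \<le> norm x * norm (u - v)" by (rule norm_cauchy_schwarz)
    also have "\<dots> \<le> (1 / m) * norm (u - v)" using body_subset x by (intro mult_right_mono) auto
    finally show "x \<bullet> u \<le> support_fun body v + (1 / m) * norm (u - v)" by simp
  qed
  note le = this
  have "(1 / m)-lipschitz_on UNIV (support_fun body)"
  proof (rule lipschitz_onI)
    fix u v :: 'a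
    show "dist (support_fun body u) (support_fun body v) \<le> 1 / m * dist u v"
      using le[of u v] le[of v u] by (simp add: dist_real_def dist_norm abs_le_iff norm_minus_commute)
  qed (use m_pos in simp)
  then show ?thesis by (rule continuous_on_subset[OF lipschitz_on_continuous_on]) simp
qed

lemma support_fun_body_pos:
  assumes "norm u = 1" shows "0 < support_fun body u"
proof -
  have "bdd_above ((\<lambda>x. x \<bullet> u) ` body)"
    by (rule compact_imp_bounded[THEN bounded_imp_bdd_above]) (intro compact_continuous_image compact_body continuous_intros)
  moreover have "(1 / M) *\<^sub>R u \<in> body" by (rule subsetD[OF cball_subset_body]) (use M_pos assms in simp)
  ultimately have "((1 / M) *\<^sub>R u) \<bullet> u \<le> support_fun body u" unfolding support_fun_def by (rule cSUP_upper[rotated])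
  moreover have "((1 / M) *\<^sub>R u) \<bullet> u = 1 / M" using assms by (simp add: dot_square_norm)
  moreover have "0 < 1 / M" using M_pos by simp
  ultimately show ?thesis by linarith
qed

theorem general_volume_body:
  fixes G :: "real \<Rightarrow> 'a \<Rightarrow> real"
  assumes G: "continuous_on ({0<..} \<times> sphere 0 1) (\<lambda>(t, u). G t u)"
  shows "general_volume G body = (\<integral>z. indicator body z * vol_density \<kappa> G (sgrad g z) \<partial>lborel)"
proof -
  let ?f = "\<lambda>u. G (support_fun body u) u"
  have "continuous_on (sphere 0 1) (\<lambda>u. (\<lambda>(t, u). G t u) (support_fun body u, u))"
    by (rule continuous_on_compose2[OF G])
      (auto intro!: continuous_intros continuous_on_support_fun_body simp: support_fun_body_pos)
  then have f: "?f \<in> borel_measurable borel_sphere"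
    by (intro borel_measurable_continuous_on_restrict) simp
  define d where "d z = \<kappa> * DIM('a) * norm (sgrad g z) * indicator {z. 0 < g z \<and> g z \<le> 1} z" for z
  have d[measurable]: "d \<in> borel_measurable borel" unfolding d_def by measurable
  have cd: "cone_density = density lborel (\<lambda>z. ennreal (d z))"
    unfolding cone_density_def d_def by (intro arg_cong[of _ _ "density lborel"]) (auto simp: fun_eq_iff split: split_indicator)
  have fg: "(\<lambda>z. ?f (gnormal z)) \<in> borel_measurable borel"
    using measurable_compose[OF measurable_gnormal f] by (simp add: cone_density_def)
  have vd: "(\<lambda>z. vol_density \<kappa> G (sgrad g z)) \<in> borel_measurable borel"
    by (rule measurable_compose[OF measurable_sgrad measurable_vol_density[OF G]])
  have "general_volume G body = (\<integral>z. ?f (gnormal z) \<partial>cone_density)"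
    unfolding general_volume_def surface_area_measure_body by (rule integral_distr[OF measurable_gnormal f])
  also have "\<dots> = (\<integral>z. d z *\<^sub>R ?f (gnormal z) \<partial>lborel)"
    unfolding cd by (rule integral_density) (use fg \<kappa>_pos in \<open>auto simp: d_def\<close>)
  also have "\<dots> = (\<integral>z. indicator body z * vol_density \<kappa> G (sgrad g z) \<partial>lborel)"
  proof (rule integral_cong_AE)
    show "AE z in lborel. d z *\<^sub>R ?f (gnormal z) = indicator body z * vol_density \<kappa> G (sgrad g z)"
      using AE_regpt
    proof eventually_elim
      case (elim z)
      have "0 < g z" using elim not_regpt_0 by (intro g_pos) auto
      moreover have "sgrad g z \<noteq> 0" using norm_sgrad_ge[OF elim] m_pos by auto
      ultimately show ?case
        using support_fun_body[OF elim] elim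
        by (auto simp: d_def body_def gnormal_def vol_density_def split: split_indicator)
    qed
    have [measurable]: "body \<in> sets borel" using compact_body by (simp add: borel_compact)
    show "(\<lambda>z. d z *\<^sub>R ?f (gnormal z)) \<in> borel_measurable lborel" using fg by simp
    show "(\<lambda>z. indicator body z * vol_density \<kappa> G (sgrad g z)) \<in> borel_measurable lborel" using vd by simp
  qed
  finally show ?thesis .
qed

lemma vol_density_bounded:
  fixes G :: "real \<Rightarrow> 'a \<Rightarrow> real"
  assumes G: "continuous_on ({0<..} \<times> sphere 0 1) (\<lambda>(t, u). G t u)" and c: "0 < c"
  obtains B where "\<And>p. c \<le> norm p \<Longrightarrow> norm p \<le> C \<Longrightarrow> \<bar>vol_density \<kappa> G p\<bar> \<le> B"
proof -
  have "closed {p::'a. c \<le> norm p}" by (intro closed_Collect_le continuous_intros)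
  then have "compact (cball 0 C \<inter> {p::'a. c \<le> norm p})" by (intro compact_Int_closed compact_cball)
  moreover have "continuous_on (cball 0 C \<inter> {p. c \<le> norm p}) (vol_density \<kappa> G)"
    by (rule continuous_on_subset[OF continuous_on_vol_density[OF G]]) (use c in auto)
  ultimately have "bounded (vol_density \<kappa> G ` (cball 0 C \<inter> {p. c \<le> norm p}))"
    by (intro compact_imp_bounded compact_continuous_image)
  then obtain B where "\<forall>y\<in>vol_density \<kappa> G ` (cball 0 C \<inter> {p. c \<le> norm p}). norm y \<le> B" by (auto simp: bounded_iff)
  then show thesis by (intro that[of B]) auto
qed

end

text \<open>A difference quotient of g0 that is close to its derivative is close to the same
  quotient of \<open>g i\<close> for large i, and quotients dominate derivatives; this gives the
  upper bound in every direction. At regular points the upper bound in direction -b is the lower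
  bound in direction b.\<close>

lemma sgrad_LIMSEQ:
  assumes g: "\<And>i. sublinear_gauge (g i) m M" and g0: "sublinear_gauge g0 m M"
    and lim: "\<And>x. (\<lambda>i. g i x) \<longlonglongrightarrow> g0 x"
    and reg: "\<And>i. regpt (g i) z" "regpt g0 z"
  shows "(\<lambda>i. sgrad (g i) z) \<longlonglongrightarrow> sgrad g0 z"
proof -
  have up: "eventually (\<lambda>i. dird (g i) z v < a) sequentially" if "dird g0 z v < a" for v a
  proof -
    have "eventually (\<lambda>j. real (Suc j) * (g0 (z + (1 / real (Suc j)) *\<^sub>R v) - g0 z) < a) sequentially"
      by (rule order_tendstoD(2)[OF sublinear_gauge.dird_LIMSEQ[OF g0] that])
    then obtain j where j: "real (Suc j) * (g0 (z + (1 / real (Suc j)) *\<^sub>R v) - g0 z) < a"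
      by (auto simp: eventually_sequentially)
    have "(\<lambda>i. real (Suc j) * (g i (z + (1 / real (Suc j)) *\<^sub>R v) - g i z)) \<longlonglongrightarrow> real (Suc j) * (g0 (z + (1 / real (Suc j)) *\<^sub>R v) - g0 z)"
      by (intro tendsto_intros lim)
    then have "eventually (\<lambda>i. real (Suc j) * (g i (z + (1 / real (Suc j)) *\<^sub>R v) - g i z) < a) sequentially"
      using j by (rule order_tendstoD)
    then show ?thesis
    proof eventually_elim
      case (elim i)
      have "dird (g i) z v \<le> (g i (z + (1 / real (Suc j)) *\<^sub>R v) - g i z) / (1 / real (Suc j))"
        by (rule sublinear_gauge.dird_le_quotient[OF g]) simp
      with elim show ?case unfolding sublinear_gauge.dird_quotient[OF g] by (rule le_less_trans[rotated])
    qed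
  qed
  have "(\<lambda>i. dird (g i) z b) \<longlonglongrightarrow> dird g0 z b" if b: "b \<in> Basis" for b
  proof (rule order_tendstoI)
    show "eventually (\<lambda>i. dird (g i) z b < a) sequentially" if "dird g0 z b < a" for a by (rule up[OF that])
    fix a assume "a < dird g0 z b"
    then have "dird g0 z (- b) < - a" using reg(2) b by (simp add: regpt_def)
    then have "eventually (\<lambda>i. dird (g i) z (- b) < - a) sequentially" by (rule up)
    then show "eventually (\<lambda>i. a < dird (g i) z b) sequentially"
      using reg(1) b by (auto simp: regpt_def elim!: eventually_mono)
  qed
  then show ?thesis unfolding sgrad_def by (intro tendsto_intros)
qed

theorem general_volume_LIMSEQ:
  fixes G :: "real \<Rightarrow> 'a::euclidean_space \<Rightarrow> real"
  assumes g: "\<And>i. gauge_area (g i) m M \<kappa>" and g0: "gauge_area g0 m M \<kappa>"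
    and lim: "\<And>x. (\<lambda>i. g i x) \<longlonglongrightarrow> g0 x"
    and G: "continuous_on ({0<..} \<times> sphere 0 1) (\<lambda>(t, u). G t u)"
  shows "(\<lambda>i. general_volume G {x. g i x \<le> 1}) \<longlonglongrightarrow> general_volume G {x. g0 x \<le> 1}"
proof -
  interpret g0: gauge_area g0 m M \<kappa> by (rule g0)
  interpret gi: gauge_area "g i" m M \<kappa> for i by (rule g)
  obtain B where B: "\<And>p::'a. m \<le> norm p \<Longrightarrow> norm p \<le> M \<Longrightarrow> \<bar>vol_density \<kappa> G p\<bar> \<le> B"
    using g0.vol_density_bounded[OF G g0.m_pos] by blast
  \<comment> \<open>The level g0 z = 1 is excluded because the indicators of the bodies need not
    converge there.\<close>
  have ae: "AE z in lborel. (\<forall>i. regpt (g i) z) \<and> regpt g0 z \<and> g0 z \<noteq> 1"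
    using AE_all_countable[THEN iffD2, OF allI, OF gi.AE_regpt] g0.AE_regpt AE_not_in[OF g0.null_level]
    by eventually_elim auto
  have "(\<lambda>i. \<integral>z. indicator (gi.body i) z * vol_density \<kappa> G (sgrad (g i) z) \<partial>lborel)
      \<longlonglongrightarrow> (\<integral>z. indicator g0.body z * vol_density \<kappa> G (sgrad g0 z) \<partial>lborel)"
  proof (rule integral_dominated_convergence[where w = "\<lambda>z. B * indicator (cball 0 (1 / m)) z"])
    have [measurable]: "g0.body \<in> sets borel" "gi.body i \<in> sets borel" for i
      using g0.compact_body gi.compact_body by (simp_all add: borel_compact)
    have [measurable]: "(\<lambda>z. vol_density \<kappa> G (sgrad g0 z)) \<in> borel_measurable borel"
      "(\<lambda>z. vol_density \<kappa> G (sgrad (g i) z)) \<in> borel_measurable borel" for i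
      by (rule measurable_compose[OF _ measurable_vol_density[OF G]], simp add: g0.measurable_sgrad gi.measurable_sgrad)+
    show "(\<lambda>z. indicator g0.body z * vol_density \<kappa> G (sgrad g0 z)) \<in> borel_measurable lborel"
      "(\<lambda>z. indicator (gi.body i) z * vol_density \<kappa> G (sgrad (g i) z)) \<in> borel_measurable lborel" for i
      by measurable
    show "integrable lborel (\<lambda>z::'a. B * indicator (cball 0 (1 / m)) z)"
      using emeasure_bounded_finite[of "cball (0::'a) (1 / m)"] by (intro integrable_mult_right integrable_real_indicator) auto
    show "AE z in lborel. (\<lambda>i. indicator (gi.body i) z * vol_density \<kappa> G (sgrad (g i) z)) \<longlonglongrightarrow> indicator g0.body z * vol_density \<kappa> G (sgrad g0 z)"
      using ae
    proof eventually_elim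
      case (elim z)
      have "(\<lambda>i. sgrad (g i) z) \<longlonglongrightarrow> sgrad g0 z"
        by (rule sgrad_LIMSEQ[OF gi.sublinear_gauge_axioms g0.sublinear_gauge_axioms lim]) (use elim in auto)
      moreover have "isCont (vol_density \<kappa> G) (sgrad g0 z)"
      proof -
        have "sgrad g0 z \<noteq> 0" using g0.norm_sgrad_ge[of z] elim g0.m_pos by auto
        then show ?thesis
          using continuous_on_vol_density[OF G] by (simp add: continuous_on_eq_continuous_at open_Compl)
      qed
      ultimately have 1: "(\<lambda>i. vol_density \<kappa> G (sgrad (g i) z)) \<longlonglongrightarrow> vol_density \<kappa> G (sgrad g0 z)"
        by (rule isCont_tendsto_compose[rotated])
      have "eventually (\<lambda>i. indicator (gi.body i) z = (indicator g0.body z :: real)) sequentially"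
      proof (cases "g0 z < 1")
        case True
        then have "eventually (\<lambda>i. g i z < 1) sequentially" by (rule order_tendstoD[OF lim])
        then show ?thesis by (rule eventually_mono) (use True in \<open>simp add: gi.body_def g0.body_def\<close>)
      next
        case False
        then have g0z: "1 < g0 z" using elim by auto
        then have "eventually (\<lambda>i. 1 < g i z) sequentially" by (rule order_tendstoD[OF lim])
        then show ?thesis by (rule eventually_mono) (use g0z in \<open>simp add: gi.body_def g0.body_def\<close>)
      qed
      then have "(\<lambda>i. indicator (gi.body i) z :: real) \<longlonglongrightarrow> indicator g0.body z" by (rule tendsto_eventually)
      then show ?case using 1 by (rule tendsto_mult)
    qed
    show "AE z in lborel. norm (indicator (gi.body i) z * vol_density \<kappa> G (sgrad (g i) z)) \<le> B * indicator (cball 0 (1 / m)) z" for i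
      using ae
    proof eventually_elim
      case (elim z)
      have "\<bar>vol_density \<kappa> G (sgrad (g i) z)\<bar> \<le> B"
        using elim gi.norm_sgrad_ge[of i z] gi.norm_sgrad_le[of i z] by (intro B) auto
      then show ?case using gi.body_subset[of i] by (auto simp: abs_mult split: split_indicator)
    qed
  qed
  then show ?thesis
    using g0.general_volume_body[OF G] gi.general_volume_body[OF G] by (simp add: g0.body_def gi.body_def)
qed

subsection \<open>Growth of the general volume\<close>

lemma nn_integral_lborel_translate:
  fixes f :: "'a::euclidean_space \<Rightarrow> ennreal"
  assumes [measurable]: "f \<in> borel_measurable borel"
  shows "(\<integral>\<^sup>+x. f (a + x) \<partial>lborel) = (\<integral>\<^sup>+x. f x \<partial>lborel)"
proof -
  have "(\<integral>\<^sup>+x. f x \<partial>lborel) = (\<integral>\<^sup>+x. f x \<partial>distr lborel borel ((+) a))" by (simp only: lborel_distr_plus)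
  also have "\<dots> = (\<integral>\<^sup>+x. f (a + x) \<partial>lborel)" by (rule nn_integral_distr) measurable
  finally show ?thesis by (rule sym)
qed

lemma nn_integral_lborel_scale:
  fixes f :: "'a::euclidean_space \<Rightarrow> ennreal"
  assumes [measurable]: "f \<in> borel_measurable borel" and c: "0 < c"
  shows "(\<integral>\<^sup>+x. f x \<partial>lborel) = ennreal (c ^ DIM('a)) * (\<integral>\<^sup>+x. f (c *\<^sub>R x) \<partial>lborel)"
proof -
  have "(\<integral>\<^sup>+x. f x \<partial>lborel) = (\<integral>\<^sup>+x. f x \<partial>density (distr lborel borel (\<lambda>x. 0 + c *\<^sub>R x)) (\<lambda>_. ennreal (\<bar>c\<bar> ^ DIM('a))))"
    using lborel_affine[of c "0::'a"] c by simp
  also have "\<dots> = (\<integral>\<^sup>+x. ennreal (c ^ DIM('a)) * f x \<partial>distr lborel borel (\<lambda>x. 0 + c *\<^sub>R x))"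
    using c by (subst nn_integral_density) auto
  also have "\<dots> = (\<integral>\<^sup>+x. ennreal (c ^ DIM('a)) * f (c *\<^sub>R x) \<partial>lborel)"
    by (subst nn_integral_distr) auto
  also have "\<dots> = ennreal (c ^ DIM('a)) * (\<integral>\<^sup>+x. f (c *\<^sub>R x) \<partial>lborel)"
    by (rule nn_integral_cmult) measurable
  finally show ?thesis .
qed

text \<open>Only an inequality, since \<open>ennreal\<close> discards negative increments.\<close>

lemma ennreal_telescope:
  fixes f :: "nat \<Rightarrow> real"
  shows "ennreal (f N - f 0) \<le> (\<Sum>j<N. ennreal (f (Suc j) - f j))"
proof (induction N)
  case (Suc N)
  have "ennreal (f (Suc N) - f 0) = ennreal ((f N - f 0) + (f (Suc N) - f N))" by simp
  also have "\<dots> \<le> ennreal (f N - f 0) + ennreal (f (Suc N) - f N)"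
    by (cases "0 \<le> f N - f 0"; cases "0 \<le> f (Suc N) - f N")
      (auto simp: ennreal_plus[symmetric] ennreal_neg simp del: ennreal_plus intro!: ennreal_leI)
  also have "\<dots> \<le> (\<Sum>j<N. ennreal (f (Suc j) - f j)) + ennreal (f (Suc N) - f N)"
    by (intro add_right_mono Suc.IH)
  finally show ?case by simp
qed simp

section \<open>An isoperimetric inequality for gauges\<close>

context sublinear_gauge
begin

definition body_vol :: real where "body_vol = measure lborel body"

definition grad_mass :: real where
  "grad_mass = (\<integral>z. indicator body z * norm (sgrad g z) \<partial>lborel)"

lemma emeasure_body: "emeasure lborel body = ennreal body_vol"
  unfolding body_vol_def using emeasure_body_finite by (intro emeasure_eq_ennreal_measure) simp

lemma body_vol_pos: "0 < body_vol"
proof -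
  have "emeasure lborel (ball (0::'a) (1 / M)) \<le> emeasure lborel body"
    using cball_subset_body by (intro emeasure_mono) auto
  moreover have "0 < emeasure lborel (ball (0::'a) (1 / M))" using M_pos by (simp add: emeasure_ball)
  ultimately have "0 < ennreal body_vol" unfolding emeasure_body by (rule less_le_trans[rotated])
  then show ?thesis by simp
qed

lemma integrable_body:
  fixes h :: "'a \<Rightarrow> real"
  assumes "h \<in> borel_measurable borel" "AE z in lborel. \<bar>h z\<bar> \<le> B"
  shows "integrable lborel (\<lambda>z. indicator body z * h z)"
proof -
  have "integrable lborel (\<lambda>z. indicator body z *\<^sub>R h z)"
    by (rule integrableI_bounded_set_indicator[where B = B])
      (use assms emeasure_body_finite in \<open>auto elim: eventually_mono\<close>)
  then show ?thesis by simp
qed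

lemma integrable_norm_sgrad: "integrable lborel (\<lambda>z. indicator body z * norm (sgrad g z))"
proof (rule integrable_body[where B = M])
  show "AE z in lborel. \<bar>norm (sgrad g z)\<bar> \<le> M"
    using AE_regpt by eventually_elim (simp add: norm_sgrad_le)
qed measurable

lemma nn_grad_mass: "(\<integral>\<^sup>+z. indicator body z * ennreal (norm (sgrad g z)) \<partial>lborel) = ennreal grad_mass"
proof -
  have "(\<integral>\<^sup>+z. indicator body z * ennreal (norm (sgrad g z)) \<partial>lborel)
      = (\<integral>\<^sup>+z. ennreal (indicator body z * norm (sgrad g z)) \<partial>lborel)"
    by (intro nn_integral_cong) (auto split: split_indicator)
  also have "\<dots> = ennreal grad_mass"
    unfolding grad_mass_def by (intro nn_integral_eq_integral integrable_norm_sgrad) simp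
  finally show ?thesis .
qed

lemma grad_mass_nonneg: "0 \<le> grad_mass"
  unfolding grad_mass_def by (intro integral_nonneg_AE) simp

text \<open>A Lipschitz substitute for the indicator of the body: it vanishes off the body and has
  gradient -grad g almost everywhere inside, so its total variation is
  \<open>grad_mass\<close>.\<close>

definition bump :: "'a \<Rightarrow> real" where "bump z = max 0 (1 - g z)"

lemma bump_nonneg: "0 \<le> bump z" by (simp add: bump_def)

lemma measurable_bump [measurable]: "bump \<in> borel_measurable borel"
  unfolding bump_def by measurable

text \<open>Where the increment is positive, w - a lies in the body and the subgradient at w bounds
  the increment by the product of grad g w with a. The smallness of a puts w into twice the body,
  and rescaling that integral gives the factor 2^n.\<close>

lemma bump_small_shift:
  assumes a: "M * norm a \<le> 1"
  shows "(\<integral>\<^sup>+w. ennreal (bump (w - a) - bump w) \<partial>lborel) \<le> ennreal (norm a * (2 ^ DIM('a) * grad_mass))"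
proof -
  have "(\<integral>\<^sup>+w. ennreal (bump (w - a) - bump w) \<partial>lborel)
      \<le> (\<integral>\<^sup>+w. ennreal (norm a) * (indicator body ((1/2) *\<^sub>R w) * ennreal (norm (sgrad g w))) \<partial>lborel)"
  proof (rule nn_integral_mono_AE)
    show "AE w in lborel. ennreal (bump (w - a) - bump w)
        \<le> ennreal (norm a) * (indicator body ((1/2) *\<^sub>R w) * ennreal (norm (sgrad g w)))"
      using AE_regpt
    proof eventually_elim
      case (elim w)
      show ?case
      proof (cases "bump (w - a) \<le> bump w")
        case True
        then have "ennreal (bump (w - a) - bump w) = 0" by (simp add: ennreal_neg)
        then show ?thesis by simp
      next
        case False
        then have g1: "g (w - a) < 1" by (auto simp: bump_def max_def split: if_splits)
        have "g w \<le> g (w - a) + M * norm a" using g_lipschitz[of w "w - a"] by (simp add: abs_le_iff)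
        then have "g w \<le> 2" using g1 a by linarith
        then have "(1/2) *\<^sub>R w \<in> body" by (simp add: body_def hom)
        moreover have "bump (w - a) - bump w \<le> norm a * norm (sgrad g w)"
        proof -
          have "bump (w - a) - bump w \<le> (1 - g (w - a)) - (1 - g w)" using g1 by (simp add: bump_def)
          also have "\<dots> \<le> sgrad g w \<bullet> a" using subgradient[OF elim, of "w - a"] by simp
          also have "\<dots> \<le> norm (sgrad g w) * norm a" by (rule norm_cauchy_schwarz)
          finally show ?thesis by (simp add: mult.commute)
        qed
        ultimately show ?thesis by (simp add: ennreal_mult[symmetric] ennreal_leI)
      qed
    qed
  qed
  also have "\<dots> = ennreal (norm a) * (\<integral>\<^sup>+w. indicator body ((1/2) *\<^sub>R w) * ennreal (norm (sgrad g w)) \<partial>lborel)"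
    by (rule nn_integral_cmult) measurable
  also have "(\<integral>\<^sup>+w. indicator body ((1/2) *\<^sub>R w) * ennreal (norm (sgrad g w)) \<partial>lborel)
      = ennreal (2 ^ DIM('a)) * (\<integral>\<^sup>+w. indicator body ((1/2) *\<^sub>R (2 *\<^sub>R w)) * ennreal (norm (sgrad g (2 *\<^sub>R w))) \<partial>lborel)"
    by (rule nn_integral_lborel_scale[OF _ zero_less_numeral]) measurable
  also have "(\<integral>\<^sup>+w. indicator body ((1/2) *\<^sub>R (2 *\<^sub>R w)) * ennreal (norm (sgrad g (2 *\<^sub>R w))) \<partial>lborel) = ennreal grad_mass"
    by (simp add: sgrad_cone nn_grad_mass)
  also have "ennreal (norm a) * (ennreal (2 ^ DIM('a)) * ennreal grad_mass) = ennreal (norm a * (2 ^ DIM('a) * grad_mass))"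
    using grad_mass_nonneg by (simp add: ennreal_mult)
  finally show ?thesis .
qed

text \<open>The bound for small shifts is linear in |a|, so cutting a into N short steps and
  telescoping keeps the same constant for every a.\<close>

lemma bump_shift:
  "(\<integral>\<^sup>+w. ennreal (bump (w - a) - bump w) \<partial>lborel) \<le> ennreal (norm a * (2 ^ DIM('a) * grad_mass))"
proof -
  define N where "N = Suc (nat \<lceil>M * norm a\<rceil>)"
  have N: "0 < real N" by (simp add: N_def)
  define b where "b = (1 / real N) *\<^sub>R a"
  have "M * norm a \<le> real N" unfolding N_def by linarith
  then have Mb: "M * norm b \<le> 1" using N by (simp add: b_def field_simps)
  have Nb: "real N *\<^sub>R b = a" using N by (simp add: b_def)
  have "(\<integral>\<^sup>+w. ennreal (bump (w - a) - bump w) \<partial>lborel)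
      \<le> (\<integral>\<^sup>+w. (\<Sum>j<N. ennreal (bump (w - real (Suc j) *\<^sub>R b) - bump (w - real j *\<^sub>R b))) \<partial>lborel)"
  proof (rule nn_integral_mono)
    fix w
    show "ennreal (bump (w - a) - bump w) \<le> (\<Sum>j<N. ennreal (bump (w - real (Suc j) *\<^sub>R b) - bump (w - real j *\<^sub>R b)))"
      using ennreal_telescope[of "\<lambda>j. bump (w - real j *\<^sub>R b)" N] by (simp add: Nb)
  qed
  also have "\<dots> = (\<Sum>j<N. (\<integral>\<^sup>+w. ennreal (bump (w - real (Suc j) *\<^sub>R b) - bump (w - real j *\<^sub>R b)) \<partial>lborel))"
    by (rule nn_integral_sum) measurable
  also have "\<dots> \<le> (\<Sum>j<N. ennreal (norm b * (2 ^ DIM('a) * grad_mass)))"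
  proof (rule sum_mono)
    fix j
    have "(\<integral>\<^sup>+w. ennreal (bump (w - real (Suc j) *\<^sub>R b) - bump (w - real j *\<^sub>R b)) \<partial>lborel)
        = (\<integral>\<^sup>+w. ennreal (bump ((- (real j *\<^sub>R b) + w) - b) - bump (- (real j *\<^sub>R b) + w)) \<partial>lborel)"
      by (simp add: algebra_simps)
    also have "\<dots> = (\<integral>\<^sup>+w. ennreal (bump (w - b) - bump w) \<partial>lborel)"
      by (rule nn_integral_lborel_translate) measurable
    finally show "(\<integral>\<^sup>+w. ennreal (bump (w - real (Suc j) *\<^sub>R b) - bump (w - real j *\<^sub>R b)) \<partial>lborel)
        \<le> ennreal (norm b * (2 ^ DIM('a) * grad_mass))"
      using bump_small_shift[OF Mb] by simp
  qed
  also have "\<dots> = ennreal (real N * (norm b * (2 ^ DIM('a) * grad_mass)))"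
    using grad_mass_nonneg by (simp add: ennreal_mult ennreal_of_nat_eq_real_of_nat)
  also have "real N * (norm b * (2 ^ DIM('a) * grad_mass)) = norm a * (2 ^ DIM('a) * grad_mass)"
    using N by (simp add: b_def)
  finally show ?thesis .
qed

definition bump_mass :: real where "bump_mass = (\<integral>z. bump z \<partial>lborel)"

lemma nn_bump_mass: "(\<integral>\<^sup>+z. ennreal (bump z) \<partial>lborel) = ennreal bump_mass"
  unfolding bump_mass_def
proof (rule nn_integral_eq_integral)
  have "integrable lborel (\<lambda>z. indicator body z * bump z)"
    by (rule integrable_body[where B = 1]) (use g_nonneg in \<open>auto simp: bump_def\<close>)
  moreover have "(\<lambda>z. indicator body z * bump z) = bump"
    by (auto simp: fun_eq_iff bump_def body_def split: split_indicator)
  ultimately show "integrable lborel bump" by simp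
qed (simp add: bump_nonneg)

text \<open>The bump is at least 1/2 on the body shrunk by one half, whose volume is
  \<open>body_vol\<close> / 2^n.\<close>

lemma bump_mass_ge: "body_vol \<le> 2 ^ Suc DIM('a) * bump_mass"
proof -
  have "ennreal (1/2) * (\<integral>\<^sup>+z. indicator body (2 *\<^sub>R z) \<partial>(lborel :: 'a measure)) = (\<integral>\<^sup>+z. ennreal (1/2) * indicator body (2 *\<^sub>R z) \<partial>lborel)"
    by (rule nn_integral_cmult[symmetric]) measurable
  also have "\<dots> \<le> (\<integral>\<^sup>+z. ennreal (bump z) \<partial>lborel)"
  proof (rule nn_integral_mono)
    fix z show "ennreal (1/2) * indicator body (2 *\<^sub>R z) \<le> ennreal (bump z)"
    proof (cases "2 *\<^sub>R z \<in> body")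
      case True
      then have "1/2 \<le> bump z" by (simp add: body_def bump_def hom)
      then have "ennreal (1/2) \<le> ennreal (bump z)" by (rule ennreal_leI)
      then show ?thesis using True by simp
    qed simp
  qed
  finally have 1: "ennreal (1/2) * (\<integral>\<^sup>+z. indicator body (2 *\<^sub>R z) \<partial>(lborel :: 'a measure)) \<le> ennreal bump_mass"
    by (simp only: nn_bump_mass)
  have "ennreal body_vol = (\<integral>\<^sup>+z. indicator body z \<partial>(lborel :: 'a measure))" by (simp add: emeasure_body)
  also have "\<dots> = ennreal (2 ^ DIM('a)) * (\<integral>\<^sup>+z. indicator body (2 *\<^sub>R z) \<partial>(lborel :: 'a measure))"
    by (rule nn_integral_lborel_scale[OF _ zero_less_numeral]) measurable
  also have "\<dots> = ennreal (2 ^ Suc DIM('a)) * (ennreal (1/2) * (\<integral>\<^sup>+z. indicator body (2 *\<^sub>R z) \<partial>(lborel :: 'a measure)))"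
  proof -
    have "ennreal (2 ^ Suc DIM('a)) * ennreal (1/2) = ennreal (2 ^ DIM('a))"
      by (subst ennreal_mult[symmetric]) auto
    then show ?thesis by (simp only: mult.assoc[symmetric])
  qed
  also have "\<dots> \<le> ennreal (2 ^ Suc DIM('a)) * ennreal bump_mass" by (intro mult_left_mono 1) simp
  also have "\<dots> = ennreal (2 ^ Suc DIM('a) * bump_mass)"
    by (rule ennreal_mult[symmetric]) (auto simp: bump_mass_def bump_nonneg)
  finally show ?thesis
    by (subst (asm) ennreal_le_iff) (auto simp: bump_mass_def bump_nonneg intro!: mult_nonneg_nonneg)
qed

text \<open>
  Averaging the translates of \<open>bump\<close> over a cube of volume \<open>2 * body_vol\<close>: most translates move \<open>bump\<close>
  off the body, so their \<open>L\<^sup>1\<close>-distance to \<open>bump\<close> is large, while it is controlled by the gradient.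
\<close>

lemma bump_mass_le:
  fixes l :: real
  assumes l: "0 < l" "l ^ DIM('a) = 2 * body_vol"
  shows "bump_mass \<le> 2 * (DIM('a) * l * (2 ^ DIM('a) * grad_mass))"
proof -
  let ?n = "DIM('a)"
  define Q where "Q = cbox 0 (l *\<^sub>R One :: 'a)"
  have Q [measurable]: "Q \<in> sets borel" by (simp add: Q_def)
  have vQ: "emeasure lborel Q = ennreal (2 * body_vol)"
  proof -
    have "emeasure lborel Q = ennreal (\<Prod>b\<in>(Basis::'a set). l)"
      unfolding Q_def using l by (subst emeasure_lborel_cbox) (auto intro!: arg_cong[of _ _ ennreal] prod.cong)
    then show ?thesis by (simp add: l)
  qed
  have nQ: "norm a \<le> ?n * l" if "a \<in> Q" for a
  proof -
    have "norm a \<le> (\<Sum>b\<in>Basis. \<bar>a \<bullet> b\<bar>)" by (rule norm_le_l1)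
    also have "\<dots> \<le> (\<Sum>b\<in>(Basis::'a set). l)" using that by (intro sum_mono) (auto simp: Q_def mem_box)
    finally show ?thesis by simp
  qed
  define E where "E = ?n * l * (2 ^ ?n * grad_mass)"
  have E0: "0 \<le> E" using l grad_mass_nonneg by (simp add: E_def)
  have U0: "0 \<le> bump_mass" by (simp add: bump_mass_def bump_nonneg)
  \<comment> \<open>\<open>ennreal\<close> cuts off negative values, so F carries the positive part
    of bump z - bump (z + a).\<close>
  define F where "F = (\<lambda>z a. indicator Q a * (indicator body z * ennreal (bump z - bump (z + a))) :: ennreal)"
  have Fm [measurable]: "(\<lambda>(z, a). F z a) \<in> borel_measurable (lborel \<Otimes>\<^sub>M lborel)"
    unfolding F_def by measurable
  have upper: "(\<integral>\<^sup>+a. (\<integral>\<^sup>+z. F z a \<partial>lborel) \<partial>lborel) \<le> ennreal (2 * body_vol * E)"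
  proof -
    have "(\<integral>\<^sup>+a. (\<integral>\<^sup>+z. F z a \<partial>lborel) \<partial>lborel) \<le> (\<integral>\<^sup>+a. ennreal E * indicator Q a \<partial>lborel)"
    proof (rule nn_integral_mono)
      fix a :: 'a
      show "(\<integral>\<^sup>+z. F z a \<partial>lborel) \<le> ennreal E * indicator Q a"
      proof (cases "a \<in> Q")
        case True
        have "(\<integral>\<^sup>+z. F z a \<partial>lborel) \<le> (\<integral>\<^sup>+z. ennreal (bump ((a + z) - a) - bump (a + z)) \<partial>lborel)"
          by (intro nn_integral_mono) (auto simp: F_def True add.commute split: split_indicator)
        also have "\<dots> = (\<integral>\<^sup>+z. ennreal (bump (z - a) - bump z) \<partial>lborel)"
          by (rule nn_integral_lborel_translate) measurable
        also have "\<dots> \<le> ennreal (norm a * (2 ^ ?n * grad_mass))" by (rule bump_shift)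
        also have "\<dots> \<le> ennreal E" unfolding E_def using nQ[OF True] grad_mass_nonneg
          by (intro ennreal_leI mult_right_mono) auto
        finally show ?thesis using True by simp
      qed (simp add: F_def)
    qed
    also have "\<dots> = ennreal E * emeasure lborel Q" by (rule nn_integral_cmult_indicator) simp
    also have "\<dots> = ennreal (2 * body_vol * E)" unfolding vQ using E0 body_vol_pos by (simp add: ennreal_mult[symmetric] mult.commute)
    finally show ?thesis .
  qed
  \<comment> \<open>For z in the body, \<open>bump z\<close> is at most the positive part in F plus
    \<open>bump (z + a)\<close>, and the latter integrates over a to \<open>bump_mass\<close>.
    Integrated over the body this error is \<open>bump_mass * body_vol\<close>, half of the left
    side; that is why the cube has volume \<open>2 * body_vol\<close>.\<close>
  have lower: "ennreal (2 * body_vol * bump_mass) \<le> (\<integral>\<^sup>+z. (\<integral>\<^sup>+a. F z a \<partial>lborel) \<partial>lborel) + ennreal (bump_mass * body_vol)"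
  proof -
    have "ennreal (2 * body_vol * bump_mass) = (\<integral>\<^sup>+z. ennreal (2 * body_vol) * ennreal (bump z) \<partial>lborel)"
      using body_vol_pos U0 by (subst nn_integral_cmult) (auto simp: nn_bump_mass ennreal_mult)
    also have "\<dots> \<le> (\<integral>\<^sup>+z. (\<integral>\<^sup>+a. F z a \<partial>lborel) + ennreal bump_mass * indicator body z \<partial>lborel)"
    proof (rule nn_integral_mono)
      fix z :: 'a
      show "ennreal (2 * body_vol) * ennreal (bump z) \<le> (\<integral>\<^sup>+a. F z a \<partial>lborel) + ennreal bump_mass * indicator body z"
      proof (cases "z \<in> body")
        case True
        have "ennreal (2 * body_vol) * ennreal (bump z) = (\<integral>\<^sup>+a. ennreal (bump z) * indicator Q a \<partial>lborel)"
          by (subst nn_integral_cmult_indicator) (auto simp: vQ mult.commute)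
        also have "\<dots> \<le> (\<integral>\<^sup>+a. F z a + ennreal (bump (z + a)) \<partial>lborel)"
        proof (rule nn_integral_mono)
          fix a
          have "ennreal (bump z) \<le> ennreal (bump z - bump (z + a)) + ennreal (bump (z + a))"
            by (cases "0 \<le> bump z - bump (z + a)")
              (auto simp: ennreal_plus[symmetric] bump_nonneg ennreal_neg simp del: ennreal_plus intro!: ennreal_leI)
          then show "ennreal (bump z) * indicator Q a \<le> F z a + ennreal (bump (z + a))"
            using True by (auto simp: F_def split: split_indicator)
        qed
        also have "\<dots> = (\<integral>\<^sup>+a. F z a \<partial>lborel) + (\<integral>\<^sup>+a. ennreal (bump (z + a)) \<partial>lborel)"
          by (rule nn_integral_add) (auto simp: F_def)
        also have "(\<integral>\<^sup>+a. ennreal (bump (z + a)) \<partial>lborel) = ennreal bump_mass"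
          unfolding nn_bump_mass[symmetric] by (rule nn_integral_lborel_translate) measurable
        finally show ?thesis using True by simp
      next
        case False
        then have "bump z = 0" by (simp add: body_def bump_def)
        then show ?thesis by simp
      qed
    qed
    also have "\<dots> = (\<integral>\<^sup>+z. (\<integral>\<^sup>+a. F z a \<partial>lborel) \<partial>lborel) + (\<integral>\<^sup>+z. ennreal bump_mass * indicator body z \<partial>lborel)"
      by (rule nn_integral_add) measurable
    also have "(\<integral>\<^sup>+z. ennreal bump_mass * indicator body z \<partial>lborel) = ennreal (bump_mass * body_vol)"
      using U0 body_vol_pos by (subst nn_integral_cmult_indicator) (auto simp: emeasure_body ennreal_mult)
    finally show ?thesis .
  qed
  have "(\<integral>\<^sup>+z. (\<integral>\<^sup>+a. F z a \<partial>lborel) \<partial>lborel) = (\<integral>\<^sup>+a. (\<integral>\<^sup>+z. F z a \<partial>lborel) \<partial>lborel)"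
    by (rule lborel_pair.Fubini'[symmetric]) measurable
  with upper have "(\<integral>\<^sup>+z. (\<integral>\<^sup>+a. F z a \<partial>lborel) \<partial>lborel) \<le> ennreal (2 * body_vol * E)" by simp
  from order_trans[OF lower add_right_mono[OF this]]
  have "ennreal (2 * body_vol * bump_mass) \<le> ennreal (2 * body_vol * E + bump_mass * body_vol)"
    using E0 U0 body_vol_pos by simp
  then have "2 * body_vol * bump_mass \<le> 2 * body_vol * E + bump_mass * body_vol"
    using E0 U0 body_vol_pos by (subst (asm) ennreal_le_iff) auto
  then have "body_vol * bump_mass \<le> body_vol * (2 * E)" by (simp add: algebra_simps)
  then show ?thesis using body_vol_pos by (simp add: E_def)
qed

text \<open>Since l is the n-th root of \<open>2 * body_vol\<close>, this is an isoperimetric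
  inequality for the weight |grad g|. The constant collects 2^(n+1) from
  \<open>bump_mass_ge\<close>, 2 from the absorbed half and 2^n from the dilation in
  \<open>bump_small_shift\<close>.\<close>

lemma isoperimetric:
  fixes l :: real
  assumes l: "0 < l" "l ^ DIM('a) = 2 * body_vol"
  shows "body_vol \<le> 4 ^ Suc DIM('a) * DIM('a) * l * grad_mass"
proof -
  have "body_vol \<le> 2 ^ Suc DIM('a) * (2 * (DIM('a) * l * (2 ^ DIM('a) * grad_mass)))"
    by (rule order_trans[OF bump_mass_ge mult_left_mono[OF bump_mass_le[OF l]]]) simp
  also have "\<dots> = (2 * 2) ^ Suc DIM('a) * DIM('a) * l * grad_mass"
    unfolding power_mult_distrib by (simp add: mult_ac)
  finally show ?thesis by simp
qed

text \<open>The convex hull of x and the ball of radius 1/M lies in the body. Along the half of the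
  segment from 0 to x that is nearer to 0 there is room for disjoint balls of radius 1/(2M) with
  spacing 1/M, about M |x| / 2 of them.\<close>

lemma norm_le_body_vol:
  assumes x: "x \<in> body"
  shows "norm x * measure lborel (ball (0::'a) (1 / (2 * M))) \<le> 2 * body_vol / M"
proof (cases "x = 0")
  case False
  define r where "r = 1 / M"
  have r: "0 < r" using M_pos by (simp add: r_def)
  have nx: "0 < norm x" using False by simp
  define N where "N = Suc (nat \<lfloor>norm x / (2 * r)\<rfloor>)"
  have N1: "norm x / (2 * r) \<le> real N" unfolding N_def by linarith
  have N2: "real (N - 1) \<le> norm x / (2 * r)"
  proof -
    have "0 \<le> norm x / (2 * r)" using r by simp
    then show ?thesis unfolding N_def by simp
  qed
  define c where "c j = (real j * r / norm x) *\<^sub>R x" for j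
  define B where "B j = ball (c j) (r / 2)" for j
  have sub: "B j \<subseteq> body" if "j < N" for j
  proof
    fix y assume y: "y \<in> B j"
    have "j \<le> N - 1" using that by simp
    then have "real j \<le> real (N - 1)" by (rule of_nat_mono)
    with N2 have "real j \<le> norm x / (2 * r)" by linarith
    then have t: "real j * r / norm x \<le> 1 / 2" using r nx by (simp add: field_simps)
    have "g y \<le> g (c j) + g (y - c j)" using sub[of "c j" "y - c j"] by simp
    also have "g (c j) = (real j * r / norm x) * g x" unfolding c_def using r nx by (intro hom) simp
    also have "\<dots> \<le> 1 / 2 * 1" using t x r nx g_nonneg by (intro mult_mono) (auto simp: body_def)
    also have "g (y - c j) \<le> M * norm (y - c j)" by (rule upper)
    also have "M * norm (y - c j) \<le> M * (r / 2)"
      using y M_pos by (intro mult_left_mono) (auto simp: B_def dist_norm norm_minus_commute)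
    finally show "y \<in> body" using M_pos by (simp add: body_def r_def)
  qed
  have disj: "disjoint_family_on B {..<N}"
    unfolding disjoint_family_on_def
  proof (intro ballI impI)
    fix i j :: nat assume "i \<noteq> j"
    have "c i - c j = ((real i - real j) * r / norm x) *\<^sub>R x" by (simp add: c_def algebra_simps diff_divide_distrib)
    then have "dist (c i) (c j) = \<bar>real i - real j\<bar> * r" using r nx by (simp add: dist_norm abs_mult)
    moreover have "1 \<le> \<bar>real i - real j\<bar>" using \<open>i \<noteq> j\<close> by linarith
    ultimately have d: "r \<le> dist (c i) (c j)" using r by simp
    show "B i \<inter> B j = {}"
    proof (rule ccontr)
      assume "B i \<inter> B j \<noteq> {}"
      then obtain y where "dist (c i) y < r / 2" "dist (c j) y < r / 2" by (auto simp: B_def)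
      then show False using d dist_triangle2[of "c i" "c j" y] by linarith
    qed
  qed
  have "real N * measure lborel (ball (0::'a) (r / 2)) = (\<Sum>j<N. measure lborel (B j))"
  proof -
    have "measure lborel (B j) = measure lborel (ball (0::'a) (r / 2))" for j
      unfolding B_def measure_def using r by (simp add: emeasure_ball)
    then show ?thesis by simp
  qed
  also have "\<dots> = measure lborel (\<Union>j<N. B j)"
    by (rule measure_finite_Union[symmetric, OF _ _ disj])
      (use r in \<open>auto simp: B_def emeasure_ball\<close>)
  also have "\<dots> \<le> body_vol"
    unfolding body_vol_def by (rule measure_mono_fmeasurable)
      (use sub emeasure_body_finite in \<open>auto simp: B_def fmeasurable_def\<close>)
  finally have "norm x / (2 * r) * measure lborel (ball (0::'a) (r / 2)) \<le> body_vol"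
    using mult_right_mono[OF N1, of "measure lborel (ball (0::'a) (r / 2))"] by simp
  then show ?thesis using r M_pos by (simp add: r_def field_simps)
qed (use body_vol_pos M_pos in simp)

end

text \<open>The growth hypothesis concerns t \<ge> 1, while the support values that occur are only
  known to be at least 1/M. On the compact range between \<tau> and 1, continuity and positivity of
  G supply the constant.\<close>

lemma growth_lower_bound:
  fixes G :: "real \<Rightarrow> 'a::euclidean_space \<Rightarrow> real"
  assumes G: "continuous_on ({0<..} \<times> sphere 0 1) (\<lambda>(t, u). G t u)"
    and pos: "\<And>t u. 0 < t \<Longrightarrow> u \<in> sphere 0 1 \<Longrightarrow> 0 < G t u"
    and inf: "(INF (t, u) \<in> {1..} \<times> sphere 0 1. G t u / t powr q) > 0"
    and \<tau>: "0 < \<tau>"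
  obtains c where "0 < c" "\<And>t u. \<tau> \<le> t \<Longrightarrow> u \<in> sphere 0 1 \<Longrightarrow> c * t powr q \<le> G t u"
proof -
  let ?F = "\<lambda>(t, u). G t u / t powr q"
  define c1 where "c1 = (INF (t, u) \<in> {1..} \<times> sphere 0 1. G t u / t powr q)"
  have c1: "c1 \<le> G t u / t powr q" if "1 \<le> t" "u \<in> sphere 0 1" for t u
  proof -
    have "bdd_below (?F ` ({1..} \<times> sphere 0 1))"
      by (rule bdd_belowI[of _ 0]) (auto intro!: divide_nonneg_nonneg less_imp_le[OF pos])
    then have "c1 \<le> ?F (t, u)" unfolding c1_def by (rule cINF_lower) (use that in auto)
    then show ?thesis by simp
  qed
  define S where "S = {min \<tau> 1..1} \<times> sphere (0::'a) 1"
  have cS: "compact S" unfolding S_def by (intro compact_Times compact_Icc compact_sphere)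
  have neS: "S \<noteq> {}" unfolding S_def using \<tau> by auto
  have "continuous_on S (\<lambda>x. (\<lambda>(t, u). G t u) x / fst x powr q)"
    by (intro continuous_intros continuous_on_subset[OF G]) (use \<tau> in \<open>auto simp: S_def\<close>)
  then have "continuous_on S ?F" by (simp add: case_prod_beta)
  from continuous_attains_inf[OF cS neS this] obtain s where s: "s \<in> S" "\<forall>y\<in>S. ?F s \<le> ?F y" ..
  obtain t0 u0 where s0: "s = (t0, u0)" by (cases s)
  define c2 where "c2 = G t0 u0 / t0 powr q"
  have t0: "0 < t0" "u0 \<in> sphere 0 1" using s(1) \<tau> by (auto simp: s0 S_def)
  have c2: "0 < c2" unfolding c2_def using t0 by (intro divide_pos_pos pos) auto
  show thesis
  proof (rule that[of "min c1 c2"])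
    show "0 < min c1 c2" using inf c2 by (simp add: c1_def)
    fix t u assume t: "\<tau> \<le> t" and u: "u \<in> sphere (0::'a) 1"
    have t0: "0 < t powr q" using t \<tau> by simp
    have "min c1 c2 \<le> G t u / t powr q"
    proof (cases "1 \<le> t")
      case True
      then show ?thesis using c1[OF True u] by simp
    next
      case False
      then have "(t, u) \<in> S" using t u by (auto simp: S_def)
      with s(2) have "?F s \<le> ?F (t, u)" by blast
      then show ?thesis by (simp add: c2_def s0)
    qed
    then show "min c1 c2 * t powr q \<le> G t u" using t0 by (simp add: pos_le_divide_eq)
  qed
qed

section \<open>Volume and diameter bounds from the general volume\<close>

context gauge_area
begin

text \<open>The convexity argument is made by hand: |p|^(1 - q) is bounded below by the affine
  function a^(-q) (|p| - a) of |p|. Since \<open>body_vol\<close> is at most C times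
  \<open>grad_mass\<close>, the choice a = 1/(2C) makes the subtracted term at most half of
  \<open>grad_mass\<close>.\<close>

lemma general_volume_ge:
  fixes G :: "real \<Rightarrow> 'a \<Rightarrow> real" and l :: real
  assumes G: "continuous_on ({0<..} \<times> sphere 0 1) (\<lambda>(t, u). G t u)"
    and c: "0 < c" "\<And>t u. 1 / M \<le> t \<Longrightarrow> u \<in> sphere 0 1 \<Longrightarrow> c * t powr q \<le> G t u" and q: "q < 0"
    and l: "0 < l" "l ^ DIM('a) = 2 * body_vol"
  shows "\<kappa> * DIM('a) * c * (1 / (2 * (4 ^ Suc DIM('a) * DIM('a) * l))) powr (1 - q) * body_vol \<le> general_volume G body"
proof -
  define C where "C = 4 ^ Suc DIM('a) * DIM('a) * l"
  have C: "0 < C" using l by (simp add: C_def)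
  define a where "a = 1 / (2 * C)"
  have a: "0 < a" using C by (simp add: a_def)
  define d where "d = \<kappa> * DIM('a) * c * a powr (- q)"
  have d: "0 < d" using \<kappa>_pos c a n_pos by (simp add: d_def)
  have ineq: "d * (norm p - a) \<le> vol_density \<kappa> G p" if p: "m \<le> norm p" "norm p \<le> M" for p
  proof -
    have np: "0 < norm p" using p m_pos by linarith
    have "1 / M \<le> 1 / norm p" using p np by (simp add: frac_le)
    moreover have "sgn p \<in> sphere 0 1" using np by (simp add: norm_sgn)
    ultimately have "c * (1 / norm p) powr q \<le> G (1 / norm p) (sgn p)" by (rule c(2))
    moreover have "(1 / norm p) powr q = norm p powr (- q)"
      using np by (simp add: powr_minus powr_divide inverse_eq_divide)
    ultimately have 1: "c * norm p powr (- q) \<le> G (1 / norm p) (sgn p)" by simp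
    have 2: "a powr (- q) * (norm p - a) \<le> norm p * norm p powr (- q)"
    proof (cases "a \<le> norm p")
      case True
      have "a powr (- q) * (norm p - a) \<le> norm p powr (- q) * norm p"
        using True a q by (intro mult_mono powr_mono2) auto
      then show ?thesis by (simp add: mult.commute)
    next
      case False
      then have "a powr (- q) * (norm p - a) \<le> 0" by (intro mult_nonneg_nonpos) auto
      also have "0 \<le> norm p * norm p powr (- q)" by simp
      finally show ?thesis .
    qed
    have kc: "0 \<le> \<kappa> * DIM('a) * c" using \<kappa>_pos c by simp
    have "d * (norm p - a) = (\<kappa> * DIM('a) * c) * (a powr (- q) * (norm p - a))" by (simp add: d_def)
    also have "\<dots> \<le> (\<kappa> * DIM('a) * c) * (norm p * norm p powr (- q))" by (rule mult_left_mono[OF 2 kc])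
    also have "\<dots> = (\<kappa> * DIM('a) * norm p) * (c * norm p powr (- q))" by (simp add: mult_ac)
    also have "\<dots> \<le> (\<kappa> * DIM('a) * norm p) * G (1 / norm p) (sgn p)"
      using \<kappa>_pos by (intro mult_left_mono 1) simp
    also have "\<dots> = vol_density \<kappa> G p" using np by (auto simp: vol_density_def)
    finally show ?thesis .
  qed
  obtain B where B: "\<And>p::'a. m \<le> norm p \<Longrightarrow> norm p \<le> M \<Longrightarrow> \<bar>vol_density \<kappa> G p\<bar> \<le> B"
    using vol_density_bounded[OF G m_pos] by blast
  have intv: "integrable lborel (\<lambda>z. indicator body z * vol_density \<kappa> G (sgrad g z))"
  proof (rule integrable_body[where B = B])
    show "(\<lambda>z. vol_density \<kappa> G (sgrad g z)) \<in> borel_measurable borel"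
      by (rule measurable_compose[OF measurable_sgrad measurable_vol_density[OF G]])
    show "AE z in lborel. \<bar>vol_density \<kappa> G (sgrad g z)\<bar> \<le> B"
      using AE_regpt by eventually_elim (intro B norm_sgrad_ge norm_sgrad_le)
  qed
  have inta: "integrable lborel (\<lambda>z. indicator body z * a)" by (rule integrable_body[where B = a]) (use a in auto)
  have "d * (grad_mass - a * body_vol) = (\<integral>z. d * (indicator body z * norm (sgrad g z) - indicator body z * a) \<partial>lborel)"
  proof -
    have "(\<integral>z. indicator body z * a \<partial>lborel) = a * body_vol" by (simp add: body_vol_def mult.commute)
    then show ?thesis
      by (simp only: integral_mult_right_zero Bochner_Integration.integral_diff[OF integrable_norm_sgrad inta] grad_mass_def)
  qed
  also have "\<dots> \<le> (\<integral>z. indicator body z * vol_density \<kappa> G (sgrad g z) \<partial>lborel)"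
  proof (rule integral_mono_AE)
    show "integrable lborel (\<lambda>z. d * (indicator body z * norm (sgrad g z) - indicator body z * a))"
      by (intro integrable_mult_right Bochner_Integration.integrable_diff integrable_norm_sgrad inta)
    show "AE z in lborel. d * (indicator body z * norm (sgrad g z) - indicator body z * a)
        \<le> indicator body z * vol_density \<kappa> G (sgrad g z)"
      using AE_regpt
    proof eventually_elim
      case (elim z)
      then show ?case using ineq[OF norm_sgrad_ge[OF elim] norm_sgrad_le[OF elim]] by (auto split: split_indicator)
    qed
  qed (rule intv)
  also have "\<dots> = general_volume G body" by (rule general_volume_body[OF G, symmetric])
  finally have vg: "d * (grad_mass - a * body_vol) \<le> general_volume G body" .
  have "body_vol \<le> C * grad_mass" unfolding C_def by (rule isoperimetric[OF l])
  then have "2 * a * body_vol \<le> grad_mass" using C by (simp add: a_def field_simps)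
  then have "d * (a * body_vol) \<le> d * (grad_mass - a * body_vol)" using d by (intro mult_left_mono) auto
  moreover have "d * (a * body_vol) = \<kappa> * DIM('a) * c * a powr (1 - q) * body_vol"
    using a by (simp add: d_def powr_diff powr_minus field_simps)
  ultimately show ?thesis using vg unfolding a_def C_def by linarith
qed

end

text \<open>The point is that m' does not depend on the lower constant m of the gauge, only on its
  upper constant M and the data, which makes the bound uniform over all bodies in a fixed ball.
  Writing \<open>body_vol\<close> as l^n / 2 turns \<open>general_volume_ge\<close> into a lower
  bound by a multiple of l^s.\<close>

theorem gauge_uniform_lower_bound:
  fixes G :: "real \<Rightarrow> 'a::euclidean_space \<Rightarrow> real"
  assumes G: "continuous_on ({0<..} \<times> sphere 0 1) (\<lambda>(t, u). G t u)"
    and pos: "\<And>t u. 0 < t \<Longrightarrow> u \<in> sphere 0 1 \<Longrightarrow> 0 < G t u"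
    and inf: "(INF (t, u) \<in> {1..} \<times> sphere 0 1. G t u / t powr q) > 0"
    and q: "1 - real DIM('a) < q" "q < 0"
  obtains m' where "0 < m'"
    "\<And>g m x. gauge_area g m M \<kappa> \<Longrightarrow> general_volume G {x. g x \<le> 1} \<le> v \<Longrightarrow> m' * norm x \<le> g x"
proof (cases "\<exists>g m. gauge_area (g :: 'a \<Rightarrow> real) m M \<kappa>")
  \<comment> \<open>Here the claim is vacuous; in the other case one gauge supplies positivity of M
    and \<kappa>.\<close>
  case False
  then show thesis using that[of 1] by auto
next
  case True
  then obtain g0 m0 where "gauge_area (g0 :: 'a \<Rightarrow> real) m0 M \<kappa>" by blast
  then interpret g0: gauge_area g0 m0 M \<kappa> .
  define n where "n = real DIM('a)"
  have n: "0 < n" by (simp add: n_def)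
  have M: "0 < M" by (rule g0.M_pos)
  obtain c where c: "0 < c" "\<And>t u. 1 / M \<le> t \<Longrightarrow> u \<in> sphere (0::'a) 1 \<Longrightarrow> c * t powr q \<le> G t u"
    using growth_lower_bound[OF G pos inf, of "1 / M"] M by auto
  define b where "b = 2 * (4 ^ Suc DIM('a) * n)"
  have b: "0 < b" using n by (simp add: b_def)
  define e where "e = \<kappa> * n * c * b powr (- (1 - q)) / 2"
  have e: "0 < e" using g0.\<kappa>_pos n c b by (simp add: e_def)
  \<comment> \<open>The surviving power of l: l^n from the volume and l^(-(1 - q)) from the
    constant. Its positivity is the hypothesis q > 1 - n.\<close>
  define s where "s = n - (1 - q)"
  have s: "0 < s" using q by (simp add: s_def n_def)
  define L where "L = (max 0 v / e) powr (1 / s)"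
  define \<beta> where "\<beta> = measure lborel (ball (0::'a) (1 / (2 * M)))"
  have \<beta>: "0 < \<beta>" unfolding \<beta>_def using M by (simp add: content_ball_pos)
  \<comment> \<open>The added 1 keeps D positive even if L is 0.\<close>
  define D where "D = L ^ DIM('a) / (M * \<beta>) + 1"
  have D: "0 < D" using M \<beta> by (simp add: D_def L_def add_nonneg_pos)
  show thesis
  proof (rule that[of "1 / D"])
    show "0 < 1 / D" using D by simp
    fix g :: "'a \<Rightarrow> real" and m x
    assume gm: "gauge_area g m M \<kappa>" and gv: "general_volume G {x. g x \<le> 1} \<le> v"
    interpret g: gauge_area g m M \<kappa> by (rule gm)
    define l where "l = root DIM('a) (2 * g.body_vol)"
    have l: "0 < l" "l ^ DIM('a) = 2 * g.body_vol"
      using g.body_vol_pos by (simp_all add: l_def)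
    have vol: "g.body_vol = l powr n / 2" using l by (simp add: n_def powr_realpow)
    have "\<kappa> * n * c * (1 / (b * l)) powr (1 - q) * g.body_vol \<le> general_volume G g.body"
      using g.general_volume_ge[OF G c q(2) l] by (simp add: n_def b_def mult_ac)
    also have "\<dots> \<le> v" using gv by (simp add: g.body_def)
    also have "\<kappa> * n * c * (1 / (b * l)) powr (1 - q) * g.body_vol = e * l powr s"
    proof -
      have "(1 / (b * l)) powr (1 - q) = b powr (- (1 - q)) * l powr (- (1 - q))"
      proof -
        have "(1 / (b * l)) powr (1 - q) = 1 / (b * l) powr (1 - q)" using b l by (simp add: powr_divide)
        also have "\<dots> = (b * l) powr (- (1 - q))" by (rule powr_minus_divide[symmetric])
        also have "\<dots> = b powr (- (1 - q)) * l powr (- (1 - q))" by (rule powr_mult)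
        finally show ?thesis .
      qed
      moreover have "l powr (- (1 - q)) * l powr n = l powr s"
        by (simp add: powr_add[symmetric] s_def) (rule arg_cong[of _ _ "(powr) l"], simp)
      ultimately show ?thesis unfolding vol e_def by (metis (no_types, opaque_lifting) mult.assoc mult.commute times_divide_eq_right)
    qed
    finally have "l powr s \<le> max 0 v / e" using e by (simp add: pos_le_divide_eq mult.commute)
    then have "(l powr s) powr (1 / s) \<le> L" unfolding L_def using s by (intro powr_mono2) auto
    moreover have "(l powr s) powr (1 / s) = l" using l s by (simp add: powr_powr)
    ultimately have lL: "l \<le> L" by simp
    have bd: "norm y \<le> D" if "y \<in> g.body" for y
    proof -
      have "norm y * \<beta> \<le> 2 * g.body_vol / M" using g.norm_le_body_vol[OF that] by (simp add: \<beta>_def)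
      also have "2 * g.body_vol = l ^ DIM('a)" using l by simp
      also have "l ^ DIM('a) / M \<le> L ^ DIM('a) / M"
        using lL l M by (intro divide_right_mono power_mono) auto
      finally have "norm y \<le> L ^ DIM('a) / M / \<beta>" unfolding pos_le_divide_eq[OF \<beta>] .
      then show ?thesis by (simp add: D_def)
    qed
    show "1 / D * norm x \<le> g x"
    proof (cases "x = 0")
      case False
      then have gx: "0 < g x" by (rule g.g_pos)
      have "x /\<^sub>R g x \<in> g.body" using gx by (simp add: g.body_def g.hom)
      from bd[OF this] have "norm x / g x \<le> D" using gx by (simp add: divide_inverse mult.commute)
      then show ?thesis using gx D by (simp add: field_simps)
    qed simp
  qed
qed

subsection \<open>Selection and weak convergence\<close>

lemma support_fun_upper:
  assumes "compact Q" "y \<in> Q" shows "y \<bullet> x \<le> support_fun Q x"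
proof -
  have "bdd_above ((\<lambda>y. y \<bullet> x) ` Q)"
    by (rule compact_imp_bounded[THEN bounded_imp_bdd_above])
      (intro compact_continuous_image assms continuous_intros)
  then show ?thesis unfolding support_fun_def by (rule cSUP_upper[OF assms(2)])
qed

lemma support_fun_attained:
  assumes "compact Q" "Q \<noteq> {}" obtains y where "y \<in> Q" "support_fun Q x = y \<bullet> x"
proof -
  have "continuous_on Q (\<lambda>y. y \<bullet> x)" by (intro continuous_intros)
  from continuous_attains_sup[OF assms this]
  obtain y where y: "y \<in> Q" "\<forall>z\<in>Q. z \<bullet> x \<le> y \<bullet> x" by blast
  have "support_fun Q x = y \<bullet> x"
    unfolding support_fun_def by (rule cSup_eq_maximum) (use y in auto)
  with y show thesis using that by blast
qed

lemma sublinear_gauge_support_fun: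
  fixes Q :: "'a::euclidean_space set"
  assumes Q: "compact Q" "cball 0 r \<subseteq> Q" "Q \<subseteq> cball 0 R" and r: "0 < r"
  shows "sublinear_gauge (support_fun Q) r R"
proof
  have ne: "Q \<noteq> {}" using Q(2) r by (metis centre_in_cball empty_iff less_imp_le subset_iff)
  show "0 < r" by (rule r)
  fix x y :: 'a and t :: real
  obtain z where z: "z \<in> Q" "support_fun Q (x + y) = z \<bullet> (x + y)" using support_fun_attained[OF Q(1) ne] .
  then show "support_fun Q (x + y) \<le> support_fun Q x + support_fun Q y"
    using support_fun_upper[OF Q(1) z(1), of x] support_fun_upper[OF Q(1) z(1), of y] by (simp add: inner_add_right)
  show "support_fun Q (t *\<^sub>R x) = t * support_fun Q x" if t: "0 \<le> t"
  proof (rule antisym)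
    obtain z where z: "z \<in> Q" "support_fun Q (t *\<^sub>R x) = z \<bullet> (t *\<^sub>R x)" using support_fun_attained[OF Q(1) ne] .
    then show "support_fun Q (t *\<^sub>R x) \<le> t * support_fun Q x"
      using mult_left_mono[OF support_fun_upper[OF Q(1) z(1), of x] t] by simp
    obtain w where w: "w \<in> Q" "support_fun Q x = w \<bullet> x" using support_fun_attained[OF Q(1) ne] .
    then show "t * support_fun Q x \<le> support_fun Q (t *\<^sub>R x)"
      using support_fun_upper[OF Q(1) w(1), of "t *\<^sub>R x"] by simp
  qed
  show "r * norm x \<le> support_fun Q x"
  proof (cases "x = 0")
    case True
    have "0 \<in> Q" using Q(2) r by auto
    from support_fun_upper[OF Q(1) this, of x] show ?thesis using True by simp
  next
    case False
    have "r *\<^sub>R sgn x \<in> Q" by (rule subsetD[OF Q(2)]) (use r False in \<open>simp add: norm_sgn\<close>)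
    from support_fun_upper[OF Q(1) this, of x] have "r * (sgn x \<bullet> x) \<le> support_fun Q x" by simp
    moreover have "sgn x \<bullet> x = norm x"
      using False by (simp add: sgn_div_norm power2_norm_eq_inner[symmetric] power2_eq_square)
    ultimately show ?thesis by simp
  qed
  obtain w where w: "w \<in> Q" "support_fun Q x = w \<bullet> x" using support_fun_attained[OF Q(1) ne] .
  have "w \<bullet> x \<le> norm w * norm x" by (rule norm_cauchy_schwarz)
  also have "\<dots> \<le> R * norm x" using Q(3) w by (intro mult_right_mono) auto
  finally show "support_fun Q x \<le> R * norm x" using w by simp
qed

lemma convex_bodies_oD:
  assumes "Q \<in> convex_bodies_o"
  shows "compact Q" "convex Q" "Q \<noteq> {}" "\<exists>r>0. cball 0 r \<subseteq> Q"
proof -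
  show "compact Q" "convex Q" using assms by (auto simp: convex_bodies_o_def)
  have "0 \<in> interior Q" using assms by (simp add: convex_bodies_o_def)
  then show "\<exists>r>0. cball 0 r \<subseteq> Q" by (simp add: mem_interior_cball)
  show "Q \<noteq> {}" using \<open>0 \<in> interior Q\<close> interior_subset by auto
qed

lemma convex_bodies_o_gauge:
  fixes Q :: "'a::euclidean_space set"
  assumes Q: "Q \<in> convex_bodies_o"
  obtains r R where "sublinear_gauge (support_fun Q) r R"
proof -
  obtain r where r: "r > 0" "cball 0 r \<subseteq> Q" using convex_bodies_oD(4)[OF Q] by blast
  obtain R where "\<forall>x\<in>Q. norm x \<le> R" using compact_imp_bounded[OF convex_bodies_oD(1)[OF Q]] by (auto simp: bounded_iff)
  then have "Q \<subseteq> cball 0 R" by auto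
  then show thesis using that sublinear_gauge_support_fun[OF convex_bodies_oD(1)[OF Q] r(2) _ r(1)] by blast
qed

lemma polar_body_eq:
  assumes "compact Q" "Q \<noteq> {}" shows "polar_body Q = {x. support_fun Q x \<le> 1}"
proof (intro set_eqI iffI)
  fix x assume x: "x \<in> polar_body Q"
  obtain y where y: "y \<in> Q" "support_fun Q x = y \<bullet> x" using support_fun_attained[OF assms] .
  have "x \<bullet> y \<le> 1" using x y(1) by (simp add: polar_body_def)
  then show "x \<in> {x. support_fun Q x \<le> 1}" using y(2) by (simp add: inner_commute)
next
  fix x assume x: "x \<in> {x. support_fun Q x \<le> 1}"
  have "x \<bullet> y \<le> 1" if "y \<in> Q" for y
    using support_fun_upper[OF assms(1) that, of x] x by (simp add: inner_commute)
  then show "x \<in> polar_body Q" by (simp add: polar_body_def)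
qed

lemma support_fun_cball: "support_fun (cball 0 1) x = norm (x :: 'a::euclidean_space)"
proof -
  interpret sublinear_gauge "support_fun (cball (0::'a) 1)" 1 1
    by (rule sublinear_gauge_support_fun) auto
  show ?thesis using lower[of x] upper[of x] by simp
qed

lemma cball_in_body_class: "cball 0 1 \<in> body_class G"
proof -
  have "polar_body (cball 0 1) = {x::'a. support_fun (cball 0 1) x \<le> 1}" by (rule polar_body_eq) auto
  also have "\<dots> = cball 0 1" unfolding support_fun_cball by auto
  finally show ?thesis by (auto simp: body_class_def convex_bodies_o_def)
qed

lemma support_fun_Collect:
  fixes g :: "'a::euclidean_space \<Rightarrow> real"
  assumes Q: "Q = {y. \<forall>x. y \<bullet> x \<le> g x}" and at: "\<And>x. \<exists>y\<in>Q. y \<bullet> x = g x"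
  shows "support_fun Q x = g x"
proof -
  obtain y where y: "y \<in> Q" "y \<bullet> x = g x" using at by blast
  have le: "z \<bullet> x \<le> g x" if "z \<in> Q" for z using that by (simp add: Q)
  show ?thesis
    unfolding support_fun_def
  proof (rule cSup_eq_maximum)
    show "g x \<in> (\<lambda>z. z \<bullet> x) ` Q" by (rule rev_image_eqI[OF y(1)]) (rule y(2)[symmetric])
  qed (use le in blast)
qed

text \<open>Blaschke selection, in terms of support functions.\<close>

lemma support_fun_subsequence:
  fixes Qs :: "nat \<Rightarrow> 'a::euclidean_space set"
  assumes Q: "\<And>i. compact (Qs i)" "\<And>i. Qs i \<noteq> {}" and g: "\<And>i. sublinear_gauge (support_fun (Qs i)) m M"
  obtains r Q where "strict_mono (r :: nat \<Rightarrow> nat)" "compact Q" "convex Q" "cball 0 m \<subseteq> Q"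
    "sublinear_gauge (support_fun Q) m M"
    "\<forall>x. (\<lambda>i. support_fun (Qs (r i)) x) \<longlonglongrightarrow> support_fun Q x"
    "uniform_limit (sphere 0 1) (\<lambda>i. support_fun (Qs (r i))) (support_fun Q) sequentially"
proof -
  interpret gi: sublinear_gauge "support_fun (Qs i)" m M for i by (rule g)
  let ?h = "\<lambda>i. support_fun (Qs i)"
  have Mp: "0 < M" by (rule gi.M_pos)
  \<comment> \<open>The support functions are M-Lipschitz and bounded by M on the unit ball, so
    Arzela-Ascoli applies.\<close>
  obtain l r where l: "continuous_on (cball 0 1) l" "strict_mono (r :: nat \<Rightarrow> nat)"
    "\<And>e. 0 < e \<Longrightarrow> \<exists>N. \<forall>n x. n \<ge> N \<and> x \<in> cball (0::'a) 1 \<longrightarrow> norm (?h (r n) x - l x) < e"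
  proof (rule Arzela_Ascoli[of "cball (0::'a) 1" ?h M])
    show "compact (cball (0::'a) 1)" by (rule compact_cball)
    show "norm (?h n x) \<le> M" if "x \<in> cball 0 1" for n x
    proof -
      have "M * norm x \<le> M * 1" using that Mp by (intro mult_left_mono) auto
      then show ?thesis using gi.g_nonneg[of n x] gi.upper[of n x] by simp
    qed
    show "\<exists>d. 0 < d \<and> (\<forall>n y. y \<in> cball 0 1 \<and> norm (x - y) < d \<longrightarrow> norm (?h n x - ?h n y) < e)"
      if "x \<in> cball (0::'a) 1" "0 < e" for x e
    proof (intro exI[of _ "e / M"] conjI allI impI)
      show "0 < e / M" using that Mp by simp
      fix n and y :: 'a assume "y \<in> cball 0 1 \<and> norm (x - y) < e / M"
      then have "M * norm (x - y) < e" using Mp by (simp add: pos_less_divide_eq mult.commute)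
      then show "norm (?h n x - ?h n y) < e" using gi.g_lipschitz[of n x y] by simp
    qed
  qed blast
  have pt: "(\<lambda>i. ?h (r i) x) \<longlonglongrightarrow> l x" if "x \<in> cball 0 1" for x
  proof (rule LIMSEQ_I)
    fix e :: real assume "0 < e"
    from l(3)[OF this] that show "\<exists>N. \<forall>n\<ge>N. norm (?h (r n) x - l x) < e" by blast
  qed
  \<comment> \<open>The uniform limit is given on the unit ball; homogeneity carries it to the whole
    space.\<close>
  define g0 where "g0 x = norm x * l (sgn x)" for x
  have lim: "(\<lambda>i. ?h (r i) x) \<longlonglongrightarrow> g0 x" for x
  proof -
    have "sgn x \<in> cball 0 1" by (simp add: norm_sgn)
    from tendsto_mult_left[OF pt[OF this], of "norm x"]
    have "(\<lambda>i. norm x * ?h (r i) (sgn x)) \<longlonglongrightarrow> g0 x" by (simp add: g0_def)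
    moreover have "norm x * ?h (r i) (sgn x) = ?h (r i) x" for i
    proof -
      have "norm x *\<^sub>R sgn x = x" by (cases "x = 0") (simp_all add: sgn_div_norm)
      then show ?thesis using gi.hom[of "norm x" "r i" "sgn x"] by simp
    qed
    ultimately show ?thesis by simp
  qed
  have g0: "sublinear_gauge g0 m M"
  proof
    show "0 < m" by (rule gi.m_pos)
    show "g0 (x + y) \<le> g0 x + g0 y" for x y
      by (rule LIMSEQ_le[OF lim tendsto_add[OF lim lim]]) (use gi.sub in blast)
    show "g0 (t *\<^sub>R x) = t * g0 x" if "0 \<le> t" for t x
    proof (rule LIMSEQ_unique[OF lim])
      show "(\<lambda>i. ?h (r i) (t *\<^sub>R x)) \<longlonglongrightarrow> t * g0 x"
        unfolding gi.hom[OF that] by (rule tendsto_mult_left[OF lim])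
    qed
    show "m * norm x \<le> g0 x" for x by (rule LIMSEQ_le_const[OF lim]) (use gi.lower in blast)
    show "g0 x \<le> M * norm x" for x by (rule LIMSEQ_le_const2[OF lim]) (use gi.upper in blast)
  qed
  interpret g0: sublinear_gauge g0 m M by (rule g0)
  define Q where "Q = {y. \<forall>x. y \<bullet> x \<le> g0 x}"
  have QM: "Q \<subseteq> cball 0 M"
  proof
    fix y assume "y \<in> Q"
    then have "y \<bullet> y \<le> M * norm y" using g0.upper[of y] by (auto simp: Q_def intro: order_trans)
    then have "norm y * norm y \<le> M * norm y" by (simp add: power2_norm_eq_inner[symmetric] power2_eq_square)
    then show "y \<in> cball 0 M" using Mp by (cases "y = 0") auto
  qed
  have closedQ: "closed Q"
    unfolding Q_def by (intro closed_Collect_all closed_Collect_le continuous_intros)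
  have cQ: "compact Q"
    using closedQ QM bounded_subset[OF bounded_cball] by (simp add: compact_eq_bounded_closed)
  have convQ: "convex Q"
    unfolding convex_def
  proof (intro ballI allI impI)
    fix x y and u v :: real assume xy: "x \<in> Q" "y \<in> Q" and uv: "0 \<le> u" "0 \<le> v" "u + v = 1"
    have "(u *\<^sub>R x + v *\<^sub>R y) \<bullet> z \<le> g0 z" for z
    proof -
      have "(u *\<^sub>R x + v *\<^sub>R y) \<bullet> z = u * (x \<bullet> z) + v * (y \<bullet> z)" by (simp add: inner_add_left)
      also have "\<dots> \<le> u * g0 z + v * g0 z" using xy uv by (intro add_mono mult_left_mono) (auto simp: Q_def)
      also have "\<dots> = g0 z" using uv by (simp flip: distrib_right)
      finally show ?thesis .
    qed
    then show "u *\<^sub>R x + v *\<^sub>R y \<in> Q" by (simp add: Q_def)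
  qed
  have mQ: "cball 0 m \<subseteq> Q"
  proof
    fix y :: 'a assume "y \<in> cball 0 m"
    then have ny: "norm y \<le> m" by simp
    have "y \<bullet> x \<le> g0 x" for x
    proof -
      have "y \<bullet> x \<le> norm y * norm x" by (rule norm_cauchy_schwarz)
      also have "\<dots> \<le> m * norm x" using ny by (intro mult_right_mono) auto
      also have "\<dots> \<le> g0 x" by (rule g0.lower)
      finally show ?thesis .
    qed
    then show "y \<in> Q" by (simp add: Q_def)
  qed
  \<comment> \<open>Maximisers \<open>y i\<close> of the approximating bodies in direction x
    accumulate at a point w of Q that attains g0 x, so g0 is indeed the support function of
    Q.\<close>
  have at: "\<exists>y\<in>Q. y \<bullet> x = g0 x" for x
  proof -
    have "\<exists>y. y \<in> Qs (r i) \<and> ?h (r i) x = y \<bullet> x" for i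
      using support_fun_attained[OF Q(1) Q(2)] by blast
    then obtain y where y: "\<And>i. y i \<in> Qs (r i)" "\<And>i. ?h (r i) x = y i \<bullet> x" by metis
    have yz: "y i \<bullet> z \<le> ?h (r i) z" for i z by (rule support_fun_upper[OF Q(1) y(1)])
    have "y i \<in> cball 0 M" for i
    proof -
      have "y i \<bullet> y i \<le> M * norm (y i)" using yz[of i "y i"] gi.upper[of "r i" "y i"] by linarith
      then have "norm (y i) * norm (y i) \<le> M * norm (y i)" by (simp add: power2_norm_eq_inner[symmetric] power2_eq_square)
      then show ?thesis using Mp by (cases "y i = 0") auto
    qed
    then obtain w s where w: "strict_mono (s :: nat \<Rightarrow> nat)" "(y \<circ> s) \<longlonglongrightarrow> w"
      using compact_cball[of "0::'a" M] unfolding compact_def by metis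
    have lim': "(\<lambda>i. ?h (r (s i)) z) \<longlonglongrightarrow> g0 z" for z
      using LIMSEQ_subseq_LIMSEQ[OF lim w(1)] by (simp add: o_def)
    have yw: "(\<lambda>i. y (s i) \<bullet> z) \<longlonglongrightarrow> w \<bullet> z" for z
      using w(2) by (intro tendsto_inner tendsto_const) (simp add: o_def)
    have "w \<in> Q"
    proof -
      have "w \<bullet> z \<le> g0 z" for z by (rule LIMSEQ_le[OF yw lim']) (use yz in blast)
      then show ?thesis by (simp add: Q_def)
    qed
    moreover have "w \<bullet> x = g0 x"
      using LIMSEQ_unique[OF yw[of x]] lim'[of x] by (simp add: y(2))
    ultimately show ?thesis by blast
  qed
  have hQ: "support_fun Q = g0" using support_fun_Collect[OF Q_def at] by blast
  have "uniform_limit (sphere 0 1) (\<lambda>i. ?h (r i)) (support_fun Q) sequentially"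
    unfolding uniform_limit_sequentially_iff hQ
  proof (intro allI impI)
    fix e :: real assume "0 < e"
    from l(3)[OF this] obtain N where N: "\<And>n x. n \<ge> N \<Longrightarrow> x \<in> cball (0::'a) 1 \<Longrightarrow> norm (?h (r n) x - l x) < e" by blast
    have "l x = g0 x" if "x \<in> cball 0 1" for x using LIMSEQ_unique[OF pt[OF that] lim] .
    with N show "\<exists>N. \<forall>n\<ge>N. \<forall>x\<in>sphere 0 1. dist (?h (r n) x) (g0 x) < e"
      by (intro exI[of _ N]) (auto simp: dist_norm)
  qed
  then show thesis using that[of r Q] l(2) cQ convQ mQ g0 lim hQ by simp
qed

section \<open>Integrals against weakly convergent measures\<close>

lemma integrable_continuous_on_sphere:
  fixes f :: "'a::euclidean_space \<Rightarrow> real"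
  assumes \<mu>: "sets \<mu> = sets borel_sphere" "finite_measure \<mu>" and f: "continuous_on (sphere 0 1) f"
  shows "integrable \<mu> f"
proof -
  have sp: "space \<mu> = sphere 0 1" using sets_eq_imp_space_eq[OF \<mu>(1)] by (simp add: space_restrict_space)
  have "f \<in> borel_measurable borel_sphere" by (rule borel_measurable_continuous_on_restrict[OF f])
  then have fm: "f \<in> borel_measurable \<mu>" using measurable_cong_sets[OF \<mu>(1) refl] by blast
  have "bounded (f ` sphere 0 1)"
    by (intro compact_imp_bounded compact_continuous_image f compact_sphere)
  then obtain B where "\<forall>y\<in>f ` sphere 0 1. norm y \<le> B" unfolding bounded_iff ..
  then show ?thesis by (intro finite_measure.integrable_const_bound[OF \<mu>(2) _ fm, of B]) (auto simp: sp)
qed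

definition good_measure :: "'a::euclidean_space measure \<Rightarrow> bool" where
  "good_measure \<mu> \<longleftrightarrow> nonzero_finite_sphere_measure \<mu> \<and> not_concentrated_on_hemisphere \<mu>"

lemma good_measureD:
  assumes "good_measure \<mu>"
  shows "sets \<mu> = sets borel_sphere" "finite_measure \<mu>" "space \<mu> = sphere 0 1" "0 < measure \<mu> (sphere 0 1)"
    "measure \<mu> (space \<mu>) = measure \<mu> (sphere 0 1)"
proof -
  show s: "sets \<mu> = sets borel_sphere" and f: "finite_measure \<mu>"
    using assms by (auto simp: good_measure_def nonzero_finite_sphere_measure_def)
  show sp: "space \<mu> = sphere 0 1" using sets_eq_imp_space_eq[OF s] by (simp add: space_restrict_space)
  then show "measure \<mu> (space \<mu>) = measure \<mu> (sphere 0 1)" by simp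
  have "emeasure \<mu> (sphere 0 1) \<noteq> 0" using assms by (auto simp: good_measure_def nonzero_finite_sphere_measure_def)
  then show "0 < measure \<mu> (sphere 0 1)"
    using finite_measure.emeasure_eq_measure[OF f, of "sphere 0 1"] by (simp add: zero_less_measure_iff)
qed

lemma weakly_converges_subseq:
  "weakly_converges \<mu>s \<mu> \<Longrightarrow> filterlim r sequentially sequentially \<Longrightarrow> weakly_converges (\<lambda>i. \<mu>s (r i)) \<mu>"
  unfolding weakly_converges_def using filterlim_compose by fast

lemma weakly_converges_const: "weakly_converges (\<lambda>_. \<mu>) \<mu>"
  by (simp add: weakly_converges_def)

lemma weakly_converges_mass:
  assumes w: "weakly_converges \<mu>s \<mu>" and good: "\<And>i. good_measure (\<mu>s i)" "good_measure \<mu>"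
  shows "(\<lambda>i. measure (\<mu>s i) (sphere 0 1)) \<longlonglongrightarrow> measure \<mu> (sphere 0 1)"
proof -
  have "(\<lambda>i. \<integral>u. (1::real) \<partial>\<mu>s i) \<longlonglongrightarrow> (\<integral>u. (1::real) \<partial>\<mu>)"
    using w unfolding weakly_converges_def by (elim allE[of _ "\<lambda>_. 1"]) simp
  moreover have "(\<integral>u. (1::real) \<partial>\<nu>) = measure \<nu> (sphere 0 1)" if "good_measure \<nu>" for \<nu> :: "'a measure"
    using good_measureD(5)[OF that] by simp
  ultimately show ?thesis using good by simp
qed

text \<open>Testing with the constant 1 makes the total masses converge, so they are bounded by some
  W. The uniform error, multiplied by W, vanishes, and the fixed limit function is handled by weak
  convergence.\<close>

lemma weakly_converges_uniform:
  assumes w: "weakly_converges \<mu>s \<mu>" and good: "\<And>i. good_measure (\<mu>s i)" "good_measure \<mu>"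
    and h: "\<And>i. continuous_on (sphere 0 1) (h i)" "continuous_on (sphere 0 1) f"
    and unif: "uniform_limit (sphere 0 1) h f sequentially"
  shows "(\<lambda>i. \<integral>u. h i u \<partial>\<mu>s i) \<longlonglongrightarrow> (\<integral>u. (f u :: real) \<partial>\<mu>)"
proof -
  note mass = weakly_converges_mass[OF w good]
  obtain W where W: "\<And>i. measure (\<mu>s i) (sphere 0 1) \<le> W"
    using Bseq_def[THEN iffD1, OF convergent_imp_Bseq[OF convergentI[OF mass]]] by (auto simp: abs_le_iff)
  have W0: "0 < W" using W[of 0] good_measureD(4)[OF good(1), of 0] by linarith
  have "(\<lambda>i. (\<integral>u. h i u \<partial>\<mu>s i) - (\<integral>u. f u \<partial>\<mu>s i)) \<longlonglongrightarrow> 0"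
  proof (rule LIMSEQ_I)
    fix e :: real assume e: "0 < e"
    then obtain N where N: "\<And>i u. i \<ge> N \<Longrightarrow> u \<in> sphere 0 1 \<Longrightarrow> dist (h i u) (f u) < e / (2 * W)"
      using unif W0 unfolding uniform_limit_sequentially_iff by (metis divide_pos_pos mult_pos_pos zero_less_numeral)
    show "\<exists>N. \<forall>i\<ge>N. norm ((\<integral>u. h i u \<partial>\<mu>s i) - (\<integral>u. f u \<partial>\<mu>s i) - 0) < e"
    proof (intro exI allI impI)
      fix i assume i: "N \<le> i"
      note gm = good_measureD[OF good(1)[of i]]
      interpret finite_measure "\<mu>s i" by (rule gm(2))
      have ih: "integrable (\<mu>s i) (h i)" "integrable (\<mu>s i) f"
        by (intro integrable_continuous_on_sphere[OF gm(1,2)] h)+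
      have "norm ((\<integral>u. h i u \<partial>\<mu>s i) - (\<integral>u. f u \<partial>\<mu>s i)) = norm (\<integral>u. h i u - f u \<partial>\<mu>s i)"
        by (simp add: Bochner_Integration.integral_diff[OF ih])
      also have "\<dots> \<le> (\<integral>u. norm (h i u - f u) \<partial>\<mu>s i)" by (rule integral_norm_bound)
      also have "\<dots> \<le> (\<integral>u. e / (2 * W) \<partial>\<mu>s i)"
      proof (rule integral_mono)
        show "integrable (\<mu>s i) (\<lambda>u. norm (h i u - f u))" using ih by simp
        show "norm (h i u - f u) \<le> e / (2 * W)" if "u \<in> space (\<mu>s i)" for u
          using N[OF i, of u] that gm(3) by (simp add: dist_norm)
      qed simp
      also have "\<dots> = measure (\<mu>s i) (sphere 0 1) * (e / (2 * W))" using gm(5) by simp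
      also have "\<dots> \<le> W * (e / (2 * W))" using W[of i] e W0 by (intro mult_right_mono) auto
      also have "\<dots> < e" using e W0 by simp
      finally show "norm ((\<integral>u. h i u \<partial>\<mu>s i) - (\<integral>u. f u \<partial>\<mu>s i) - 0) < e" by simp
    qed
  qed
  moreover have "(\<lambda>i. \<integral>u. f u \<partial>\<mu>s i) \<longlonglongrightarrow> (\<integral>u. f u \<partial>\<mu>)"
    using w h(2) unfolding weakly_converges_def by blast
  ultimately show ?thesis using tendsto_add by fastforce
qed

subsection \<open>The minimisation problems\<close>

locale orlicz_setting =
  fixes \<phi> :: "real \<Rightarrow> real" and G :: "real \<Rightarrow> 'a::euclidean_space \<Rightarrow> real" and \<kappa> q :: real
  assumes dim: "DIM('a) \<ge> 2" and phi: "orlicz_fun \<phi>"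
    and G_cont: "continuous_on ({0<..} \<times> sphere 0 1) (\<lambda>(t, u). G t u)"
    and G_pos: "\<And>t u. 0 < t \<Longrightarrow> u \<in> sphere 0 1 \<Longrightarrow> 0 < G t u"
    and q: "1 - real DIM('a) < q" "q < 0"
    and G_inf: "(INF (t, u) \<in> {1..} \<times> sphere 0 1. G t u / t powr q) > 0"
    and \<kappa>_pos: "0 < \<kappa>"
    and \<kappa>: "\<And>(e::'a) E. norm e = 1 \<Longrightarrow> E \<in> sets borel \<Longrightarrow>
       emeasure (hplane_product e) E = ennreal \<kappa> * emeasure lborel E"
begin

lemma gauge_areaI: "sublinear_gauge (g :: 'a \<Rightarrow> real) m M \<Longrightarrow> gauge_area g m M \<kappa>"
  by (intro gauge_area.intro gauge_area_axioms.intro dim \<kappa>_pos \<kappa>)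

lemma body_class_convex_bodies: "Q \<in> body_class G \<Longrightarrow> Q \<in> convex_bodies_o"
  by (simp add: body_class_def)

text \<open>R is the upper gauge constant, and the prescribed general volume supplies one inner
  radius m for all members. This keeps the origin in the interior of the limit, and continuity of
  the general volume keeps the limit in the class.\<close>

lemma body_class_compact:
  assumes Qs: "\<And>i. Qs i \<in> body_class G" "\<And>i. Qs i \<subseteq> cball 0 R"
  obtains r Q where "strict_mono (r :: nat \<Rightarrow> nat)" "Q \<in> body_class G"
    "uniform_limit (sphere 0 1) (\<lambda>i. support_fun (Qs (r i))) (support_fun Q) sequentially"
proof -
  let ?v = "general_volume G (cball 0 1)"
  have cb: "Qs i \<in> convex_bodies_o" for i by (rule body_class_convex_bodies[OF Qs(1)])
  obtain m where m: "0 < m"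
    "\<And>g r x. gauge_area (g :: 'a \<Rightarrow> real) r R \<kappa> \<Longrightarrow> general_volume G {x. g x \<le> 1} \<le> ?v \<Longrightarrow> m * norm x \<le> g x"
    using gauge_uniform_lower_bound[OF G_cont G_pos G_inf q] by blast
  have vol: "general_volume G {x. support_fun (Qs i) x \<le> 1} = ?v" for i
    using Qs(1)[of i] polar_body_eq[OF convex_bodies_oD(1,3)[OF cb[of i]]] by (simp add: body_class_def)
  have g: "sublinear_gauge (support_fun (Qs i)) m R" for i
  proof -
    obtain r where r: "r > 0" "cball 0 r \<subseteq> Qs i" using convex_bodies_oD(4)[OF cb] by blast
    have s: "sublinear_gauge (support_fun (Qs i)) r R"
      by (rule sublinear_gauge_support_fun[OF convex_bodies_oD(1)[OF cb] r(2) Qs(2) r(1)])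
    interpret s: sublinear_gauge "support_fun (Qs i)" r R by (rule s)
    show ?thesis
    proof
      show "m * norm x \<le> support_fun (Qs i) x" for x
        by (rule m(2)[OF gauge_areaI[OF s]]) (simp add: vol)
      show "0 < m" by (rule m(1))
      show "support_fun (Qs i) (x + y) \<le> support_fun (Qs i) x + support_fun (Qs i) y" for x y by (rule s.sub)
      show "support_fun (Qs i) (t *\<^sub>R x) = t * support_fun (Qs i) x" if "0 \<le> t" for t x by (rule s.hom[OF that])
      show "support_fun (Qs i) x \<le> R * norm x" for x by (rule s.upper)
    qed
  qed
  obtain r Q where Q: "strict_mono (r :: nat \<Rightarrow> nat)" "compact Q" "convex Q" "cball 0 m \<subseteq> Q"
    "sublinear_gauge (support_fun Q) m R"
    "\<forall>x. (\<lambda>i. support_fun (Qs (r i)) x) \<longlonglongrightarrow> support_fun Q x"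
    "uniform_limit (sphere 0 1) (\<lambda>i. support_fun (Qs (r i))) (support_fun Q) sequentially"
    using support_fun_subsequence[OF convex_bodies_oD(1)[OF cb] convex_bodies_oD(3)[OF cb] g] .
  have "(0::'a) \<in> interior Q" unfolding mem_interior_cball using m(1) Q(4) by blast
  then have Qcb: "Q \<in> convex_bodies_o" using Q(2,3) by (simp add: convex_bodies_o_def)
  have "(\<lambda>i. general_volume G {x. support_fun (Qs (r i)) x \<le> 1}) \<longlonglongrightarrow> general_volume G {x. support_fun Q x \<le> 1}"
    by (rule general_volume_LIMSEQ[OF gauge_areaI[OF g] gauge_areaI[OF Q(5)] spec[OF Q(6)] G_cont])
  then have "general_volume G {x. support_fun Q x \<le> 1} = ?v" unfolding vol by (simp add: LIMSEQ_const_iff)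
  then have "Q \<in> body_class G"
    using Qcb polar_body_eq[OF convex_bodies_oD(1,3)[OF Qcb]] by (simp add: body_class_def)
  then show thesis using that[OF Q(1) _ Q(7)] by blast
qed

section \<open>Continuity and coercivity of the integral functional\<close>

lemma phi_less: "0 < s \<Longrightarrow> s < t \<Longrightarrow> \<phi> s < \<phi> t"
  using phi unfolding orlicz_fun_def strict_mono_on_def by auto

lemma phi_mono: "0 < s \<Longrightarrow> s \<le> t \<Longrightarrow> \<phi> s \<le> \<phi> t"
  using phi_less[of s t] by (cases "s = t") auto

lemma phi_pos: "0 < t \<Longrightarrow> 0 < \<phi> t" and phi_1: "\<phi> 1 = 1"
  and phi_cont: "continuous_on {0<..} \<phi>" and phi_top: "filterlim \<phi> at_top at_top"
  using phi by (auto simp: orlicz_fun_def)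

text \<open>The scale l serves both problems: l = 1 gives the integral functional, variable l the
  Orlicz norm.\<close>

definition ophi :: "real \<Rightarrow> 'a set \<Rightarrow> 'a \<Rightarrow> real" where
  "ophi l Q u = \<phi> (support_fun Q u / l)"

lemma support_fun_sphere_bounds:
  assumes Q: "Q \<in> convex_bodies_o"
  obtains a b where "0 < a" "a \<le> b" "\<forall>u::'a \<in> sphere 0 1. a \<le> support_fun Q u \<and> support_fun Q u \<le> b"
proof -
  obtain r R where "sublinear_gauge (support_fun Q) r R" using convex_bodies_o_gauge[OF Q] .
  then interpret sublinear_gauge "support_fun Q" r R .
  show thesis
  proof (rule that[OF m_pos M_ge_m], intro ballI)
    fix u :: 'a assume "u \<in> sphere 0 1"
    then show "r \<le> support_fun Q u \<and> support_fun Q u \<le> R" using lower[of u] upper[of u] by simp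
  qed
qed

lemma support_fun_pos:
  assumes Q: "Q \<in> convex_bodies_o" and u: "u \<in> sphere 0 1" shows "0 < support_fun Q (u::'a)"
proof -
  obtain a b where "0 < a" "a \<le> b" "\<forall>u::'a \<in> sphere 0 1. a \<le> support_fun Q u \<and> support_fun Q u \<le> b"
    using support_fun_sphere_bounds[OF Q] .
  from bspec[OF this(3) u] this(1) show ?thesis by linarith
qed

lemma continuous_on_support_fun:
  assumes Q: "Q \<in> convex_bodies_o" shows "continuous_on S (support_fun (Q :: 'a set))"
proof -
  obtain r R where "sublinear_gauge (support_fun Q) r R" using convex_bodies_o_gauge[OF Q] .
  then show ?thesis by (rule sublinear_gauge.continuous_on_g)
qed

lemma continuous_on_ophi:
  assumes Q: "Q \<in> convex_bodies_o" and l: "0 < l"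
  shows "continuous_on (sphere 0 1) (ophi l Q)"
proof -
  have "continuous_on (sphere 0 1) (\<lambda>u::'a. support_fun Q u / l)"
    by (intro continuous_intros continuous_on_support_fun[OF Q]) (use l in auto)
  then show ?thesis
    unfolding ophi_def using support_fun_pos[OF Q] l by (intro continuous_on_compose2[OF phi_cont]) auto
qed

lemma ophi_pos: "Q \<in> convex_bodies_o \<Longrightarrow> 0 < l \<Longrightarrow> u \<in> sphere 0 1 \<Longrightarrow> 0 < ophi l Q u"
  unfolding ophi_def using support_fun_pos by (intro phi_pos) auto

lemma integrable_ophi:
  assumes "good_measure \<mu>" "Q \<in> convex_bodies_o" "0 < l"
  shows "integrable \<mu> (ophi l Q)"
  by (rule integrable_continuous_on_sphere[OF good_measureD(1,2)[OF assms(1)] continuous_on_ophi[OF assms(2,3)]])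

lemma integral_ophi_nonneg:
  assumes "good_measure \<mu>" "Q \<in> convex_bodies_o" "0 < l"
  shows "0 \<le> (\<integral>u. ophi l Q u \<partial>\<mu>)"
proof (rule integral_nonneg_AE, rule AE_I2)
  fix u assume "u \<in> space \<mu>"
  then show "0 \<le> ophi l Q u" using ophi_pos[OF assms(2,3), of u] good_measureD(3)[OF assms(1)] by simp
qed

lemma ophi_uniform_limit:
  assumes Qs: "\<And>i. Qs i \<in> convex_bodies_o" and Q: "Q \<in> convex_bodies_o" and l: "0 < l"
    and unif: "uniform_limit (sphere 0 1) (\<lambda>i. support_fun (Qs i)) (support_fun Q) sequentially"
  shows "uniform_limit (sphere 0 1) (\<lambda>i. ophi l (Qs i)) (ophi l Q) sequentially"
proof -
  obtain a b where ab: "0 < a" "a \<le> b" "\<forall>u::'a \<in> sphere 0 1. a \<le> support_fun Q u \<and> support_fun Q u \<le> b"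
    using support_fun_sphere_bounds[OF Q] .
  \<comment> \<open>A compact interval inside the open half-line containing the scaled values of
    both support functions once these differ by less than a/2; \<phi> is uniformly continuous
    there.\<close>
  define I where "I = {a / 2 / l .. (b + a) / l}"
  have I0: "I \<subseteq> {0<..}" using ab(1) l by (auto simp: I_def intro: less_le_trans[of 0 "a / 2 / l"])
  have uc: "uniformly_continuous_on I \<phi>"
    unfolding I_def by (rule compact_uniformly_continuous[OF continuous_on_subset[OF phi_cont I0[unfolded I_def]] compact_Icc])
  show ?thesis
    unfolding uniform_limit_sequentially_iff
  proof (intro allI impI)
    fix e :: real assume "0 < e"
    then obtain d where d: "0 < d" "\<And>s t. s \<in> I \<Longrightarrow> t \<in> I \<Longrightarrow> dist s t < d \<Longrightarrow> dist (\<phi> s) (\<phi> t) < e"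
      using uc unfolding uniformly_continuous_on_def by metis
    have "0 < min (a / 2) (d * l)" using ab d l by simp
    then obtain N where N: "\<And>n u. n \<ge> N \<Longrightarrow> u \<in> sphere 0 1 \<Longrightarrow> dist (support_fun (Qs n) u) (support_fun Q u) < min (a / 2) (d * l)"
      using unif unfolding uniform_limit_sequentially_iff by blast
    show "\<exists>N. \<forall>n\<ge>N. \<forall>u\<in>sphere 0 1. dist (ophi l (Qs n) u) (ophi l Q u) < e"
    proof (intro exI allI impI ballI)
      fix n and u :: 'a assume n: "N \<le> n" and u: "u \<in> sphere 0 1"
      have 1: "\<bar>support_fun (Qs n) u - support_fun Q u\<bar> < a / 2" "\<bar>support_fun (Qs n) u - support_fun Q u\<bar> < d * l"
        using N[OF n u] by (auto simp: dist_real_def)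
      have 2: "a \<le> support_fun Q u" "support_fun Q u \<le> b" using bspec[OF ab(3) u] by auto
      have "a / 2 \<le> support_fun (Qs n) u" "support_fun (Qs n) u \<le> b + a" "a / 2 \<le> support_fun Q u" "support_fun Q u \<le> b + a"
        using 1(1) 2 ab(1) by linarith+
      moreover have "t / l \<in> I" if "a / 2 \<le> t" "t \<le> b + a" for t
        unfolding I_def atLeastAtMost_iff using that l by (intro conjI divide_right_mono) auto
      ultimately have "support_fun (Qs n) u / l \<in> I" "support_fun Q u / l \<in> I" by blast+
      moreover have "dist (support_fun (Qs n) u / l) (support_fun Q u / l) < d"
      proof -
        have "dist (support_fun (Qs n) u / l) (support_fun Q u / l) = \<bar>support_fun (Qs n) u - support_fun Q u\<bar> / l"
          using l by (simp add: dist_real_def flip: diff_divide_distrib)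
        then show ?thesis using 1(2) l by (simp add: pos_divide_less_eq)
      qed
      ultimately show "dist (ophi l (Qs n) u) (ophi l Q u) < e" unfolding ophi_def by (rule d(2))
    qed
  qed
qed

lemma integral_ophi_LIMSEQ:
  assumes w: "weakly_converges \<mu>s \<mu>" and good: "\<And>i. good_measure (\<mu>s i)" "good_measure \<mu>"
    and Qs: "\<And>i. Qs i \<in> convex_bodies_o" and Q: "Q \<in> convex_bodies_o" and l: "0 < l"
    and unif: "uniform_limit (sphere 0 1) (\<lambda>i. support_fun (Qs i)) (support_fun Q) sequentially"
  shows "(\<lambda>i. \<integral>u. ophi l (Qs i) u \<partial>\<mu>s i) \<longlonglongrightarrow> (\<integral>u. ophi l Q u \<partial>\<mu>)"
  by (rule weakly_converges_uniform[OF w good continuous_on_ophi[OF Qs l] continuous_on_ophi[OF Q l]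
        ophi_uniform_limit[OF Qs Q l unif]])

text \<open>The positive part of u . v is a continuous test function that is positive exactly on the
  open hemisphere of v, so the hemisphere condition becomes positivity of an integral that behaves
  well under weak convergence and varying v.\<close>

lemma integral_positive_part_pos:
  fixes v :: 'a
  assumes good: "good_measure \<mu>" and v: "v \<in> sphere 0 1"
  shows "0 < (\<integral>u. max 0 (u \<bullet> v) \<partial>\<mu>)"
proof -
  note gm = good_measureD[OF good]
  have c: "continuous_on (sphere 0 1) (\<lambda>u::'a. max 0 (u \<bullet> v))" by (intro continuous_intros)
  have int: "integrable \<mu> (\<lambda>u. max 0 (u \<bullet> v))" by (rule integrable_continuous_on_sphere[OF gm(1,2) c])
  have "(\<integral>u. max 0 (u \<bullet> v) \<partial>\<mu>) \<noteq> 0"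
  proof
    assume "(\<integral>u. max 0 (u \<bullet> v) \<partial>\<mu>) = 0"
    then have "AE u in \<mu>. max 0 (u \<bullet> v) = 0"
      using integral_nonneg_eq_0_iff_AE[OF int] by simp
    then have "AE u in \<mu>. \<not> (u \<bullet> v > 0)" by eventually_elim (simp add: max_def split: if_splits)
    moreover have "{u \<in> sphere 0 1. u \<bullet> v > 0} \<in> sets \<mu>"
    proof -
      have eq: "{u \<in> sphere 0 1. u \<bullet> v > 0} = sphere 0 1 \<inter> {u. u \<bullet> v > 0}" by auto
      have "{u. u \<bullet> v > 0} \<in> sets borel" by (intro borel_open open_Collect_less continuous_intros)
      then have "sphere 0 1 \<inter> {u. u \<bullet> v > 0} \<in> sets (borel_sphere :: 'a measure)"
        by (subst sets_restrict_space) blast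
      then show ?thesis unfolding gm(1) eq .
    qed
    ultimately have "emeasure \<mu> {u \<in> sphere 0 1. u \<bullet> v > 0} = 0"
      using AE_iff_measurable[of "{u \<in> sphere 0 1. u \<bullet> v > 0}" \<mu> "\<lambda>u. \<not> (u \<bullet> v > 0)"] gm(3) by simp
    moreover have "emeasure \<mu> {u \<in> sphere 0 1. u \<bullet> v > 0} > 0"
      using good v by (simp add: good_measure_def not_concentrated_on_hemisphere_def)
    ultimately show False by simp
  qed
  moreover have "0 \<le> (\<integral>u. max 0 (u \<bullet> v) \<partial>\<mu>)" by (rule integral_nonneg_AE) simp
  ultimately show ?thesis by linarith
qed

text \<open>A body containing \<rho> v has support function at least \<rho> (u . v). Where u . v >
  \<delta> this bounds the integrand below by the value of \<phi> at \<rho> \<delta> / l; the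
  continuous function max 0 (u . v) - \<delta> is at most 1 there and nonpositive elsewhere, so it
  can replace the indicator.\<close>

lemma integral_ophi_ge:
  assumes good: "good_measure \<mu>" and Q: "Q \<in> convex_bodies_o" and l: "0 < l" and \<delta>: "0 < \<delta>"
    and v: "v \<in> sphere 0 1" and \<rho>: "0 < \<rho>" "\<rho> *\<^sub>R v \<in> Q"
  shows "\<phi> (\<rho> * \<delta> / l) * ((\<integral>u. max 0 (u \<bullet> v) \<partial>\<mu>) - \<delta> * measure \<mu> (sphere 0 1)) \<le> (\<integral>u. ophi l Q u \<partial>\<mu>)"
proof -
  note gm = good_measureD[OF good]
  interpret finite_measure \<mu> by (rule gm(2))
  have "continuous_on (sphere 0 1) (\<lambda>u::'a. max 0 (u \<bullet> v))" by (intro continuous_intros)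
  then have int: "integrable \<mu> (\<lambda>u. max 0 (u \<bullet> v))" by (rule integrable_continuous_on_sphere[OF gm(1,2)])
  let ?p = "\<phi> (\<rho> * \<delta> / l)"
  have p: "0 < ?p" using \<rho> \<delta> l by (intro phi_pos) simp
  have "?p * ((\<integral>u. max 0 (u \<bullet> v) \<partial>\<mu>) - \<delta> * measure \<mu> (sphere 0 1)) = (\<integral>u. ?p * (max 0 (u \<bullet> v) - \<delta>) \<partial>\<mu>)"
    using gm(5) by (simp add: Bochner_Integration.integral_diff[OF int] mult.commute)
  also have "\<dots> \<le> (\<integral>u. ophi l Q u \<partial>\<mu>)"
  proof (rule integral_mono)
    show "integrable \<mu> (\<lambda>u. ?p * (max 0 (u \<bullet> v) - \<delta>))" using int by simp
    show "integrable \<mu> (ophi l Q)" by (rule integrable_ophi[OF good Q l])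
    fix u assume "u \<in> space \<mu>"
    then have u: "u \<in> sphere 0 1" using gm(3) by simp
    show "?p * (max 0 (u \<bullet> v) - \<delta>) \<le> ophi l Q u"
    proof (cases "u \<bullet> v \<le> \<delta>")
      case True
      then have "?p * (max 0 (u \<bullet> v) - \<delta>) \<le> 0" using p \<delta> by (intro mult_nonneg_nonpos) auto
      then show ?thesis using ophi_pos[OF Q l u] by linarith
    next
      case False
      have "u \<bullet> v \<le> 1" using norm_cauchy_schwarz[of u v] u v by simp
      then have "?p * (max 0 (u \<bullet> v) - \<delta>) \<le> ?p * 1" using p \<delta> False by (intro mult_left_mono) auto
      also have "?p \<le> ophi l Q u"
        unfolding ophi_def
      proof (rule phi_mono)
        show "0 < \<rho> * \<delta> / l" using \<rho> \<delta> l by simp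
        have "\<rho> * \<delta> \<le> \<rho> * (u \<bullet> v)" using False \<rho> by (intro mult_left_mono) auto
        also have "\<dots> = (\<rho> *\<^sub>R v) \<bullet> u" by (simp add: inner_commute)
        also have "\<dots> \<le> support_fun Q u" by (rule support_fun_upper[OF convex_bodies_oD(1)[OF Q] \<rho>(2)])
        finally show "\<rho> * \<delta> / l \<le> support_fun Q u / l" using l by (intro divide_right_mono) auto
      qed
      finally show ?thesis by simp
    qed
  qed
  finally show ?thesis .
qed

text \<open>If the bodies were unbounded, their farthest points would have norms tending to infinity
  along indices whose directions converge to some v0. The lower bound
  \<open>integral_ophi_ge\<close> then has one factor with positive limit, because \<mu> charges the
  hemisphere of v0, and one factor \<phi> tending to infinity.\<close>

lemma uniformly_bounded:
  assumes w: "weakly_converges \<mu>s \<mu>" and good: "\<And>i. good_measure (\<mu>s i)" "good_measure \<mu>"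
    and Qs: "\<And>i. Qs i \<in> convex_bodies_o" and l: "0 < l"
    and C: "\<And>i. (\<integral>u. ophi l (Qs i) u \<partial>\<mu>s i) \<le> C"
  shows "\<exists>R. \<forall>i. Qs i \<subseteq> cball 0 R"
proof (rule ccontr)
  assume unb: "\<not> ?thesis"
  have "\<exists>y\<in>Qs i. \<forall>z\<in>Qs i. norm z \<le> norm y" for i
    by (rule continuous_attains_sup[OF convex_bodies_oD(1,3)[OF Qs]]) (intro continuous_intros)
  then obtain y where y: "\<And>i. y i \<in> Qs i" "\<And>i z. z \<in> Qs i \<Longrightarrow> norm z \<le> norm (y i)" by metis
  \<comment> \<open>The sum of the first norms forces the chosen index beyond N, so that the indices
    tend to infinity and the measures along them still converge to \<mu>.\<close>
  have "\<exists>j. real N + (\<Sum>i\<le>N. norm (y i)) < norm (y j)" for N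
  proof (rule ccontr)
    assume "\<not> ?thesis"
    then have "norm (y j) \<le> real N + (\<Sum>i\<le>N. norm (y i))" for j by (simp add: not_less)
    then have "Qs j \<subseteq> cball 0 (real N + (\<Sum>i\<le>N. norm (y i)))" for j using y(2) by (force intro: order_trans)
    then show False using unb by blast
  qed
  then obtain j where j: "\<And>N. real N + (\<Sum>i\<le>N. norm (y i)) < norm (y (j N))" by metis
  have jN: "N < j N" for N
  proof (rule ccontr)
    assume "\<not> N < j N"
    then have "norm (y (j N)) \<le> (\<Sum>i\<le>N. norm (y i))" by (intro member_le_sum) auto
    then show False using j[of N] by simp
  qed
  have \<rho>N: "real N < norm (y (j N))" for N
    using j[of N] sum_nonneg[of "{..N}" "\<lambda>i. norm (y i)"] by simp
  have y0: "0 < norm (y (j N))" for N using \<rho>N[of N] by (meson le_less_trans of_nat_0_le_iff)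
  define v where "v N = sgn (y (j N))" for N
  have vS: "v N \<in> sphere 0 1" for N using y0[of N] by (simp add: v_def norm_sgn)
  obtain v0 s where s: "v0 \<in> sphere 0 1" "strict_mono (s :: nat \<Rightarrow> nat)" "(v \<circ> s) \<longlonglongrightarrow> v0"
    using compact_sphere[of "0::'a" 1] vS unfolding compact_def by metis
  define J where "J i = j (s i)" for i
  have Jge: "i \<le> J i" for i using jN[of "s i"] seq_suble[OF s(2), of i] by (simp add: J_def)
  have Jlim: "filterlim J sequentially sequentially"
    by (rule filterlim_at_top_mono[OF filterlim_ident]) (simp add: Jge)
  have wJ: "weakly_converges (\<lambda>i. \<mu>s (J i)) \<mu>" by (rule weakly_converges_subseq[OF w Jlim])
  let ?p = "\<lambda>v u::'a. max 0 (u \<bullet> v)"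
  have pl: "(\<lambda>i. \<integral>u. ?p (v (s i)) u \<partial>\<mu>s (J i)) \<longlonglongrightarrow> (\<integral>u. ?p v0 u \<partial>\<mu>)"
  proof (rule weakly_converges_uniform[OF wJ good(1) good(2)])
    show "continuous_on (sphere 0 1) (?p (v (s i)))" "continuous_on (sphere 0 1) (?p v0)" for i
      by (intro continuous_intros)+
    show "uniform_limit (sphere 0 1) (\<lambda>i. ?p (v (s i))) (?p v0) sequentially"
      unfolding uniform_limit_sequentially_iff
    proof (intro allI impI)
      fix e :: real assume "0 < e"
      then obtain N where N: "\<And>i. i \<ge> N \<Longrightarrow> dist (v (s i)) v0 < e" using s(3) unfolding lim_sequentially by auto
      show "\<exists>N. \<forall>n\<ge>N. \<forall>u\<in>sphere 0 1. dist (?p (v (s n)) u) (?p v0 u) < e"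
      proof (intro exI allI impI ballI)
        fix n and u :: 'a assume n: "N \<le> n" and u: "u \<in> sphere 0 1"
        have "\<bar>?p (v (s n)) u - ?p v0 u\<bar> \<le> \<bar>u \<bullet> v (s n) - u \<bullet> v0\<bar>" by linarith
        also have "\<dots> = \<bar>u \<bullet> (v (s n) - v0)\<bar>" by (simp add: inner_diff_right)
        also have "\<dots> \<le> norm u * norm (v (s n) - v0)" by (rule Cauchy_Schwarz_ineq2)
        also have "\<dots> < e" using N[OF n] u by (simp add: dist_norm)
        finally show "dist (?p (v (s n)) u) (?p v0 u) < e" by (simp add: dist_real_def)
      qed
    qed
  qed
  define P where "P = (\<integral>u. ?p v0 u \<partial>\<mu>)"
  have P: "0 < P" unfolding P_def by (rule integral_positive_part_pos[OF good(2) s(1)])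
  define W where "W = measure \<mu> (sphere 0 1)"
  have W: "0 < W" unfolding W_def by (rule good_measureD(4)[OF good(2)])
  \<comment> \<open>This leaves P - \<delta> W = P/2 as the limit of the coefficient.\<close>
  define \<delta> where "\<delta> = P / (2 * W)"
  have \<delta>: "0 < \<delta>" using P W by (simp add: \<delta>_def)
  have lim1: "(\<lambda>i. (\<integral>u. ?p (v (s i)) u \<partial>\<mu>s (J i)) - \<delta> * measure (\<mu>s (J i)) (sphere 0 1)) \<longlonglongrightarrow> P - \<delta> * W"
    unfolding P_def W_def by (intro tendsto_intros pl weakly_converges_mass[OF wJ good(1) good(2)])
  have PW: "0 < P - \<delta> * W" using P W by (simp add: \<delta>_def)
  have lim2: "filterlim (\<lambda>i. \<phi> (norm (y (J i)) * \<delta> / l)) at_top sequentially"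
  proof (rule filterlim_compose[OF phi_top])
    have "filterlim (\<lambda>i. real i * (\<delta> / l)) at_top sequentially"
      using \<delta> l by (intro filterlim_at_top_mult_tendsto_pos[OF tendsto_const _ filterlim_real_sequentially]) simp
    then show "filterlim (\<lambda>i. norm (y (J i)) * \<delta> / l) at_top sequentially"
    proof (rule filterlim_at_top_mono, intro always_eventually allI)
      fix i
      have "real i \<le> real (s i)" using seq_suble[OF s(2), of i] by simp
      also have "\<dots> \<le> norm (y (J i))" using \<rho>N[of "s i"] by (simp add: J_def)
      finally have "real i * (\<delta> / l) \<le> norm (y (J i)) * (\<delta> / l)" using \<delta> l by (intro mult_right_mono) auto
      then show "real i * (\<delta> / l) \<le> norm (y (J i)) * \<delta> / l" by simp
    qed
  qed
  have "filterlim (\<lambda>i. ((\<integral>u. ?p (v (s i)) u \<partial>\<mu>s (J i)) - \<delta> * measure (\<mu>s (J i)) (sphere 0 1)) * \<phi> (norm (y (J i)) * \<delta> / l)) at_top sequentially"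
    by (rule filterlim_tendsto_pos_mult_at_top[OF lim1 PW lim2])
  then have "eventually (\<lambda>i. C < ((\<integral>u. ?p (v (s i)) u \<partial>\<mu>s (J i)) - \<delta> * measure (\<mu>s (J i)) (sphere 0 1)) * \<phi> (norm (y (J i)) * \<delta> / l)) sequentially"
    by (simp add: filterlim_at_top_dense)
  then obtain i where i: "C < ((\<integral>u. ?p (v (s i)) u \<partial>\<mu>s (J i)) - \<delta> * measure (\<mu>s (J i)) (sphere 0 1)) * \<phi> (norm (y (J i)) * \<delta> / l)"
    by (auto simp: eventually_sequentially)
  have "norm (y (J i)) *\<^sub>R v (s i) = y (J i)" using y0[of "s i"] by (simp add: v_def J_def sgn_div_norm)
  then have "norm (y (J i)) *\<^sub>R v (s i) \<in> Qs (J i)" using y(1) by simp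
  from integral_ophi_ge[OF good(1)[of "J i"] Qs l \<delta> vS y0[of "s i", folded J_def] this] C[of "J i"]
  have "\<phi> (norm (y (J i)) * \<delta> / l) * ((\<integral>u. ?p (v (s i)) u \<partial>\<mu>s (J i)) - \<delta> * measure (\<mu>s (J i)) (sphere 0 1)) \<le> C"
    by (rule order_trans)
  with i show False by (simp only: mult.commute[of "\<phi> _"] not_le[symmetric])
qed

text \<open>The direct method for a functional of measure and body: continuity along weakly
  convergent measures and uniformly convergent support functions, plus coercivity with varying
  measures. Attainment is the case of a constant sequence of measures; both minimisation problems
  are instances.\<close>

theorem inf_attained_stable:
  fixes F :: "'a measure \<Rightarrow> 'a set \<Rightarrow> real"
  assumes lim: "\<And>\<mu>s \<mu> Qs Q. weakly_converges \<mu>s \<mu> \<Longrightarrow> (\<And>i. good_measure (\<mu>s i)) \<Longrightarrow> good_measure \<mu> \<Longrightarrow>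
      (\<And>i. Qs i \<in> body_class G) \<Longrightarrow> Q \<in> body_class G \<Longrightarrow>
      uniform_limit (sphere 0 1) (\<lambda>i. support_fun (Qs i)) (support_fun Q) sequentially \<Longrightarrow>
      (\<lambda>i. F (\<mu>s i) (Qs i)) \<longlonglongrightarrow> F \<mu> Q"
    and coer: "\<And>\<mu>s \<mu> Qs C. weakly_converges \<mu>s \<mu> \<Longrightarrow> (\<And>i. good_measure (\<mu>s i)) \<Longrightarrow> good_measure \<mu> \<Longrightarrow>
      (\<And>i. Qs i \<in> body_class G) \<Longrightarrow> (\<And>i. F (\<mu>s i) (Qs i) \<le> C) \<Longrightarrow> \<exists>R. \<forall>i. Qs i \<subseteq> cball 0 R"
    and nonneg: "\<And>\<mu> Q. good_measure \<mu> \<Longrightarrow> Q \<in> body_class G \<Longrightarrow> 0 \<le> F \<mu> Q"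
  shows "good_measure \<mu> \<Longrightarrow> \<exists>Q\<in>body_class G. F \<mu> Q = (INF Q\<in>body_class G. F \<mu> Q)"
    and "weakly_converges \<mu>s \<mu> \<Longrightarrow> (\<And>i. good_measure (\<mu>s i)) \<Longrightarrow> good_measure \<mu> \<Longrightarrow>
      (\<lambda>i. INF Q\<in>body_class G. F (\<mu>s i) Q) \<longlonglongrightarrow> (INF Q\<in>body_class G. F \<mu> Q)"
proof -
  define I where "I \<mu> = (INF Q\<in>body_class G. F \<mu> Q)" for \<mu>
  have ne: "body_class G \<noteq> {}" using cball_in_body_class by blast
  have I_le: "I \<mu> \<le> F \<mu> Q" if "good_measure \<mu>" "Q \<in> body_class G" for \<mu> Q
    unfolding I_def by (rule cINF_lower[OF bdd_belowI2 that(2)]) (rule nonneg[OF that(1)])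
  have I_near: "\<exists>Q\<in>body_class G. F \<mu> Q < a" if "I \<mu> < a" for \<mu> a
  proof (rule ccontr)
    assume "\<not> ?thesis"
    then have "a \<le> I \<mu>" unfolding I_def by (intro cINF_greatest[OF ne]) auto
    then show False using that by simp
  qed
  have limit: "\<exists>Q\<in>body_class G. F \<mu> Q \<le> a"
    if w: "weakly_converges \<mu>s \<mu>" and good: "\<And>i. good_measure (\<mu>s i)" "good_measure \<mu>"
      and Qs: "\<And>i. Qs i \<in> body_class G" and le: "\<And>i. F (\<mu>s i) (Qs i) \<le> b i" and b: "b \<longlonglongrightarrow> a"
    for \<mu>s \<mu> Qs b a
  proof -
    obtain C where C: "\<forall>i. norm (b i) \<le> C"
      using convergent_imp_Bseq[OF convergentI[OF b]] unfolding Bseq_def by blast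
    have "F (\<mu>s i) (Qs i) \<le> C" for i using le[of i] spec[OF C, of i] by simp
    from coer[OF w good Qs this] obtain R where R: "\<forall>i. Qs i \<subseteq> cball 0 R" ..
    obtain r Q where r: "strict_mono (r :: nat \<Rightarrow> nat)" "Q \<in> body_class G"
      "uniform_limit (sphere 0 1) (\<lambda>i. support_fun (Qs (r i))) (support_fun Q) sequentially"
      using body_class_compact[OF Qs spec[OF R]] .
    have "(\<lambda>i. F (\<mu>s (r i)) (Qs (r i))) \<longlonglongrightarrow> F \<mu> Q"
      by (rule lim[OF weakly_converges_subseq[OF w filterlim_subseq[OF r(1)]] good(1) good(2) Qs r(2,3)])
    moreover have "(\<lambda>i. b (r i)) \<longlonglongrightarrow> a" using LIMSEQ_subseq_LIMSEQ[OF b r(1)] by (simp add: o_def)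
    ultimately have "F \<mu> Q \<le> a" by (rule LIMSEQ_le) (use le in blast)
    then show ?thesis using r(2) by blast
  qed
  have small: "(\<lambda>i. a + 1 / real (Suc i)) \<longlonglongrightarrow> a" for a :: real
  proof -
    have "(\<lambda>i. a + 1 / real (Suc i)) \<longlonglongrightarrow> a + 0" by (intro tendsto_intros LIMSEQ_Suc lim_1_over_n)
    then show ?thesis by simp
  qed
  show "\<exists>Q\<in>body_class G. F \<mu> Q = (INF Q\<in>body_class G. F \<mu> Q)" if good: "good_measure \<mu>" for \<mu>
  proof -
    have "\<exists>Q\<in>body_class G. F \<mu> Q < I \<mu> + 1 / real (Suc i)" for i by (rule I_near) simp
    then obtain Qs where Qs: "\<And>i. Qs i \<in> body_class G" "\<And>i. F \<mu> (Qs i) < I \<mu> + 1 / real (Suc i)" by metis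
    from limit[OF weakly_converges_const good good Qs(1) less_imp_le[OF Qs(2)] small]
    obtain Q where Q: "Q \<in> body_class G" "F \<mu> Q \<le> I \<mu>" by blast
    have "F \<mu> Q = I \<mu>" by (rule antisym[OF Q(2) I_le[OF good Q(1)]])
    with Q(1) show ?thesis unfolding I_def by blast
  qed
  assume w: "weakly_converges \<mu>s \<mu>" and good: "\<And>i. good_measure (\<mu>s i)" "good_measure \<mu>"
  show "(\<lambda>i. INF Q\<in>body_class G. F (\<mu>s i) Q) \<longlonglongrightarrow> (INF Q\<in>body_class G. F \<mu> Q)"
    unfolding I_def[symmetric]
  proof (rule order_tendstoI)
    \<comment> \<open>Upper bound: a near-minimiser for \<mu> competes for every
      \<open>\<mu>s i\<close>.\<close>
    fix a assume "I \<mu> < a"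
    then obtain Q where Q: "Q \<in> body_class G" "F \<mu> Q < a" using I_near by blast
    have "(\<lambda>i. F (\<mu>s i) Q) \<longlonglongrightarrow> F \<mu> Q"
      by (rule lim[OF w good Q(1) Q(1)]) (simp add: uniform_limit_const)
    then have "eventually (\<lambda>i. F (\<mu>s i) Q < a) sequentially" using Q(2) by (rule order_tendstoD)
    then show "eventually (\<lambda>i. I (\<mu>s i) < a) sequentially"
      by (rule eventually_mono) (rule le_less_trans[OF I_le[OF good(1) Q(1)]])
  next
    fix a assume a: "a < I \<mu>"
    show "eventually (\<lambda>i. a < I (\<mu>s i)) sequentially"
    proof (rule ccontr)
      assume "\<not> ?thesis"
      then have inf: "infinite {i. I (\<mu>s i) \<le> a}"
        unfolding cofinite_eq_sequentially[symmetric] eventually_cofinite by (simp add: not_less)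
      \<comment> \<open>Infinitely many indices have infimum at most a; near-minimisers along them
        have a limit body whose value for \<mu> is at most a, below its infimum.\<close>
      define r where "r = enumerate {i. I (\<mu>s i) \<le> a}"
      have r: "strict_mono r" "I (\<mu>s (r i)) \<le> a" for i
        using strict_mono_enumerate[OF inf] enumerate_in_set[OF inf, of i] by (auto simp: r_def)
      have "I (\<mu>s (r i)) < a + 1 / real (Suc i)" for i
        by (rule le_less_trans[OF r(2)]) simp
      then have "\<exists>Q\<in>body_class G. F (\<mu>s (r i)) Q < a + 1 / real (Suc i)" for i by (rule I_near)
      then obtain Qs where Qs: "\<And>i. Qs i \<in> body_class G" "\<And>i. F (\<mu>s (r i)) (Qs i) < a + 1 / real (Suc i)" by metis
      have wr: "weakly_converges (\<lambda>i. \<mu>s (r i)) \<mu>" by (rule weakly_converges_subseq[OF w filterlim_subseq[OF r(1)]])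
      from limit[OF wr good(1) good(2) Qs(1) less_imp_le[OF Qs(2)] small]
      obtain Q where "Q \<in> body_class G" "F \<mu> Q \<le> a" by blast
      then show False using I_le[OF good(2)] a by (meson leD order_trans)
    qed
  qed
qed

section \<open>The Orlicz norm\<close>

definition mean_ophi :: "'a measure \<Rightarrow> real \<Rightarrow> 'a set \<Rightarrow> real" where
  "mean_ophi \<mu> l Q = 1 / measure \<mu> (space \<mu>) * (\<integral>u. ophi l Q u \<partial>\<mu>)"

definition onorm_set :: "'a measure \<Rightarrow> 'a set \<Rightarrow> real set" where
  "onorm_set \<mu> Q = {l. l > 0 \<and> mean_ophi \<mu> l Q \<le> 1}"

lemma orlicz_norm_eq: "orlicz_norm \<mu> \<phi> (support_fun Q) = Inf (onorm_set \<mu> Q)"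
  by (simp add: orlicz_norm_def onorm_set_def mean_ophi_def ophi_def)

lemma mass_pos: "good_measure \<nu> \<Longrightarrow> 0 < measure \<nu> (space \<nu>)"
  by (simp only: good_measureD(4,5))

context
  fixes \<mu> :: "'a measure" and Q :: "'a set"
  assumes good: "good_measure \<mu>" and Q: "Q \<in> convex_bodies_o"
begin

lemma mean_ophi_less:
  assumes l: "0 < l" "l < l'" shows "mean_ophi \<mu> l' Q < mean_ophi \<mu> l Q"
proof -
  interpret finite_measure \<mu> by (rule good_measureD(2)[OF good])
  have "(\<integral>u. ophi l' Q u \<partial>\<mu>) < (\<integral>u. ophi l Q u \<partial>\<mu>)"
  proof (rule integral_less_AE_space)
    show "integrable \<mu> (ophi l' Q)" "integrable \<mu> (ophi l Q)" using l by (auto intro!: integrable_ophi[OF good Q])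
    show "AE u in \<mu>. ophi l' Q u < ophi l Q u"
    proof (rule AE_I2)
      fix u assume "u \<in> space \<mu>"
      then have "u \<in> sphere 0 1" by (simp only: good_measureD(3)[OF good])
      then have "0 < support_fun Q u" by (rule support_fun_pos[OF Q])
      then show "ophi l' Q u < ophi l Q u" unfolding ophi_def using l
        by (intro phi_less divide_pos_pos divide_strict_left_mono mult_pos_pos) auto
    qed
    show "emeasure \<mu> (space \<mu>) \<noteq> 0" using mass_pos[OF good] by (auto simp: measure_def)
  qed
  then show ?thesis unfolding mean_ophi_def using mass_pos[OF good] by (intro mult_strict_left_mono) auto
qed

text \<open>Because \<phi> 1 = 1, comparing l with the extreme values of the support function
  decides on which side of 1 the mean lies. This shows that admissible scales exist and that very
  small scales are not admissible.\<close>

lemma mean_ophi_compare_1: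
  shows "(\<And>u. u \<in> sphere 0 1 \<Longrightarrow> support_fun Q u \<le> l) \<Longrightarrow> 0 < l \<Longrightarrow> mean_ophi \<mu> l Q \<le> 1"
    and "(\<And>u. u \<in> sphere 0 1 \<Longrightarrow> l \<le> support_fun Q u) \<Longrightarrow> 0 < l \<Longrightarrow> 1 \<le> mean_ophi \<mu> l Q"
proof -
  interpret finite_measure \<mu> by (rule good_measureD(2)[OF good])
  note sp = good_measureD(3)[OF good]
  assume l: "0 < l"
  have i: "integrable \<mu> (ophi l Q)" by (rule integrable_ophi[OF good Q l])
  have one: "(\<integral>u. (1::real) \<partial>\<mu>) = measure \<mu> (space \<mu>)" by simp
  show "mean_ophi \<mu> l Q \<le> 1" if le: "\<And>u. u \<in> sphere 0 1 \<Longrightarrow> support_fun Q u \<le> l"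
  proof -
    have "(\<integral>u. ophi l Q u \<partial>\<mu>) \<le> (\<integral>u. (1::real) \<partial>\<mu>)"
    proof (rule integral_mono[OF i])
      fix u assume "u \<in> space \<mu>"
      then have u: "u \<in> sphere 0 1" using sp by simp
      have "\<phi> (support_fun Q u / l) \<le> \<phi> 1"
        using support_fun_pos[OF Q u] le[OF u] l by (intro phi_mono) auto
      then show "ophi l Q u \<le> 1" by (simp add: ophi_def phi_1)
    qed simp
    then show ?thesis unfolding one mean_ophi_def using mass_pos[OF good] by (simp add: field_simps)
  qed
  show "1 \<le> mean_ophi \<mu> l Q" if le: "\<And>u. u \<in> sphere 0 1 \<Longrightarrow> l \<le> support_fun Q u"
  proof -
    have "(\<integral>u. (1::real) \<partial>\<mu>) \<le> (\<integral>u. ophi l Q u \<partial>\<mu>)"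
    proof (rule integral_mono[OF _ i])
      fix u assume "u \<in> space \<mu>"
      then have u: "u \<in> sphere 0 1" using sp by simp
      have "\<phi> 1 \<le> \<phi> (support_fun Q u / l)"
        using le[OF u] l by (intro phi_mono) auto
      then show "1 \<le> ophi l Q u" by (simp add: ophi_def phi_1)
    qed simp
    then show ?thesis unfolding one mean_ophi_def using mass_pos[OF good] by (simp add: field_simps)
  qed
qed

lemma onorm_set_nonempty: "onorm_set \<mu> Q \<noteq> {}"
proof -
  obtain a b where ab: "0 < a" "a \<le> b" "\<forall>u::'a \<in> sphere 0 1. a \<le> support_fun Q u \<and> support_fun Q u \<le> b"
    using support_fun_sphere_bounds[OF Q] .
  have "b \<in> onorm_set \<mu> Q" unfolding onorm_set_def using ab by (auto intro!: mean_ophi_compare_1)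
  then show ?thesis by blast
qed

lemma onorm_less_iff: "Inf (onorm_set \<mu> Q) < a \<Longrightarrow> \<exists>l\<in>onorm_set \<mu> Q. l < a"
  by (rule cInf_lessD[OF onorm_set_nonempty])

lemma bdd_below_onorm_set: "bdd_below (onorm_set \<mu> Q)"
  by (rule bdd_belowI[of _ 0]) (simp add: onorm_set_def)

lemma onorm_le: "0 < l \<Longrightarrow> mean_ophi \<mu> l Q \<le> 1 \<Longrightarrow> Inf (onorm_set \<mu> Q) \<le> l"
  by (rule cInf_lower[OF _ bdd_below_onorm_set]) (simp add: onorm_set_def)

text \<open>As the mean decreases strictly in l, a scale with mean above 1 lies below every
  admissible scale.\<close>

lemma onorm_ge:
  assumes a: "0 < a" "1 < mean_ophi \<mu> a Q" shows "a \<le> Inf (onorm_set \<mu> Q)"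
proof (rule cInf_greatest[OF onorm_set_nonempty])
  fix l assume l: "l \<in> onorm_set \<mu> Q"
  show "a \<le> l"
  proof (rule ccontr)
    assume "\<not> a \<le> l"
    then have "mean_ophi \<mu> a Q < mean_ophi \<mu> l Q" using l by (intro mean_ophi_less) (auto simp: onorm_set_def)
    then show False using l a by (simp add: onorm_set_def)
  qed
qed

lemma onorm_pos: "0 < Inf (onorm_set \<mu> Q)"
proof -
  obtain a b where ab: "0 < a" "a \<le> b" "\<forall>u::'a \<in> sphere 0 1. a \<le> support_fun Q u \<and> support_fun Q u \<le> b"
    using support_fun_sphere_bounds[OF Q] .
  have "1 \<le> mean_ophi \<mu> a Q" by (rule mean_ophi_compare_1(2)) (use ab in auto)
  also have "\<dots> < mean_ophi \<mu> (a / 2) Q" using ab by (intro mean_ophi_less) auto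
  finally have "a / 2 \<le> Inf (onorm_set \<mu> Q)" using ab by (intro onorm_ge) auto
  then show ?thesis using ab by linarith
qed

lemma mean_ophi_le_1:
  assumes "Inf (onorm_set \<mu> Q) < a" shows "mean_ophi \<mu> a Q < 1"
proof -
  obtain l where l: "l \<in> onorm_set \<mu> Q" "l < a" using onorm_less_iff[OF assms] by blast
  then show ?thesis using mean_ophi_less[of l a] by (simp add: onorm_set_def)
qed

end

lemma mean_ophi_LIMSEQ:
  assumes w: "weakly_converges \<mu>s \<mu>" and good: "\<And>i. good_measure (\<mu>s i)" "good_measure \<mu>"
    and Qs: "\<And>i. Qs i \<in> convex_bodies_o" and Q: "Q \<in> convex_bodies_o" and l: "0 < l"
    and unif: "uniform_limit (sphere 0 1) (\<lambda>i. support_fun (Qs i)) (support_fun Q) sequentially"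
  shows "(\<lambda>i. mean_ophi (\<mu>s i) l (Qs i)) \<longlonglongrightarrow> mean_ophi \<mu> l Q"
proof -
  have "(\<lambda>i. measure (\<mu>s i) (space (\<mu>s i))) \<longlonglongrightarrow> measure \<mu> (space \<mu>)"
    using weakly_converges_mass[OF w good] good_measureD(5)[OF good(1)] good_measureD(5)[OF good(2)] by simp
  moreover have "measure \<mu> (space \<mu>) \<noteq> 0" using mass_pos[OF good(2)] by simp
  ultimately show ?thesis
    unfolding mean_ophi_def by (intro tendsto_intros integral_ophi_LIMSEQ[OF w good Qs Q l unif])
qed

text \<open>The norm is where \<open>mean_ophi\<close>, strictly decreasing in the scale, crosses
  the level 1. Pointwise convergence in the scale, tested at a point strictly between a and the
  limit norm, therefore localises the crossing.\<close>

lemma orlicz_norm_LIMSEQ: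
  fixes \<mu> :: "'a measure"
  assumes w: "weakly_converges \<mu>s \<mu>" and good: "\<And>i. good_measure (\<mu>s i)" "good_measure \<mu>"
    and Qs: "\<And>i. Qs i \<in> convex_bodies_o" and Q: "Q \<in> convex_bodies_o"
    and unif: "uniform_limit (sphere 0 1) (\<lambda>i. support_fun (Qs i)) (support_fun Q) sequentially"
  shows "(\<lambda>i. orlicz_norm (\<mu>s i) \<phi> (support_fun (Qs i))) \<longlonglongrightarrow> orlicz_norm \<mu> \<phi> (support_fun Q)"
  unfolding orlicz_norm_eq
proof (rule order_tendstoI)
  have lim: "(\<lambda>i. mean_ophi (\<mu>s i) l (Qs i)) \<longlonglongrightarrow> mean_ophi \<mu> l Q" if "0 < l" for l
    by (rule mean_ophi_LIMSEQ[OF w good Qs Q that unif])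
  fix a assume a: "Inf (onorm_set \<mu> Q) < a"
  define b where "b = (Inf (onorm_set \<mu> Q) + a) / 2"
  have b: "Inf (onorm_set \<mu> Q) < b" "b < a" using a by (auto simp: b_def)
  have b0: "0 < b" using onorm_pos[OF good(2) Q] b(1) by linarith
  have "eventually (\<lambda>i. mean_ophi (\<mu>s i) b (Qs i) < 1) sequentially"
    by (rule order_tendstoD(2)[OF lim[OF b0] mean_ophi_le_1[OF good(2) Q b(1)]])
  then show "eventually (\<lambda>i. Inf (onorm_set (\<mu>s i) (Qs i)) < a) sequentially"
  proof eventually_elim
    case (elim i)
    then show ?case using onorm_le[OF good(1) Qs b0, of i i] b(2) by simp
  qed
next
  have lim: "(\<lambda>i. mean_ophi (\<mu>s i) l (Qs i)) \<longlonglongrightarrow> mean_ophi \<mu> l Q" if "0 < l" for l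
    by (rule mean_ophi_LIMSEQ[OF w good Qs Q that unif])
  fix a assume a: "a < Inf (onorm_set \<mu> Q)"
  \<comment> \<open>\<open>max a 0\<close> keeps the test point positive when a is negative.\<close>
  define b where "b = (max a 0 + Inf (onorm_set \<mu> Q)) / 2"
  have b: "a < b" "0 < b" "b < Inf (onorm_set \<mu> Q)" using a onorm_pos[OF good(2) Q] by (auto simp: b_def)
  have "1 < mean_ophi \<mu> b Q"
  proof (rule ccontr)
    assume "\<not> ?thesis"
    then show False using onorm_le[OF good(2) Q b(2)] b(3) by simp
  qed
  then have "eventually (\<lambda>i. 1 < mean_ophi (\<mu>s i) b (Qs i)) sequentially"
    by (rule order_tendstoD(1)[OF lim[OF b(2)]])
  then show "eventually (\<lambda>i. a < Inf (onorm_set (\<mu>s i) (Qs i))) sequentially"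
  proof eventually_elim
    case (elim i)
    then show ?case using onorm_ge[OF good(1) Qs b(2), of i i] b(1) by simp
  qed
qed

text \<open>At the scale C + 1, strictly above every norm, the mean is below 1 whether or not the
  infimum in the norm is attained; multiplying by the bounded masses gives the integral bound that
  \<open>uniformly_bounded\<close> asks for.\<close>

lemma orlicz_norm_coercive:
  fixes \<mu> :: "'a measure"
  assumes w: "weakly_converges \<mu>s \<mu>" and good: "\<And>i. good_measure (\<mu>s i)" "good_measure \<mu>"
    and Qs: "\<And>i. Qs i \<in> convex_bodies_o"
    and C: "\<And>i. orlicz_norm (\<mu>s i) \<phi> (support_fun (Qs i)) \<le> C"
  shows "\<exists>R. \<forall>i. Qs i \<subseteq> cball 0 R"
proof -
  obtain W where "\<forall>i. norm (measure (\<mu>s i) (sphere 0 1)) \<le> W"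
    using convergent_imp_Bseq[OF convergentI[OF weakly_converges_mass[OF w good]]] unfolding Bseq_def by blast
  then have W: "measure (\<mu>s i) (sphere 0 1) \<le> W" for i by simp
  have C0: "0 < C + 1"
    using onorm_pos[OF good(1) Qs, of 0 0] C[of 0] unfolding orlicz_norm_eq by linarith
  have "(\<integral>u. ophi (C + 1) (Qs i) u \<partial>\<mu>s i) \<le> W" for i
  proof -
    have "Inf (onorm_set (\<mu>s i) (Qs i)) < C + 1" using C[of i] unfolding orlicz_norm_eq by linarith
    then have "mean_ophi (\<mu>s i) (C + 1) (Qs i) < 1" by (rule mean_ophi_le_1[OF good(1) Qs])
    then have "(\<integral>u. ophi (C + 1) (Qs i) u \<partial>\<mu>s i) < measure (\<mu>s i) (space (\<mu>s i))"
      using mass_pos[OF good(1)] by (simp add: mean_ophi_def field_simps)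
    then show ?thesis using W[of i] good_measureD(5)[OF good(1)] by simp
  qed
  then show ?thesis by (rule uniformly_bounded[OF w good Qs C0])
qed

lemma integral_inf_attained_stable:
  shows "good_measure \<mu> \<Longrightarrow> \<exists>Q\<in>body_class G. (\<integral>u. \<phi> (support_fun Q u) \<partial>\<mu>) = (INF Q\<in>body_class G. \<integral>u. \<phi> (support_fun Q u) \<partial>\<mu>)"
    and "weakly_converges \<mu>s \<mu> \<Longrightarrow> (\<And>i. good_measure (\<mu>s i)) \<Longrightarrow> good_measure \<mu> \<Longrightarrow>
      (\<lambda>i. INF Q\<in>body_class G. \<integral>u. \<phi> (support_fun Q u) \<partial>\<mu>s i) \<longlonglongrightarrow> (INF Q\<in>body_class G. \<integral>u. \<phi> (support_fun Q u) \<partial>\<mu>)"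
proof -
  define F where "F \<mu> Q = (\<integral>u. \<phi> (support_fun Q u) \<partial>\<mu>)" for \<mu> :: "'a measure" and Q
  have F: "F \<mu> Q = (\<integral>u. ophi 1 Q u \<partial>\<mu>)" for \<mu> Q by (simp add: F_def ophi_def)
  have lim: "(\<lambda>i. F (\<mu>s i) (Qs i)) \<longlonglongrightarrow> F \<mu> Q"
    if "weakly_converges \<mu>s \<mu>" "\<And>i. good_measure (\<mu>s i)" "good_measure \<mu>"
      "\<And>i. Qs i \<in> body_class G" "Q \<in> body_class G"
      "uniform_limit (sphere 0 1) (\<lambda>i. support_fun (Qs i)) (support_fun Q) sequentially" for \<mu>s \<mu> Qs Q
    unfolding F
    by (rule integral_ophi_LIMSEQ[OF that(1-3) body_class_convex_bodies[OF that(4)]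
          body_class_convex_bodies[OF that(5)] zero_less_one that(6)])
  have coer: "\<exists>R. \<forall>i. Qs i \<subseteq> cball 0 R"
    if "weakly_converges \<mu>s \<mu>" "\<And>i. good_measure (\<mu>s i)" "good_measure \<mu>"
      "\<And>i. Qs i \<in> body_class G" "\<And>i. F (\<mu>s i) (Qs i) \<le> C" for \<mu>s \<mu> Qs C
    by (rule uniformly_bounded[OF that(1-3) body_class_convex_bodies[OF that(4)] zero_less_one that(5)[unfolded F]])
  have nonneg: "0 \<le> F \<mu> Q" if "good_measure \<mu>" "Q \<in> body_class G" for \<mu> Q
    unfolding F by (rule integral_ophi_nonneg[OF that(1) body_class_convex_bodies[OF that(2)] zero_less_one])
  have "\<exists>Q\<in>body_class G. F \<mu> Q = (INF Q\<in>body_class G. F \<mu> Q)" if "good_measure \<mu>"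
    by (rule inf_attained_stable(1)[where F = F and \<mu> = \<mu>], fact lim, fact coer, fact nonneg, fact that)
  note attained = this
  have "(\<lambda>i. INF Q\<in>body_class G. F (\<mu>s i) Q) \<longlonglongrightarrow> (INF Q\<in>body_class G. F \<mu> Q)"
    if "weakly_converges \<mu>s \<mu>" "\<And>i. good_measure (\<mu>s i)" "good_measure \<mu>"
    by (rule inf_attained_stable(2)[where F = F and \<mu> = \<mu> and \<mu>s = \<mu>s], fact lim, fact coer, fact nonneg)
      (fact that)+
  note stable = this
  show "\<exists>Q\<in>body_class G. (\<integral>u. \<phi> (support_fun Q u) \<partial>\<mu>) = (INF Q\<in>body_class G. \<integral>u. \<phi> (support_fun Q u) \<partial>\<mu>)"
    if "good_measure \<mu>"
    using attained[OF that] by (simp only: F_def)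
  show "(\<lambda>i. INF Q\<in>body_class G. \<integral>u. \<phi> (support_fun Q u) \<partial>\<mu>s i) \<longlonglongrightarrow> (INF Q\<in>body_class G. \<integral>u. \<phi> (support_fun Q u) \<partial>\<mu>)"
    if "weakly_converges \<mu>s \<mu>" "\<And>i. good_measure (\<mu>s i)" "good_measure \<mu>"
    using stable[OF that] by (simp only: F_def)
qed

lemma orlicz_norm_inf_attained_stable:
  shows "good_measure \<mu> \<Longrightarrow> \<exists>Q\<in>body_class G. orlicz_norm \<mu> \<phi> (support_fun Q) = (INF Q\<in>body_class G. orlicz_norm \<mu> \<phi> (support_fun Q))"
    and "weakly_converges \<mu>s \<mu> \<Longrightarrow> (\<And>i. good_measure (\<mu>s i)) \<Longrightarrow> good_measure \<mu> \<Longrightarrow>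
      (\<lambda>i. INF Q\<in>body_class G. orlicz_norm (\<mu>s i) \<phi> (support_fun Q)) \<longlonglongrightarrow> (INF Q\<in>body_class G. orlicz_norm \<mu> \<phi> (support_fun Q))"
proof -
  define F where "F \<mu> Q = orlicz_norm \<mu> \<phi> (support_fun Q)" for \<mu> :: "'a measure" and Q
  have lim: "(\<lambda>i. F (\<mu>s i) (Qs i)) \<longlonglongrightarrow> F \<mu> Q"
    if "weakly_converges \<mu>s \<mu>" "\<And>i. good_measure (\<mu>s i)" "good_measure \<mu>"
      "\<And>i. Qs i \<in> body_class G" "Q \<in> body_class G"
      "uniform_limit (sphere 0 1) (\<lambda>i. support_fun (Qs i)) (support_fun Q) sequentially" for \<mu>s \<mu> Qs Q
    unfolding F_def
    by (rule orlicz_norm_LIMSEQ[OF that(1-3) body_class_convex_bodies[OF that(4)]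
          body_class_convex_bodies[OF that(5)] that(6)])
  have coer: "\<exists>R. \<forall>i. Qs i \<subseteq> cball 0 R"
    if "weakly_converges \<mu>s \<mu>" "\<And>i. good_measure (\<mu>s i)" "good_measure \<mu>"
      "\<And>i. Qs i \<in> body_class G" "\<And>i. F (\<mu>s i) (Qs i) \<le> C" for \<mu>s \<mu> Qs C
    by (rule orlicz_norm_coercive[OF that(1-3) body_class_convex_bodies[OF that(4)] that(5)[unfolded F_def]])
  have nonneg: "0 \<le> F \<mu> Q" if "good_measure \<mu>" "Q \<in> body_class G" for \<mu> Q
    unfolding F_def orlicz_norm_eq
    by (rule less_imp_le[OF onorm_pos[OF that(1) body_class_convex_bodies[OF that(2)]]])
  have "\<exists>Q\<in>body_class G. F \<mu> Q = (INF Q\<in>body_class G. F \<mu> Q)" if "good_measure \<mu>"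
    by (rule inf_attained_stable(1)[where F = F and \<mu> = \<mu>], fact lim, fact coer, fact nonneg, fact that)
  note attained = this
  have "(\<lambda>i. INF Q\<in>body_class G. F (\<mu>s i) Q) \<longlonglongrightarrow> (INF Q\<in>body_class G. F \<mu> Q)"
    if "weakly_converges \<mu>s \<mu>" "\<And>i. good_measure (\<mu>s i)" "good_measure \<mu>"
    by (rule inf_attained_stable(2)[where F = F and \<mu> = \<mu> and \<mu>s = \<mu>s], fact lim, fact coer, fact nonneg)
      (fact that)+
  note stable = this
  show "\<exists>Q\<in>body_class G. orlicz_norm \<mu> \<phi> (support_fun Q) = (INF Q\<in>body_class G. orlicz_norm \<mu> \<phi> (support_fun Q))"
    if "good_measure \<mu>"
    using attained[OF that] by (simp only: F_def)
  show "(\<lambda>i. INF Q\<in>body_class G. orlicz_norm (\<mu>s i) \<phi> (support_fun Q)) \<longlonglongrightarrow> (INF Q\<in>body_class G. orlicz_norm \<mu> \<phi> (support_fun Q))"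
    if "weakly_converges \<mu>s \<mu>" "\<And>i. good_measure (\<mu>s i)" "good_measure \<mu>"
    using stable[OF that] by (simp only: F_def)
qed

end

theorem theorem5p10:
  fixes \<phi> :: "real \<Rightarrow> real"
    and G :: "real \<Rightarrow> real ^ 'n \<Rightarrow> real"
  assumes n: "CARD('n) \<ge> 2"
    and \<phi>: "orlicz_fun \<phi>"
    and G_cont: "continuous_on ({0<..} \<times> sphere 0 1) (\<lambda>(t, u). G t u)"
    and G_pos: "\<forall>t>0. \<forall>u\<in>sphere 0 1. G t u > 0"
    and G_growth: "\<exists>q :: real. 1 - real CARD('n) < q \<and> q < 0 \<and>
      (INF (t, u) \<in> {1..} \<times> sphere 0 1. G t u / t powr q) > 0"
  shows
    "(\<forall>\<mu> :: (real ^ 'n) measure.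
        nonzero_finite_sphere_measure \<mu> \<and> not_concentrated_on_hemisphere \<mu> \<longrightarrow>
        (\<exists>M\<^sub>1 \<in> body_class G. \<exists>M\<^sub>2 \<in> body_class G.
           (\<integral>u. \<phi> (support_fun M\<^sub>1 u) \<partial>\<mu>) =
             (INF Q \<in> body_class G. \<integral>u. \<phi> (support_fun Q u) \<partial>\<mu>) \<and>
           orlicz_norm \<mu> \<phi> (support_fun M\<^sub>2) =
             (INF Q \<in> body_class G. orlicz_norm \<mu> \<phi> (support_fun Q)))) \<and>
     (\<forall>(\<mu>s :: nat \<Rightarrow> (real ^ 'n) measure) (\<mu> :: (real ^ 'n) measure).
        (\<forall>i. nonzero_finite_sphere_measure (\<mu>s i) \<and> not_concentrated_on_hemisphere (\<mu>s i)) \<and>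
        nonzero_finite_sphere_measure \<mu> \<and> not_concentrated_on_hemisphere \<mu> \<and>
        weakly_converges \<mu>s \<mu> \<longrightarrow>
        (\<lambda>i. INF Q \<in> body_class G. \<integral>u. \<phi> (support_fun Q u) \<partial>\<mu>s i)
          \<longlonglongrightarrow> (INF Q \<in> body_class G. \<integral>u. \<phi> (support_fun Q u) \<partial>\<mu>) \<and>
        (\<lambda>i. INF Q \<in> body_class G. orlicz_norm (\<mu>s i) \<phi> (support_fun Q))
          \<longlonglongrightarrow> (INF Q \<in> body_class G. orlicz_norm \<mu> \<phi> (support_fun Q)))"
proof -
  have dim: "DIM(real ^ 'n) \<ge> 2" using n by simp
  obtain q where q: "1 - real CARD('n) < q" "q < 0"
    "(INF (t, u) \<in> {1..} \<times> sphere 0 1. G t u / t powr q) > 0"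
    using G_growth by blast
  obtain \<kappa> where \<kappa>: "0 < \<kappa>" "\<And>(e::real ^ 'n) E. norm e = 1 \<Longrightarrow> E \<in> sets borel \<Longrightarrow>
      emeasure (hplane_product e) E = ennreal \<kappa> * emeasure lborel E"
    using hplane_product_eq_lborel[OF dim] by metis
  \<comment> \<open>\<kappa> is fixed for the space before any body is chosen, so it is common to
    all general volumes that are compared.\<close>
  interpret orlicz_setting \<phi> G \<kappa> q
  proof
    show "1 - real DIM(real ^ 'n) < q" using q by simp
    show "0 < G t u" if "0 < t" "u \<in> sphere 0 1" for t u using G_pos that by blast
  qed (use dim \<phi> G_cont q \<kappa> in blast)+
  show ?thesis
    unfolding good_measure_def[symmetric]
    using integral_inf_attained_stable orlicz_norm_inf_attained_stable
    by (simp only: good_measure_def[symmetric] conj_assoc[symmetric]) blast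
qed

end
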